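(* Let $b:\mathbb{R}\to\mathbb{R}^+$, $\alpha:\mathbb{R}\to[c,d]\subset(0,2)$ and $h:\mathbb{R}\to(0,1)$ be continuously differentiable. Let $(\Gamma_i)_{i\ge1}$ be the sequence of arrival times of a Poisson process with unit rate, let $(V_i)_{i\ge1}$ be a sequence of i.i.d. random variables with distribution $\hat m(dx)=\frac{3}{\pi^2}\sum_{j=1}^{\infty}j^{-2}\,\mathbf{1}_{[-j,-j+1)\cup[j-1,j)}(x)\,dx$ on $\mathbb{R}$, and let $(\gamma_i)_{i\ge1}$ be a sequence of i.i.d. random variables with $P(\gamma_i=1)=P(\gamma_i=-1)=1/2$. Assume that the three sequences $(\Gamma_i)_{i\ge1}$, $(V_i)_{i\ge1}$, $(\gamma_i)_{i\ge1}$ are independent, and define for $t\in\mathbb{R}$ $$Y(t)=b(t)\,C_{\alpha(t)}^{1/\alpha(t)}\sum_{i,j=1}^{\infty}\gamma_i\,\Gamma_i^{-1/\alpha(t)}\Big(|t-V_i|^{h(t)-1/\alpha(t)}-|V_i|^{h(t)-1/\alpha(t)}\Big)\Big(\frac{\pi^2j^2}{3}\Big)^{1/\alpha(t)}\mathbf{1}_{[-j,-j+1)\cup[j-1,j)}(V_i).$$ Then $Y$ is $h(u)$-localisable at all $u\in\mathbb{R}$, with local form $Y'_u=b(u)L_{\alpha(u),h(u)}$, where $L_{\alpha,H}$ is well-balanced linear fractional $\alpha$-stable motion.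
   Context: $\mathbb{R}^+$ denotes the positive reals, and $C_\alpha=\left(\int_0^\infty x^{-\alpha}\sin(x)\,dx\right)^{-1}$. In the double sum, for each $i$ exactly one index $j$ gives a non-zero indicator; the sum over $j$ is performed first. For $\alpha\in(0,2)$ and $H\in(0,1)$, $$L_{\alpha,H}(t)=\int_{-\infty}^{\infty}\Big(|t-x|^{H-1/\alpha}-|x|^{H-1/\alpha}\Big)M(dx)\qquad(t\in\mathbb{R}),$$ where $M$ is a symmetric $\alpha$-stable random measure on $\mathbb{R}$ with Lebesgue control measure; i.e. for measurable $f$ with $\int|f|^\alpha dx<\infty$, $\int f\,dM$ is symmetric $\alpha$-stable with characteristic function $\theta\mapsto\exp(-|\theta|^\alpha\int|f(x)|^\alpha dx)$, and $f\mapsto\int f\,dM$ is linear. Localisability: a process $Y=\{Y(t):t\in\mathbb{R}\}$ is $h$-localisable at $u$ if there is a non-trivial process $Y'_u=\{Y'_u(t):t\in\mathbb{R}\}$, called the local form of $Y$ at $u$, such that $r^{-h}(Y(u+rt)-Y(u))\to Y'_u(t)$ as $r\to0$ ($r>0$) in the sense of convergence of finite-dimensional distributions (as processes in $t$). Local forms are identified up to equality of finite-dimensional distributions.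
   Formalization: At u with h(u)=1/α(u) the process L_{α(u),h(u)} is identically zero, so it is not a non-trivial local form; there only the convergence of the rescaled increments to b(u)L_{α(u),h(u)} is claimed. Full localisability is claimed at all other u. *)

theory Defs
  imports "HOL-Probability.Probability"
begin

definition stoch_process :: "'a measure \<Rightarrow> (real \<Rightarrow> 'a \<Rightarrow> real) \<Rightarrow> bool" where
  "stoch_process M X \<longleftrightarrow> prob_space M \<and> (\<forall>t. X t \<in> borel_measurable M)"

text \<open>
  Weak convergence of the vectors \<open>(X r (t 0), \<dots>, X r (t (n - 1)))\<close> for all \<open>n\<close> and all times.
  A vector of length \<open>n\<close> is padded with zeros to a point of \<open>nat \<Rightarrow> real\<close>, which carries the
  product topology, so that the restrictions of the test functions \<open>g\<close> to padded vectors are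
  exactly the bounded continuous functions of \<open>n\<close> real variables. The limit process may live on
  another probability space.
\<close>

definition fdd_tendsto ::
    "'a measure \<Rightarrow> ('r \<Rightarrow> real \<Rightarrow> 'a \<Rightarrow> real) \<Rightarrow> 'b measure \<Rightarrow> (real \<Rightarrow> 'b \<Rightarrow> real)
      \<Rightarrow> 'r filter \<Rightarrow> bool" where
  "fdd_tendsto M X N Z F \<longleftrightarrow>
    (\<forall>(n::nat) (t :: nat \<Rightarrow> real) (g :: (nat \<Rightarrow> real) \<Rightarrow> real).
      continuous_on UNIV g \<and> bounded (range g) \<longrightarrow>
      ((\<lambda>r. integral\<^sup>L M (\<lambda>\<omega>. g (\<lambda>i. if i < n then X r (t i) \<omega> else 0))) \<longlongrightarrow>
        integral\<^sup>L N (\<lambda>\<omega>. g (\<lambda>i. if i < n then Z (t i) \<omega> else 0))) F)"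

definition rescaled_increment ::
    "(real \<Rightarrow> 'a \<Rightarrow> real) \<Rightarrow> real \<Rightarrow> real \<Rightarrow> real \<Rightarrow> real \<Rightarrow> 'a \<Rightarrow> real" where
  "rescaled_increment Y h u r t \<omega> = r powr (- h) * (Y (u + r * t) \<omega> - Y u \<omega>)"

definition fdd_tangent ::
    "'a measure \<Rightarrow> (real \<Rightarrow> 'a \<Rightarrow> real) \<Rightarrow> real \<Rightarrow> real \<Rightarrow> 'b measure \<Rightarrow> (real \<Rightarrow> 'b \<Rightarrow> real)
      \<Rightarrow> bool" where
  "fdd_tangent M Y h u N Y' \<longleftrightarrow>
    stoch_process M Y \<and> stoch_process N Y' \<and>
    fdd_tendsto M (rescaled_increment Y h u) N Y' (at_right 0)"

definition nontrivial_process :: "'b measure \<Rightarrow> (real \<Rightarrow> 'b \<Rightarrow> real) \<Rightarrow> bool" where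
  "nontrivial_process N Z \<longleftrightarrow> (\<exists>t. \<not> (AE \<omega> in N. Z t \<omega> = 0))"

text \<open>\<open>Y\<close> is \<open>h\<close>-localisable at \<open>u\<close>, with local form \<open>Y'\<close>.\<close>

definition localisable_with ::
    "'a measure \<Rightarrow> (real \<Rightarrow> 'a \<Rightarrow> real) \<Rightarrow> real \<Rightarrow> real \<Rightarrow> 'b measure \<Rightarrow> (real \<Rightarrow> 'b \<Rightarrow> real)
      \<Rightarrow> bool" where
  "localisable_with M Y h u N Y' \<longleftrightarrow> fdd_tangent M Y h u N Y' \<and> nontrivial_process N Y'"

text \<open>
  \<open>I f\<close> is the integral of \<open>f\<close> with respect to a symmetric \<open>\<alpha>\<close>-stable random measure with
  Lebesgue control measure; its values outside the class \<open>stable_integrand \<alpha>\<close> are irrelevant.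
\<close>

definition stable_integrand :: "real \<Rightarrow> (real \<Rightarrow> real) set" where
  "stable_integrand \<alpha> =
    {f \<in> borel_measurable lborel. integrable lborel (\<lambda>x. \<bar>f x\<bar> powr \<alpha>)}"

definition sas_integral :: "'b measure \<Rightarrow> real \<Rightarrow> ((real \<Rightarrow> real) \<Rightarrow> 'b \<Rightarrow> real) \<Rightarrow> bool" where
  "sas_integral N \<alpha> I \<longleftrightarrow>
    prob_space N \<and>
    (\<forall>f \<in> stable_integrand \<alpha>. I f \<in> borel_measurable N \<and>
      (\<forall>\<theta>. char (distr N borel (I f)) \<theta> =
        complex_of_real (exp (- (\<bar>\<theta>\<bar> powr \<alpha> * (\<integral>x. \<bar>f x\<bar> powr \<alpha> \<partial>lborel)))))) \<and>
    (\<forall>f \<in> stable_integrand \<alpha>. \<forall>g \<in> stable_integrand \<alpha>. \<forall>p q.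
      AE \<omega> in N. I (\<lambda>x. p * f x + q * g x) \<omega> = p * I f \<omega> + q * I g \<omega>)"

text \<open>
  Well-balanced linear fractional stable motion. For \<open>H = 1 / \<alpha>\<close> the kernel vanishes almost everywhere
  and the process is trivial, so it can be a limit in the sense of \<open>fdd_tangent\<close> but not a local form.
\<close>

definition lfsm :: "((real \<Rightarrow> real) \<Rightarrow> 'b \<Rightarrow> real) \<Rightarrow> real \<Rightarrow> real \<Rightarrow> real \<Rightarrow> 'b \<Rightarrow> real" where
  "lfsm I \<alpha> H t = I (\<lambda>x. \<bar>t - x\<bar> powr (H - 1 / \<alpha>) - \<bar>x\<bar> powr (H - 1 / \<alpha>))"

definition poisson_process :: "'a measure \<Rightarrow> real \<Rightarrow> (real \<Rightarrow> 'a \<Rightarrow> nat) \<Rightarrow> bool" where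
  "poisson_process M rate N \<longleftrightarrow>
    prob_space M \<and>
    (\<forall>t \<ge> 0. N t \<in> measurable M (count_space UNIV)) \<and>
    (AE \<omega> in M. N 0 \<omega> = 0 \<and> mono_on {0..} (\<lambda>t. N t \<omega>) \<and>
      (\<forall>t \<ge> 0. continuous (at_right t) (\<lambda>s. N s \<omega>))) \<and>
    (\<forall>t n. 0 \<le> t 0 \<and> incseq t \<longrightarrow>
      prob_space.indep_vars M (\<lambda>_. count_space UNIV)
        (\<lambda>k \<omega>. N (t (Suc k)) \<omega> - N (t k) \<omega>) {..<n::nat}) \<and>
    (\<forall>s t. 0 \<le> s \<and> s < t \<longrightarrow>
      distr M (count_space UNIV) (\<lambda>\<omega>. N t \<omega> - N s \<omega>) =
        measure_pmf (poisson_pmf (rate * (t - s))))"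

text \<open>Sequences are indexed from \<open>0\<close>: \<open>\<Gamma> i\<close> is the \<open>(i + 1)\<close>-st arrival time.\<close>

definition poisson_arrival_times :: "'a measure \<Rightarrow> real \<Rightarrow> (nat \<Rightarrow> 'a \<Rightarrow> real) \<Rightarrow> bool" where
  "poisson_arrival_times M rate \<Gamma> \<longleftrightarrow>
    (\<exists>N. poisson_process M rate N \<and>
      (\<forall>i. \<Gamma> i \<in> borel_measurable M \<and>
        (AE \<omega> in M. \<Gamma> i \<omega> = Inf {t. 0 \<le> t \<and> i + 1 \<le> N t \<omega>})))"

text \<open>
  The gauge integral is needed here: for \<open>\<alpha> \<le> 1\<close> the integral converges only as an improper
  integral and is not a Lebesgue integral.
\<close>

definition stable_const :: "real \<Rightarrow> real" where
  "stable_const \<alpha> = inverse (integral {0..} (\<lambda>x. x powr (- \<alpha>) * sin x))"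

text \<open>The cells are used for \<open>j \<ge> 1\<close> only; sums over \<open>j \<ge> 1\<close> are written with \<open>Suc j\<close>.\<close>

definition cell :: "nat \<Rightarrow> real set" where
  "cell j = {- real j ..< - real j + 1} \<union> {real j - 1 ..< real j}"

definition mark_density :: "real \<Rightarrow> real" where
  "mark_density x = 3 / pi\<^sup>2 * (\<Sum>j. 1 / (real (Suc j))\<^sup>2 * indicator (cell (Suc j)) x)"

text \<open>Linear multifractional multistable motion, as a Ferguson--Klass--LePage series.\<close>

definition lmmm ::
    "(real \<Rightarrow> real) \<Rightarrow> (real \<Rightarrow> real) \<Rightarrow> (real \<Rightarrow> real) \<Rightarrow> (nat \<Rightarrow> 'a \<Rightarrow> real) \<Rightarrow> (nat \<Rightarrow> 'a \<Rightarrow> real)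
      \<Rightarrow> (nat \<Rightarrow> 'a \<Rightarrow> real) \<Rightarrow> real \<Rightarrow> 'a \<Rightarrow> real" where
  "lmmm b \<alpha> h \<Gamma> V \<gamma> t \<omega> =
    b t * stable_const (\<alpha> t) powr (1 / \<alpha> t) *
    (\<Sum>i. \<Sum>j. \<gamma> i \<omega> * \<Gamma> i \<omega> powr (- 1 / \<alpha> t) *
      (\<bar>t - V i \<omega>\<bar> powr (h t - 1 / \<alpha> t) - \<bar>V i \<omega>\<bar> powr (h t - 1 / \<alpha> t)) *
      (pi\<^sup>2 * (real (Suc j))\<^sup>2 / 3) powr (1 / \<alpha> t) * indicator (cell (Suc j)) (V i \<omega>))"

end

theory Submission
  imports Defs "HOL-Real_Asymp.Real_Asymp"
begin

text \<open>
  Write \<open>\<kappa> t = b t * stable_const (\<alpha> t) powr (1 / \<alpha> t)\<close>, \<open>\<beta> t = 1 / \<alpha> t\<close>, \<open>p t = h t - \<beta> t\<close>, and let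
  \<open>X s v\<close> be the series at time \<open>s\<close> with the parameters \<open>\<kappa>\<close>, \<open>\<beta>\<close>, \<open>p\<close> frozen at their values at \<open>v\<close>,
  so that \<open>Y t = X t t\<close>. The increment of \<open>Y\<close> splits as
  \<open>Y (u + r t) - Y u = (X (u + r t) u - X u u) + (X (u + r t) (u + r t) - X (u + r t) u)\<close>.
  After multiplication with \<open>r powr (- h u)\<close> the first bracket has, for every single \<open>r > 0\<close>, exactly
  the finite-dimensional distributions of the local form, and the second one tends to 0 in
  probability.

  The first bracket. Let \<open>\<rho>\<close> be the density of the marks \<open>V i\<close>. The factor \<open>(pi\<^sup>2 j\<^sup>2 / 3)\<close> is
  \<open>1 / \<rho> (V i)\<close>, so the \<open>i\<close>-th summand is \<open>\<gamma> i * F (\<Gamma> i * \<rho> (V i)) (V i)\<close> for a function \<open>F\<close> of two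
  variables (\<open>lmmm_eq_fkl_series\<close>). The points \<open>(\<Gamma> i * \<rho> (V i), V i)\<close> form a Poisson process on the
  half-plane with Lebesgue intensity, because multiplying by \<open>\<rho>\<close> compensates the density of the
  marks. Hence the characteristic function of the series at 1 is the exponential of minus the
  integral of \<open>1 - cos F\<close> over the half-plane (\<open>char_fkl_series\<close>). For
  \<open>F z y = \<kappa> * z powr (- 1 / \<alpha>) * f y\<close> the integral over \<open>z\<close> is \<open>\<bar>\<kappa> * f y\<bar> powr \<alpha>\<close> divided by
  \<open>stable_const \<alpha>\<close> (\<open>nn_integral_one_minus_cos_power\<close>); the normalisation of \<open>Y\<close> cancels the constant.
  Linear combinations of series with the same \<open>\<alpha>\<close> are again such series, and the kernel
  \<open>\<bar>s - y\<bar> powr p - \<bar>y\<bar> powr p\<close> is self-similar, which gives the joint characteristic functions of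
  \<open>b u\<close> times the fractional stable motion (\<open>frozen_series_char\<close>, \<open>lfsm_combination_char\<close>).

  The second bracket. Given the points, a series with random signs exceeds \<open>\<epsilon>\<close> with probability at
  most the sum of its squared coefficients over \<open>\<epsilon>\<^sup>2\<close>. Large coefficients are truncated, and the
  expectation of the sum of \<open>min 1 (F\<^sup>2)\<close> is an integral over the half-plane by Campbell's formula.
  So \<open>truncated_energy F\<close> controls the series in probability (\<open>fkl_series_tail\<close>). A change of the
  parameters by \<open>d\<close> changes \<open>F\<close> by at most a constant times \<open>d\<close> times a kernel with slightly shifted exponents;
  the shift absorbs the logarithms from differentiating in the exponents, and the shifted kernel still
  has finite energy. The parameters are Lipschitz at \<open>u\<close>, so \<open>d\<close> is of order \<open>r\<close>, the factor
  \<open>r powr (- h u)\<close> leaves \<open>r powr (1 - h u)\<close>, and this vanishes because \<open>h u < 1\<close>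
  (\<open>fkl_kernel_perturbation\<close>, \<open>frozen_parameters_error\<close>). That \<open>\<kappa>\<close> is Lipschitz needs Lipschitz
  dependence of \<open>stable_const \<alpha>\<close> on \<open>\<alpha>\<close> (\<open>levy_moment_lipschitz\<close>).

  The two parts are joined by \<open>fdd_tendsto_perturbation\<close>, which rests on the fact that joint
  characteristic functions determine joint laws (\<open>joint_char_eq_imp_law_eq\<close>). For \<open>h u \<noteq> 1 / \<alpha> u\<close> the
  local form is non-trivial since its kernel at time 1 does not vanish on an interval
  (\<open>lfsm_nontrivial\<close>).
\<close>

section \<open>Joint characteristic functions and finite-dimensional limits\<close>

text \<open>
  The weighted measures have finite mass, and after normalisation they are probability measures on the
  line to which Levy's uniqueness theorem applies. The phase \<open>c\<close> covers sine and cosine at once, and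
  test functions \<open>1 + cos\<close> are used because products of them are nonnegative and can themselves serve
  as weights.
\<close>

lemma weighted_law_eqI:
  fixes X W :: "'a \<Rightarrow> real" and Z U :: "'b \<Rightarrow> real"
  assumes P: "finite_measure P" and Q: "finite_measure Q"
    and [measurable]: "X \<in> borel_measurable P" "W \<in> borel_measurable P"
      "Z \<in> borel_measurable Q" "U \<in> borel_measurable Q"
    and W: "\<And>\<omega>. 0 \<le> W \<omega>" "\<And>\<omega>. W \<omega> \<le> C" and U: "\<And>\<omega>. 0 \<le> U \<omega>" "\<And>\<omega>. U \<omega> \<le> C"
    and eq: "\<And>\<theta> c. (\<integral>\<omega>. W \<omega> * (1 + cos (\<theta> * X \<omega> + c)) \<partial>P) = (\<integral>\<omega>. U \<omega> * (1 + cos (\<theta> * Z \<omega> + c)) \<partial>Q)"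
    and [measurable]: "A \<in> sets borel"
  shows "(\<integral>\<omega>. W \<omega> * indicator A (X \<omega>) \<partial>P) = (\<integral>\<omega>. U \<omega> * indicator A (Z \<omega>) \<partial>Q)"
proof -
  interpret P: finite_measure P by fact
  interpret Q: finite_measure Q by fact
  have intW: "integrable P (\<lambda>\<omega>. W \<omega> * f \<omega>)" if [measurable]: "f \<in> borel_measurable P" and "\<And>\<omega>. \<bar>f \<omega>\<bar> \<le> 1" for f
  proof (rule P.integrable_const_bound[where B = C])
    show "AE \<omega> in P. norm (W \<omega> * f \<omega>) \<le> C"
      using that(2) W by (auto simp: abs_mult intro!: AE_I2 mult_mono[of _ C _ 1, simplified] intro: order_trans)
  qed simp
  have intU: "integrable Q (\<lambda>\<omega>. U \<omega> * f \<omega>)" if [measurable]: "f \<in> borel_measurable Q" and "\<And>\<omega>. \<bar>f \<omega>\<bar> \<le> 1" for f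
  proof (rule Q.integrable_const_bound[where B = C])
    show "AE \<omega> in Q. norm (U \<omega> * f \<omega>) \<le> C"
      using that(2) U by (auto simp: abs_mult intro!: AE_I2 mult_mono[of _ C _ 1, simplified] intro: order_trans)
  qed simp
  have intW1: "integrable P W" using intW[of "\<lambda>_. 1"] by simp
  have intU1: "integrable Q U" using intU[of "\<lambda>_. 1"] by simp
  define m where "m = (\<integral>\<omega>. W \<omega> \<partial>P)"
  have m': "m = (\<integral>\<omega>. U \<omega> \<partial>Q)"
    using eq[of 0 0] by (simp add: m_def)
  have eqcos: "(\<integral>\<omega>. W \<omega> * cos (\<theta> * X \<omega> + c) \<partial>P) = (\<integral>\<omega>. U \<omega> * cos (\<theta> * Z \<omega> + c) \<partial>Q)" for \<theta> c
  proof -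
    have "(\<integral>\<omega>. W \<omega> * (1 + cos (\<theta> * X \<omega> + c)) \<partial>P) = m + (\<integral>\<omega>. W \<omega> * cos (\<theta> * X \<omega> + c) \<partial>P)"
      by (simp add: distrib_left m_def intW intW1)
    moreover have "(\<integral>\<omega>. U \<omega> * (1 + cos (\<theta> * Z \<omega> + c)) \<partial>Q) = m + (\<integral>\<omega>. U \<omega> * cos (\<theta> * Z \<omega> + c) \<partial>Q)"
      by (simp add: distrib_left m' intU intU1)
    ultimately show ?thesis using eq[of \<theta> c] by simp
  qed
  have eqsin: "(\<integral>\<omega>. W \<omega> * sin (\<theta> * X \<omega>) \<partial>P) = (\<integral>\<omega>. U \<omega> * sin (\<theta> * Z \<omega>) \<partial>Q)" for \<theta>
    using eqcos[of \<theta> "-pi/2"] by (simp add: cos_diff)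
  have "0 \<le> m" unfolding m_def using W by simp
  show ?thesis
  proof (cases "m = 0")
    case True
    have "AE \<omega> in P. W \<omega> = 0"
      using True W(1) integral_nonneg_eq_0_iff_AE[OF intW1] by (auto simp: m_def)
    then have "(\<integral>\<omega>. W \<omega> * indicator A (X \<omega>) \<partial>P) = 0" by (intro integral_eq_zero_AE) auto
    moreover have "AE \<omega> in Q. U \<omega> = 0"
      using True U(1) integral_nonneg_eq_0_iff_AE[OF intU1] by (auto simp: m')
    then have "(\<integral>\<omega>. U \<omega> * indicator A (Z \<omega>) \<partial>Q) = 0" by (intro integral_eq_zero_AE) auto
    ultimately show ?thesis by simp
  next
    case False
    with \<open>0 \<le> m\<close> have m: "0 < m" by simp
    define \<mu> where "\<mu> = distr (density P (\<lambda>\<omega>. W \<omega> / m)) borel X"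
    define \<nu> where "\<nu> = distr (density Q (\<lambda>\<omega>. U \<omega> / m)) borel Z"
    have "emeasure (density P (\<lambda>\<omega>. W \<omega> / m)) (space P) = 1"
      using m W(1) intW1 by (simp add: emeasure_density nn_integral_eq_integral m_def cong: nn_integral_cong)
    then have "prob_space (density P (\<lambda>\<omega>. W \<omega> / m))" by (intro prob_spaceI) simp
    then interpret \<mu>: prob_space \<mu> unfolding \<mu>_def by (rule prob_space.prob_space_distr) simp
    have "emeasure (density Q (\<lambda>\<omega>. U \<omega> / m)) (space Q) = 1"
      using m U(1) intU1 by (simp add: emeasure_density nn_integral_eq_integral m' cong: nn_integral_cong)
    then have "prob_space (density Q (\<lambda>\<omega>. U \<omega> / m))" by (intro prob_spaceI) simp
    then interpret \<nu>: prob_space \<nu> unfolding \<nu>_def by (rule prob_space.prob_space_distr) simp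
    have int\<mu>: "integral\<^sup>L \<mu> f = (\<integral>\<omega>. W \<omega> * f (X \<omega>) \<partial>P) / m" if [measurable]: "f \<in> borel_measurable borel" for f :: "real \<Rightarrow> real"
      unfolding \<mu>_def using m W(1) by (simp add: integral_distr integral_density)
    have int\<nu>: "integral\<^sup>L \<nu> f = (\<integral>\<omega>. U \<omega> * f (Z \<omega>) \<partial>Q) / m" if [measurable]: "f \<in> borel_measurable borel" for f :: "real \<Rightarrow> real"
      unfolding \<nu>_def using m U(1) by (simp add: integral_distr integral_density)
    have ch: "char \<mu>' \<theta> = Complex (\<integral>x. cos (\<theta> * x) \<partial>\<mu>') (\<integral>x. sin (\<theta> * x) \<partial>\<mu>')" 
      if "real_distribution \<mu>'" for \<theta> \<mu>'
    proof -
      interpret real_distribution \<mu>' by fact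
      have i: "integrable \<mu>' (\<lambda>x. iexp (\<theta> * x))" by (rule integrable_iexp) simp_all
      show ?thesis unfolding char_def
        using integral_Re[OF i] integral_Im[OF i]
        by (intro complex_eqI) (simp_all add: Re_exp Im_exp)
    qed
    have rd: "real_distribution \<mu>" "real_distribution \<nu>"
      using \<mu>.prob_space_axioms \<nu>.prob_space_axioms by (auto simp: real_distribution_def real_distribution_axioms_def \<mu>_def \<nu>_def)
    have "\<mu> = \<nu>"
    proof (rule Levy_uniqueness[OF rd], rule ext)
      fix \<theta>
      show "char \<mu> \<theta> = char \<nu> \<theta>"
        using eqcos[of \<theta> 0] eqsin[of \<theta>] by (simp add: ch rd int\<mu> int\<nu>)
    qed
    then have "integral\<^sup>L \<mu> (indicator A) = (integral\<^sup>L \<nu> (indicator A) :: real)" by simp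
    then show ?thesis using m by (simp only: int\<mu> int\<nu> borel_measurable_indicator \<open>A \<in> sets borel\<close>) simp
  qed
qed

lemma prod_one_plus_cos_bounds:
  fixes f :: "'i \<Rightarrow> real"
  shows "0 \<le> (\<Prod>k\<in>K. 1 + cos (f k))" "finite K \<Longrightarrow> (\<Prod>k\<in>K. 1 + cos (f k)) \<le> 2 ^ card K"
proof -
  show "0 \<le> (\<Prod>k\<in>K. 1 + cos (f k))" by (intro prod_nonneg) (metis add.commute cos_ge_minus_one le_minus_iff add_le_cancel_left add.right_neutral diff_ge_0_iff_ge diff_minus_eq_add)
  assume "finite K"
  have "(\<Prod>k\<in>K. 1 + cos (f k)) \<le> (\<Prod>k\<in>K. 2)"
    using cos_ge_minus_one cos_le_one by (intro prod_mono) (smt (verit))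
  then show "(\<Prod>k\<in>K. 1 + cos (f k)) \<le> 2 ^ card K" by simp
qed

text \<open>
  Expanding \<open>1 + cos\<close> into three exponentials turns one more real factor into characteristic functions
  at frequencies where the \<open>j\<close>-th coordinate is 0, itself or its negative.
\<close>

lemma cos_factor_expansion:
  fixes Y :: "'i \<Rightarrow> 'a \<Rightarrow> real" and c :: "'i \<Rightarrow> real"
  assumes R: "prob_space R" and Y[measurable]: "\<And>k. Y k \<in> borel_measurable R"
    and K: "finite K" and j: "j \<in> K" "j \<notin> J" and J: "J \<subseteq> K"
  defines "E \<equiv> \<lambda>\<theta>. \<integral>\<omega>. complex_of_real (\<Prod>k\<in>J. 1 + cos (\<theta> k * Y k \<omega> + c k)) * iexp (\<Sum>k\<in>K - J. \<theta> k * Y k \<omega>) \<partial>R"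
  shows "(\<integral>\<omega>. complex_of_real (\<Prod>k\<in>insert j J. 1 + cos (\<theta> k * Y k \<omega> + c k)) * iexp (\<Sum>k\<in>K - insert j J. \<theta> k * Y k \<omega>) \<partial>R)
      = E (\<theta>(j := 0)) + iexp (c j) / 2 * E \<theta> + iexp (- c j) / 2 * E (\<theta>(j := - \<theta> j))"
proof -
  interpret R: prob_space R by fact
  have finJ: "finite J" using K J by (rule rev_finite_subset)
  have K': "K - J = insert j (K - insert j J)" "finite (K - insert j J)" "j \<notin> K - insert j J"
    using j J K by auto
  have sumK: "(\<Sum>k\<in>K - J. f k) = f j + (\<Sum>k\<in>K - insert j J. f k)" for f :: "'i \<Rightarrow> real"
    by (subst K'(1), rule sum.insert[OF K'(2,3)])
  define A where "A \<omega> = complex_of_real (\<Prod>k\<in>J. 1 + cos (\<theta> k * Y k \<omega> + c k)) * iexp (\<Sum>k\<in>K - insert j J. \<theta> k * Y k \<omega>)" for \<omega>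
  have A_m[measurable]: "A \<in> borel_measurable R" unfolding A_def by measurable
  have E_eq: "E (\<theta>(j := t)) = (\<integral>\<omega>. A \<omega> * iexp (t * Y j \<omega>) \<partial>R)" for t
    unfolding E_def
  proof (rule Bochner_Integration.integral_cong[OF refl])
    fix \<omega>
    have "(\<Prod>k\<in>J. 1 + cos ((\<theta>(j := t)) k * Y k \<omega> + c k)) = (\<Prod>k\<in>J. 1 + cos (\<theta> k * Y k \<omega> + c k))"
      using j by (intro prod.cong) auto
    moreover have "(\<Sum>k\<in>K - insert j J. (\<theta>(j := t)) k * Y k \<omega>) = (\<Sum>k\<in>K - insert j J. \<theta> k * Y k \<omega>)"
      by (intro sum.cong) auto
    ultimately show "complex_of_real (\<Prod>k\<in>J. 1 + cos ((\<theta>(j := t)) k * Y k \<omega> + c k)) * iexp (\<Sum>k\<in>K - J. (\<theta>(j := t)) k * Y k \<omega>)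
      = A \<omega> * iexp (t * Y j \<omega>)"
      by (simp add: A_def sumK exp_add distrib_left mult_ac)
  qed
  have A_bd: "norm (A \<omega>) \<le> 2 ^ card J" for \<omega>
    using prod_one_plus_cos_bounds[where f = "\<lambda>k. \<theta> k * Y k \<omega> + c k" and K = J] finJ
    by (simp add: A_def norm_mult del: of_real_prod)
  have int: "integrable R (\<lambda>\<omega>. A \<omega> * iexp (t * Y j \<omega>))" for t
    by (rule R.integrable_const_bound[where B = "2 ^ card J"]) (auto simp: norm_mult A_bd)
  have E_eq': "E \<theta> = (\<integral>\<omega>. A \<omega> * iexp (\<theta> j * Y j \<omega>) \<partial>R)"
    using E_eq[of "\<theta> j"] by simp
  have "complex_of_real (1 + cos (\<theta> j * Y j \<omega> + c j)) = iexp (0 * Y j \<omega>) + iexp (c j) / 2 * iexp (\<theta> j * Y j \<omega>) + iexp (- c j) / 2 * iexp (- \<theta> j * Y j \<omega>)" for \<omega>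
    by (simp add: cos_of_real[symmetric] cos_exp_eq exp_add[symmetric] algebra_simps add_divide_distrib)
  then have "complex_of_real (\<Prod>k\<in>insert j J. 1 + cos (\<theta> k * Y k \<omega> + c k)) * iexp (\<Sum>k\<in>K - insert j J. \<theta> k * Y k \<omega>)
    = A \<omega> * iexp (0 * Y j \<omega>) + iexp (c j) / 2 * (A \<omega> * iexp (\<theta> j * Y j \<omega>)) + iexp (- c j) / 2 * (A \<omega> * iexp (- \<theta> j * Y j \<omega>))" for \<omega>
    using j finJ by (simp add: A_def algebra_simps)
  then show ?thesis
    unfolding E_eq E_eq' by (simp only: Bochner_Integration.integral_add Bochner_Integration.integrable_add
      integrable_mult_right integral_mult_right_zero int)
qed

text \<open>
  Induction on \<open>J\<close> replaces the exponentials by nonnegative real factors, one coordinate at a time.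
\<close>

lemma joint_char_imp_cos_products:
  fixes X :: "'i \<Rightarrow> 'a \<Rightarrow> real" and Z :: "'i \<Rightarrow> 'b \<Rightarrow> real"
  assumes P: "prob_space P" and Q: "prob_space Q" and K: "finite K"
    and X: "\<And>k. X k \<in> borel_measurable P" and Z: "\<And>k. Z k \<in> borel_measurable Q"
    and ch: "\<And>\<theta>. (\<integral>\<omega>. iexp (\<Sum>k\<in>K. \<theta> k * X k \<omega>) \<partial>P) = (\<integral>\<omega>. iexp (\<Sum>k\<in>K. \<theta> k * Z k \<omega>) \<partial>Q)"
    and J: "J \<subseteq> K"
  shows "(\<integral>\<omega>. complex_of_real (\<Prod>k\<in>J. 1 + cos (\<theta> k * X k \<omega> + c k)) * iexp (\<Sum>k\<in>K - J. \<theta> k * X k \<omega>) \<partial>P) =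
    (\<integral>\<omega>. complex_of_real (\<Prod>k\<in>J. 1 + cos (\<theta> k * Z k \<omega> + c k)) * iexp (\<Sum>k\<in>K - J. \<theta> k * Z k \<omega>) \<partial>Q)"
proof -
  have "finite J" using K J by (rule rev_finite_subset)
  then show ?thesis using J
  proof (induction J arbitrary: \<theta>)
    case empty
    then show ?case using ch by simp
  next
    case (insert j J)
    then have j: "j \<in> K" "j \<notin> J" "J \<subseteq> K" by auto
    show ?case
      unfolding cos_factor_expansion[OF P X K j] cos_factor_expansion[OF Q Z K j] insert.IH[OF j(3)] ..
  qed
qed

text \<open>
  A multivariate uniqueness theorem obtained from the one-dimensional one. Starting from the products of
  factors \<open>1 + cos\<close>, these are replaced by indicators of Borel sets, again one coordinate at a time: the
  remaining factors and the indicators already present form a bounded nonnegative weight, so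
  \<open>weighted_law_eqI\<close> applies to the coordinate in question. What results is equality on boxes.
\<close>

lemma joint_char_eq_imp_law_eq:
  fixes X :: "'i \<Rightarrow> 'a \<Rightarrow> real" and Z :: "'i \<Rightarrow> 'b \<Rightarrow> real"
  assumes P: "prob_space P" and Q: "prob_space Q" and K: "finite K"
    and X[measurable]: "\<And>k. X k \<in> borel_measurable P"
    and Z[measurable]: "\<And>k. Z k \<in> borel_measurable Q"
    and ch: "\<And>\<theta>. (\<integral>\<omega>. iexp (\<Sum>k\<in>K. \<theta> k * X k \<omega>) \<partial>P) = (\<integral>\<omega>. iexp (\<Sum>k\<in>K. \<theta> k * Z k \<omega>) \<partial>Q)"
  shows "distr P (PiM K (\<lambda>_. borel)) (\<lambda>\<omega>. \<lambda>k\<in>K. X k \<omega>) = distr Q (PiM K (\<lambda>_. borel)) (\<lambda>\<omega>. \<lambda>k\<in>K. Z k \<omega>)"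
proof -
  interpret P: prob_space P by fact
  interpret Q: prob_space Q by fact
  have cosK: "(\<integral>\<omega>. (\<Prod>k\<in>K. 1 + cos (\<theta> k * X k \<omega> + c k)) \<partial>P) = (\<integral>\<omega>. (\<Prod>k\<in>K. 1 + cos (\<theta> k * Z k \<omega> + c k)) \<partial>Q)" for \<theta> c
  proof -
    have "complex_of_real (\<integral>\<omega>. (\<Prod>k\<in>K. 1 + cos (\<theta> k * X k \<omega> + c k)) \<partial>P) = complex_of_real (\<integral>\<omega>. (\<Prod>k\<in>K. 1 + cos (\<theta> k * Z k \<omega> + c k)) \<partial>Q)"
      using joint_char_imp_cos_products[OF P Q K X Z ch order_refl, of \<theta> c]
      unfolding integral_complex_of_real[symmetric] by simp
    then show ?thesis using of_real_eq_iff by blast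
  qed
  have step: "(\<integral>\<omega>. (\<Prod>k\<in>J. indicator (A k) (X k \<omega>)) * (\<Prod>k\<in>K - J. 1 + cos (\<theta> k * X k \<omega> + c k)) \<partial>P) =
    (\<integral>\<omega>. (\<Prod>k\<in>J. indicator (A k) (Z k \<omega>)) * (\<Prod>k\<in>K - J. 1 + cos (\<theta> k * Z k \<omega> + c k)) \<partial>Q)"
    if A: "\<And>k. k \<in> K \<Longrightarrow> A k \<in> sets borel" and J: "J \<subseteq> K" for J A \<theta> c
  proof -
    have "finite J" using K J by (rule rev_finite_subset)
    then show ?thesis using J
    proof (induction J arbitrary: \<theta> c)
      case empty
      then show ?case using cosK by simp
    next
      case (insert j J)
      have K': "K - J = insert j (K - insert j J)" "finite (K - insert j J)" "j \<notin> K - insert j J"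
        using insert K by auto
      have prodK: "(\<Prod>k\<in>K - J. f k) = f j * (\<Prod>k\<in>K - insert j J. f k)" for f :: "'i \<Rightarrow> real"
        by (subst K'(1), rule prod.insert[OF K'(2,3)])
      define W where "W y = (\<Prod>k\<in>J. indicator (A k) (y k)) * (\<Prod>k\<in>K - insert j J. 1 + cos (\<theta> k * y k + c k))"
        for y :: "'i \<Rightarrow> real"
      have W0: "0 \<le> W y" for y
        unfolding W_def by (intro mult_nonneg_nonneg prod_nonneg prod_one_plus_cos_bounds) auto
      have W1: "W y \<le> 2 ^ card (K - insert j J)" for y
      proof -
        have "(\<Prod>k\<in>J. indicator (A k) (y k)) \<le> (1::real)" by (intro prod_le_1) auto
        then have "W y \<le> 1 * 2 ^ card (K - insert j J)"
          unfolding W_def by (intro mult_mono prod_one_plus_cos_bounds K'(2)) (auto intro!: prod_nonneg)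
        then show ?thesis by simp
      qed
      have ind: "(\<lambda>x. indicator (A k) x :: real) \<in> borel_measurable borel" if "k \<in> J" for k
        using that insert by (intro borel_measurable_indicator A) auto
      have WX: "(\<lambda>\<omega>. W (\<lambda>k. X k \<omega>)) \<in> borel_measurable P"
        unfolding W_def by (intro borel_measurable_times borel_measurable_prod measurable_compose[OF X ind]) measurable
      have WZ: "(\<lambda>\<omega>. W (\<lambda>k. Z k \<omega>)) \<in> borel_measurable Q"
        unfolding W_def by (intro borel_measurable_times borel_measurable_prod measurable_compose[OF Z ind]) measurable
      have eqW: "W y * (1 + cos (t * y j + s)) =
          (\<Prod>k\<in>J. indicator (A k) (y k)) * (\<Prod>k\<in>K - J. 1 + cos ((\<theta>(j := t)) k * y k + (c(j := s)) k))" for y t s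
      proof -
        have "(\<Prod>k\<in>K - insert j J. 1 + cos ((\<theta>(j := t)) k * y k + (c(j := s)) k)) = (\<Prod>k\<in>K - insert j J. 1 + cos (\<theta> k * y k + c k))"
          by (intro prod.cong) auto
        then show ?thesis by (simp add: W_def prodK)
      qed
      have "(\<integral>\<omega>. W (\<lambda>k. X k \<omega>) * indicator (A j) (X j \<omega>) \<partial>P) = (\<integral>\<omega>. W (\<lambda>k. Z k \<omega>) * indicator (A j) (Z j \<omega>) \<partial>Q)"
      proof (rule weighted_law_eqI[OF P.finite_measure_axioms Q.finite_measure_axioms X WX Z WZ W0 W1 W0 W1])
        show "(\<integral>\<omega>. W (\<lambda>k. X k \<omega>) * (1 + cos (t * X j \<omega> + s)) \<partial>P) = (\<integral>\<omega>. W (\<lambda>k. Z k \<omega>) * (1 + cos (t * Z j \<omega> + s)) \<partial>Q)" for t s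
          using insert.IH[of "\<theta>(j := t)" "c(j := s)"] insert.prems eqW[of "\<lambda>k. X k _"] eqW[of "\<lambda>k. Z k _"] by simp
        show "A j \<in> sets borel" using A insert by auto
      qed
      then show ?case using insert by (simp add: W_def mult_ac)
    qed
  qed
  show ?thesis
  proof (rule measure_eqI_PiM_finite[OF K])
    show "sets (distr P (PiM K (\<lambda>_. borel)) (\<lambda>\<omega>. \<lambda>k\<in>K. X k \<omega>)) = sets (PiM K (\<lambda>_. borel))"
      "sets (distr Q (PiM K (\<lambda>_. borel)) (\<lambda>\<omega>. \<lambda>k\<in>K. Z k \<omega>)) = sets (PiM K (\<lambda>_. borel))" by auto
    show "range (\<lambda>_. PiE K (\<lambda>_. UNIV)) \<subseteq> prod_algebra K (\<lambda>_. borel)" 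
      using K by (auto simp: prod_algebra_eq_finite)
    show "(\<Union>i::nat. PiE K (\<lambda>_. UNIV)) = space (PiM K (\<lambda>_. borel))" by (simp add: space_PiM)
    show "emeasure (distr P (PiM K (\<lambda>_. borel)) (\<lambda>\<omega>. \<lambda>k\<in>K. X k \<omega>)) (PiE K (\<lambda>_. UNIV)) \<noteq> \<infinity>" for i::nat
      by (rule finite_measure.emeasure_finite[OF prob_space.finite_measure[OF P.prob_space_distr], unfolded infinity_ennreal_def[symmetric]]) measurable
  next
    fix A :: "'i \<Rightarrow> real set" assume A: "\<And>i. i \<in> K \<Longrightarrow> A i \<in> sets borel"
    have m: "emeasure (distr R (PiM K (\<lambda>_. borel)) (\<lambda>\<omega>. \<lambda>k\<in>K. Y k \<omega>)) (PiE K A) = ennreal (\<integral>\<omega>. (\<Prod>k\<in>K. indicator (A k) (Y k \<omega>)) \<partial>R)"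
      if "prob_space R" and [measurable]: "\<And>k. Y k \<in> borel_measurable R" for R :: "'c measure" and Y
    proof -
      interpret R: prob_space R by fact
      have [measurable]: "{\<omega> \<in> space R. \<forall>k\<in>K. Y k \<omega> \<in> A k} \<in> sets R"
        using K A by measurable
      have "emeasure (distr R (PiM K (\<lambda>_. borel)) (\<lambda>\<omega>. \<lambda>k\<in>K. Y k \<omega>)) (PiE K A) = emeasure R {\<omega> \<in> space R. \<forall>k\<in>K. Y k \<omega> \<in> A k}"
        using K A by (subst emeasure_distr) (auto intro!: arg_cong2[where f=emeasure] simp: PiE_iff)
      also have "\<dots> = ennreal (\<integral>\<omega>. indicator {\<omega> \<in> space R. \<forall>k\<in>K. Y k \<omega> \<in> A k} \<omega> \<partial>R)"
        by (simp add: R.emeasure_eq_measure)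
      also have "(\<integral>\<omega>. indicator {\<omega> \<in> space R. \<forall>k\<in>K. Y k \<omega> \<in> A k} \<omega> \<partial>R) = (\<integral>\<omega>. ((\<Prod>k\<in>K. indicator (A k) (Y k \<omega>)) :: real) \<partial>R)"
      proof (intro Bochner_Integration.integral_cong refl)
        fix \<omega> assume "\<omega> \<in> space R"
        then show "indicator {\<omega> \<in> space R. \<forall>k\<in>K. Y k \<omega> \<in> A k} \<omega> = (\<Prod>k\<in>K. indicator (A k) (Y k \<omega>) :: real)"
        proof (cases "\<forall>k\<in>K. Y k \<omega> \<in> A k")
          case False
          then have "(\<Prod>k\<in>K. indicator (A k) (Y k \<omega>) :: real) = 0"
            using K by (intro prod_zero) (auto simp: indicator_def)
          then show ?thesis using False by simp
        qed simp
      qed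
      finally show ?thesis .
    qed
    show "emeasure (distr P (PiM K (\<lambda>_. borel)) (\<lambda>\<omega>. \<lambda>k\<in>K. X k \<omega>)) (PiE K A) = emeasure (distr Q (PiM K (\<lambda>_. borel)) (\<lambda>\<omega>. \<lambda>k\<in>K. Z k \<omega>)) (PiE K A)"
      unfolding m[OF P X] m[OF Q Z] using step[OF A order_refl] by simp
  qed
qed


lemma continuous_padded_measurable:
  fixes g :: "(nat \<Rightarrow> real) \<Rightarrow> real"
  assumes "continuous_on UNIV g"
  shows "(\<lambda>x. g (\<lambda>i. if i < n then x i else 0)) \<in> borel_measurable (PiM {..<n} (\<lambda>_. borel))"
proof -
  have "g \<in> borel_measurable borel" using assms by (rule borel_measurable_continuous_onI)
  then have g: "g \<in> borel_measurable (PiM UNIV (\<lambda>_. borel))"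
    by (simp add: measurable_cong_sets[OF sets_PiM_equal_borel refl])
  have "(\<lambda>x i. if i < n then x i else 0) \<in> PiM {..<n} (\<lambda>_. borel) \<rightarrow>\<^sub>M PiM UNIV (\<lambda>_. borel :: real measure)"
  proof (rule measurable_PiM_single')
    show "(\<lambda>x. if i < n then x i else 0) \<in> borel_measurable (PiM {..<n} (\<lambda>_. borel))" for i :: nat
      by (cases "i < n") auto
  qed (auto simp: PiE_def)
  from measurable_compose[OF this g] show ?thesis .
qed

text \<open>
  The box is compact in the product topology, and the metric of \<open>nat \<Rightarrow> real\<close> is controlled by finitely
  many coordinates.
\<close>

lemma padded_uniformly_continuous:
  fixes g :: "(nat \<Rightarrow> real) \<Rightarrow> real"
  assumes g: "continuous_on UNIV g" and e: "0 < e"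
  obtains \<delta> where "0 < \<delta>" "\<And>x y. (\<And>i. \<bar>x i\<bar> \<le> R) \<Longrightarrow> (\<And>i. \<bar>y i - x i\<bar> \<le> \<delta>) \<Longrightarrow> \<bar>g y - g x\<bar> < e"
proof -
  define K where "K = (PiE UNIV (\<lambda>_. {-(R+1)..R+1}) :: (nat \<Rightarrow> real) set)"
  have "compactin (product_topology (\<lambda>_. euclidean) UNIV) K"
    unfolding K_def compactin_PiE by simp
  then have "compact K" by (simp add: euclidean_product_topology)
  then have "uniformly_continuous_on K g"
    using compact_uniformly_continuous continuous_on_subset[OF g] by blast
  then obtain d where d: "0 < d" "\<And>x y. x \<in> K \<Longrightarrow> y \<in> K \<Longrightarrow> dist y x < d \<Longrightarrow> dist (g y) (g x) < e"
    unfolding uniformly_continuous_on_def using e by meson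
  obtain m where m: "(1/2)^m < d / 2" using real_arch_pow_inv[of "d/2" "1/2"] d by auto
  define \<delta> where "\<delta> = min 1 (d / 8)"
  show thesis
  proof
    show "0 < \<delta>" using d by (simp add: \<delta>_def)
    fix x y :: "nat \<Rightarrow> real" assume x: "\<And>i. \<bar>x i\<bar> \<le> R" and y: "\<And>i. \<bar>y i - x i\<bar> \<le> \<delta>"
    have "\<bar>x i\<bar> \<le> R + 1 \<and> \<bar>y i\<bar> \<le> R + 1" for i
      using x[of i] y[of i] by (simp add: \<delta>_def) linarith
    then have "x \<in> K" "y \<in> K" by (auto simp: K_def PiE_iff abs_le_iff) (smt (verit))+
    moreover have "Max {dist (y (from_nat i)) (x (from_nat i)) |i. i \<le> m} \<le> \<delta>"
      by (subst Max_le_iff) (auto simp: dist_real_def y)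
    then have "dist y x < d"
      using dist_fun_le_dist_first_terms[of y x m] m d(1) by (auto simp: \<delta>_def min_def split: if_splits)
    ultimately show "\<bar>g y - g x\<bar> < e" using d by (simp add: dist_real_def)
  qed
qed

lemma tail_prob_small:
  fixes Z :: "nat \<Rightarrow> 'b \<Rightarrow> real"
  assumes "prob_space N" and [measurable]: "\<And>k. Z k \<in> borel_measurable N" and "0 < e"
  obtains R where "measure N {\<omega> \<in> space N. \<exists>k<n. \<bar>Z k \<omega>\<bar> > R} < e"
proof -
  interpret N: prob_space N by fact
  define D where "D m = {\<omega> \<in> space N. \<exists>k<n. \<bar>Z k \<omega>\<bar> > real m}" for m
  have "(\<lambda>m. measure N (D m)) \<longlonglongrightarrow> measure N (\<Inter>m. D m)"
  proof (rule N.finite_Lim_measure_decseq)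
    show "range D \<subseteq> sets N" by (auto simp: D_def)
    show "decseq D" by (force simp: decseq_def D_def)
  qed
  moreover have "(\<Inter>m. D m) = {}"
  proof (intro equals0I)
    fix \<omega> assume "\<omega> \<in> (\<Inter>m. D m)"
    then have "\<exists>k<n. \<bar>Z k \<omega>\<bar> > real m" for m by (auto simp: D_def)
    moreover obtain m where "(\<Sum>k<n. \<bar>Z k \<omega>\<bar>) \<le> real m" using real_arch_simple by blast
    moreover have "\<bar>Z k \<omega>\<bar> \<le> (\<Sum>k<n. \<bar>Z k \<omega>\<bar>)" if "k < n" for k
      using that by (intro member_le_sum) auto
    ultimately show False by (meson not_less order_trans)
  qed
  ultimately have "(\<lambda>m. measure N (D m)) \<longlonglongrightarrow> 0" by simp
  then have "\<forall>\<^sub>F m in sequentially. measure N (D m) < e" using \<open>0 < e\<close> by (rule order_tendstoD)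
  then obtain m where "measure N (D m) < e" by (auto simp: eventually_sequentially)
  then show thesis by (intro that[of "real m"]) (simp add: D_def)
qed

text \<open>
  A version of Slutsky's theorem in which the main part \<open>A r\<close> has the law of the limit for every \<open>r\<close>, not
  only asymptotically. Tightness of \<open>A r\<close> is then immediate from that of the single vector \<open>Z\<close>, and on
  a large box the test function is uniformly continuous.
\<close>

lemma fdd_tendsto_perturbation:
  fixes X A :: "'r \<Rightarrow> real \<Rightarrow> 'a \<Rightarrow> real" and Z :: "real \<Rightarrow> 'b \<Rightarrow> real"
  assumes M: "prob_space M" and N: "prob_space N"
    and X[measurable]: "\<And>r t. X r t \<in> borel_measurable M"
    and A[measurable]: "\<And>r t. A r t \<in> borel_measurable M"
    and Z[measurable]: "\<And>t. Z t \<in> borel_measurable N"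
    and ch: "\<forall>\<^sub>F r in F. \<forall>(n::nat) t \<theta>. (\<integral>\<omega>. iexp (\<Sum>k<n. \<theta> k * A r (t k) \<omega>) \<partial>M) = (\<integral>\<omega>. iexp (\<Sum>k<n. \<theta> k * Z (t k) \<omega>) \<partial>N)"
    and small: "\<And>t \<epsilon>. 0 < \<epsilon> \<Longrightarrow> ((\<lambda>r. measure M {\<omega> \<in> space M. \<bar>X r t \<omega> - A r t \<omega>\<bar> > \<epsilon>}) \<longlongrightarrow> 0) F"
  shows "fdd_tendsto M X N Z F"
  unfolding fdd_tendsto_def
proof (intro allI impI, elim conjE)
  fix n :: nat and t :: "nat \<Rightarrow> real" and g :: "(nat \<Rightarrow> real) \<Rightarrow> real"
  assume g: "continuous_on UNIV g" and "bounded (range g)"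
  interpret M: prob_space M by fact
  interpret N: prob_space N by fact
  obtain C where C: "\<And>x. \<bar>g x\<bar> \<le> C" "0 < C"
    using \<open>bounded (range g)\<close> unfolding bounded_pos by auto
  note gm = continuous_padded_measurable[OF g, of n]
  have gpad: "(\<lambda>\<omega>. g (\<lambda>i. if i < n then Y i \<omega> else 0)) \<in> borel_measurable R"
    if [measurable]: "\<And>i. Y i \<in> borel_measurable R" for Y :: "nat \<Rightarrow> 'c \<Rightarrow> real" and R
  proof -
    have "(\<lambda>\<omega>. \<lambda>i\<in>{..<n}. Y i \<omega>) \<in> R \<rightarrow>\<^sub>M PiM {..<n} (\<lambda>_. borel)" by measurable
    from measurable_compose[OF this gm] show ?thesis by (simp cong: if_cong)
  qed
  have law: "distr M (PiM {..<n} (\<lambda>_. borel)) (\<lambda>\<omega>. \<lambda>k\<in>{..<n}. A r (t k) \<omega>) = distr N (PiM {..<n} (\<lambda>_. borel)) (\<lambda>\<omega>. \<lambda>k\<in>{..<n}. Z (t k) \<omega>)"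
    if "\<forall>(n::nat) t \<theta>. (\<integral>\<omega>. iexp (\<Sum>k<n. \<theta> k * A r (t k) \<omega>) \<partial>M) = (\<integral>\<omega>. iexp (\<Sum>k<n. \<theta> k * Z (t k) \<omega>) \<partial>N)" for r
    by (rule joint_char_eq_imp_law_eq[OF M N]) (use that in auto)
  show "((\<lambda>r. \<integral>\<omega>. g (\<lambda>i. if i < n then X r (t i) \<omega> else 0) \<partial>M) \<longlongrightarrow> (\<integral>\<omega>. g (\<lambda>i. if i < n then Z (t i) \<omega> else 0) \<partial>N)) F"
  proof (rule tendstoI)
    fix e :: real assume e: "0 < e"
    \<comment> \<open>two exceptional events of probability below \<open>e'\<close> contribute less than \<open>e / 2\<close>, as \<open>\<bar>g\<bar> \<le> C\<close>\<close>
    define e' where "e' = e / (8 * C)"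
    have e': "0 < e'" using e C by (simp add: e'_def)
    obtain R where R: "measure N {\<omega> \<in> space N. \<exists>k<n. \<bar>Z (t k) \<omega>\<bar> > R} < e'"
      by (rule tail_prob_small[OF N _ e', of "\<lambda>k. Z (t k)" n]) auto
    obtain \<delta> where \<delta>: "0 < \<delta>" "\<And>x y. (\<And>i. \<bar>x i\<bar> \<le> max R 0) \<Longrightarrow> (\<And>i. \<bar>y i - x i\<bar> \<le> \<delta>) \<Longrightarrow> \<bar>g y - g x\<bar> < e / 4"
      using padded_uniformly_continuous[OF g, of "e/4" "max R 0"] e by auto
    have "((\<lambda>r. \<Sum>k<n. measure M {\<omega> \<in> space M. \<bar>X r (t k) \<omega> - A r (t k) \<omega>\<bar> > \<delta>}) \<longlongrightarrow> (\<Sum>k<n. 0)) F"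
      by (intro tendsto_sum small \<delta>)
    then have "\<forall>\<^sub>F r in F. (\<Sum>k<n. measure M {\<omega> \<in> space M. \<bar>X r (t k) \<omega> - A r (t k) \<omega>\<bar> > \<delta>}) < e'"
      using e' by (intro order_tendstoD) auto
    then show "\<forall>\<^sub>F r in F. dist (\<integral>\<omega>. g (\<lambda>i. if i < n then X r (t i) \<omega> else 0) \<partial>M) (\<integral>\<omega>. g (\<lambda>i. if i < n then Z (t i) \<omega> else 0) \<partial>N) < e"
      using ch
    proof eventually_elim
      case (elim r)
      define GX where "GX \<omega> = g (\<lambda>i. if i < n then X r (t i) \<omega> else 0)" for \<omega>
      define GA where "GA \<omega> = g (\<lambda>i. if i < n then A r (t i) \<omega> else 0)" for \<omega>
      define S1 where "S1 = {\<omega> \<in> space M. \<exists>k<n. \<bar>X r (t k) \<omega> - A r (t k) \<omega>\<bar> > \<delta>}"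
      define S2 where "S2 = {\<omega> \<in> space M. \<exists>k<n. \<bar>A r (t k) \<omega>\<bar> > R}"
      have [measurable]: "GX \<in> borel_measurable M" "GA \<in> borel_measurable M"
        unfolding GX_def[abs_def] GA_def[abs_def]
        using gpad[of "\<lambda>i. X r (t i)" M] gpad[of "\<lambda>i. A r (t i)" M] by auto
      have [measurable]: "S1 \<in> sets M" "S2 \<in> sets M" unfolding S1_def S2_def by auto
      have "{\<omega> \<in> space M. \<exists>k<n. \<bar>X r (t k) \<omega> - A r (t k) \<omega>\<bar> > \<delta>} = (\<Union>k<n. {\<omega> \<in> space M. \<bar>X r (t k) \<omega> - A r (t k) \<omega>\<bar> > \<delta>})" by auto
      then have "measure M S1 \<le> (\<Sum>k<n. measure M {\<omega> \<in> space M. \<bar>X r (t k) \<omega> - A r (t k) \<omega>\<bar> > \<delta>})"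
        unfolding S1_def by (auto intro!: M.finite_measure_subadditive_finite)
      then have S1: "measure M S1 < e'" using elim(1) by simp
      define T where "T = {x \<in> space (PiM {..<n} (\<lambda>_. borel :: real measure)). \<exists>k\<in>{..<n}. \<bar>x k\<bar> > R}"
      have T: "T \<in> sets (PiM {..<n} (\<lambda>_. borel))" unfolding T_def by measurable
      have "measure M S2 = measure (distr M (PiM {..<n} (\<lambda>_. borel)) (\<lambda>\<omega>. \<lambda>k\<in>{..<n}. A r (t k) \<omega>)) T"
        using T by (subst measure_distr) (auto simp: S2_def T_def space_PiM intro!: arg_cong2[where f=measure])
      also have "\<dots> = measure N {\<omega> \<in> space N. \<exists>k<n. \<bar>Z (t k) \<omega>\<bar> > R}"
        using T unfolding law[OF elim(2)] by (subst measure_distr) (auto simp: T_def space_PiM intro!: arg_cong2[where f=measure])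
      finally have S2: "measure M S2 < e'" using R by simp
      have EA: "(\<integral>\<omega>. GA \<omega> \<partial>M) = (\<integral>\<omega>. g (\<lambda>i. if i < n then Z (t i) \<omega> else 0) \<partial>N)"
      proof -
        have "(\<integral>\<omega>. GA \<omega> \<partial>M) = (\<integral>x. g (\<lambda>i. if i < n then x i else 0) \<partial>distr M (PiM {..<n} (\<lambda>_. borel)) (\<lambda>\<omega>. \<lambda>k\<in>{..<n}. A r (t k) \<omega>))"
          unfolding GA_def by (subst integral_distr) (auto simp: gm cong: if_cong)
        also have "\<dots> = (\<integral>\<omega>. g (\<lambda>i. if i < n then Z (t i) \<omega> else 0) \<partial>N)"
          unfolding law[OF elim(2)] by (subst integral_distr) (auto simp: gm cong: if_cong)
        finally show ?thesis .
      qed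
      have int: "integrable M GX" "integrable M GA"
        by (rule M.integrable_const_bound[where B = C]; auto simp: GX_def GA_def C)+
      have bd: "\<bar>GX \<omega> - GA \<omega>\<bar> \<le> e / 4 + 2 * C * (indicator S1 \<omega> + indicator S2 \<omega>)" if "\<omega> \<in> space M" for \<omega>
      proof (cases "\<omega> \<in> S1 \<or> \<omega> \<in> S2")
        case True
        then have "1 \<le> (indicator S1 \<omega> + indicator S2 \<omega> :: real)" by (auto simp: indicator_def)
        then have "2 * C \<le> 2 * C * (indicator S1 \<omega> + indicator S2 \<omega>)" using C(2) by simp
        moreover have "\<bar>GX \<omega> - GA \<omega>\<bar> \<le> 2 * C"
          using C(1)[of "\<lambda>i. if i < n then X r (t i) \<omega> else 0"] C(1)[of "\<lambda>i. if i < n then A r (t i) \<omega> else 0"]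
          unfolding GX_def GA_def by linarith
        ultimately show ?thesis using e by linarith
      next
        case False
        then have "\<bar>X r (t k) \<omega> - A r (t k) \<omega>\<bar> \<le> \<delta>" "\<bar>A r (t k) \<omega>\<bar> \<le> R" if "k < n" for k
          using that False \<open>\<omega> \<in> space M\<close> by (auto simp: S1_def S2_def not_less) (meson not_le)+
        then have "\<bar>GX \<omega> - GA \<omega>\<bar> < e / 4"
          unfolding GX_def GA_def using \<delta>(1) by (intro \<delta>(2)) (auto simp: le_max_iff_disj)
        then show ?thesis using C False by simp
      qed
      have "\<bar>(\<integral>\<omega>. GX \<omega> \<partial>M) - (\<integral>\<omega>. GA \<omega> \<partial>M)\<bar> = \<bar>\<integral>\<omega>. GX \<omega> - GA \<omega> \<partial>M\<bar>"
        using int by simp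
      also have "\<dots> \<le> (\<integral>\<omega>. \<bar>GX \<omega> - GA \<omega>\<bar> \<partial>M)" by (rule integral_abs_bound)
      also have "\<dots> \<le> (\<integral>\<omega>. e / 4 + 2 * C * (indicator S1 \<omega> + indicator S2 \<omega>) \<partial>M)"
        using int bd by (intro integral_mono) (auto simp: M.emeasure_finite less_top[symmetric])
      also have "\<dots> = e / 4 + 2 * C * (measure M S1 + measure M S2)"
        by (simp add: M.emeasure_finite less_top[symmetric] M.prob_space)
      also have "\<dots> < e / 4 + 2 * C * (e' + e')" using S1 S2 C by simp
      also have "\<dots> < e" using C e by (simp add: e'_def)
      finally show ?case unfolding EA dist_real_def by (simp add: GX_def)
    qed
  qed
qed

section \<open>Series with random signs\<close>

locale rademacher = prob_space M for M :: "'a measure" +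
  fixes \<gamma> :: "nat \<Rightarrow> 'a \<Rightarrow> real"
  assumes indep: "indep_vars (\<lambda>_. borel) \<gamma> UNIV"
    and half1: "\<And>i. measure M {\<omega> \<in> space M. \<gamma> i \<omega> = 1} = 1 / 2"
    and half2: "\<And>i. measure M {\<omega> \<in> space M. \<gamma> i \<omega> = - 1} = 1 / 2"
begin

lemma measurable_sign[measurable]: "\<gamma> i \<in> borel_measurable M"
  using indep by (auto simp: indep_vars_def)

lemma AE_sign: "AE \<omega> in M. \<gamma> i \<omega> = 1 \<or> \<gamma> i \<omega> = - 1"
proof -
  have "measure M ({\<omega> \<in> space M. \<gamma> i \<omega> = 1} \<union> {\<omega> \<in> space M. \<gamma> i \<omega> = - 1}) = 1"
    by (subst finite_measure_Union) (auto simp: half1 half2)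
  also have "{\<omega> \<in> space M. \<gamma> i \<omega> = 1} \<union> {\<omega> \<in> space M. \<gamma> i \<omega> = - 1} = {\<omega> \<in> space M. \<gamma> i \<omega> = 1 \<or> \<gamma> i \<omega> = - 1}" by auto
  finally show ?thesis by (subst (asm) prob_Collect_eq_1) auto
qed

lemma AE_signs: "AE \<omega> in M. \<forall>i. \<gamma> i \<omega> = 1 \<or> \<gamma> i \<omega> = - 1"
  by (simp add: AE_all_countable AE_sign)

lemma integral_sign_fun:
  fixes f :: "real \<Rightarrow> 'b::{banach, second_countable_topology}"
  assumes [measurable]: "f \<in> borel_measurable borel"
  shows "(\<integral>\<omega>. f (\<gamma> i \<omega>) \<partial>M) = (1/2) *\<^sub>R (f 1 + f (- 1))"
proof -
  let ?A = "{\<omega> \<in> space M. \<gamma> i \<omega> = 1}" and ?B = "{\<omega> \<in> space M. \<gamma> i \<omega> = - 1}"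
  have "(\<integral>\<omega>. f (\<gamma> i \<omega>) \<partial>M) = (\<integral>\<omega>. indicator ?A \<omega> *\<^sub>R f 1 + indicator ?B \<omega> *\<^sub>R f (- 1) \<partial>M)"
    using AE_sign[of i] by (intro integral_cong_AE) (auto simp: indicator_def)
  also have "\<dots> = (1/2) *\<^sub>R (f 1 + f (- 1))"
    by (subst Bochner_Integration.integral_add)
       (auto simp: half1 half2 scaleR_add_right emeasure_finite less_top[symmetric])
  finally show ?thesis .
qed

text \<open>
  This is the martingale property of the partial sums of \<open>\<gamma> i * a i\<close>.
\<close>

lemma sign_orthogonal_to_past:
  fixes f :: "(nat \<Rightarrow> real) \<Rightarrow> real"
  assumes [measurable]: "f \<in> borel_measurable (PiM {..<n} (\<lambda>_. borel))"
    and int: "integrable M (\<lambda>\<omega>. f (\<lambda>i\<in>{..<n}. \<gamma> i \<omega>))"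
  shows "(\<integral>\<omega>. \<gamma> n \<omega> * f (\<lambda>i\<in>{..<n}. \<gamma> i \<omega>) \<partial>M) = 0"
proof -
  have "indep_var borel ((\<lambda>x. x n) \<circ> (\<lambda>\<omega>. \<lambda>i\<in>{n}. \<gamma> i \<omega>)) borel (f \<circ> (\<lambda>\<omega>. \<lambda>i\<in>{..<n}. \<gamma> i \<omega>))"
    by (intro indep_var_compose[OF indep_var_restrict[OF indep]]) auto
  then have "indep_var borel (\<gamma> n) borel (\<lambda>\<omega>. f (\<lambda>i\<in>{..<n}. \<gamma> i \<omega>))" by (simp add: comp_def)
  moreover have "integrable M (\<gamma> n)"
    using AE_sign[of n] by (intro integrable_const_bound[where B = 1]) auto
  ultimately have "(\<integral>\<omega>. \<gamma> n \<omega> * f (\<lambda>i\<in>{..<n}. \<gamma> i \<omega>) \<partial>M) = (\<integral>\<omega>. \<gamma> n \<omega> \<partial>M) * (\<integral>\<omega>. f (\<lambda>i\<in>{..<n}. \<gamma> i \<omega>) \<partial>M)"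
    using int by (intro indep_var_lebesgue_integral)
  also have "(\<integral>\<omega>. \<gamma> n \<omega> \<partial>M) = 0" using integral_sign_fun[of "\<lambda>x. x" n] by simp
  finally show ?thesis by (simp only: mult_zero_left)
qed

text \<open>
  Let \<open>g n\<close> indicate the paths that have stayed below \<open>\<epsilon>\<close> up to time \<open>n\<close>. Induction shows that
  \<open>\<epsilon>\<^sup>2 * (1 - E (g n)) + E (g n * (s n)\<^sup>2)\<close> is at most the sum of squares: in a step the cross term
  vanishes by orthogonality, and a path that leaves at this step moves at least \<open>\<epsilon>\<^sup>2\<close> from the second
  term to the first.
\<close>

lemma kolmogorov_inequality:
  fixes a :: "nat \<Rightarrow> real"
  assumes \<epsilon>: "0 < \<epsilon>"
  shows "measure M {\<omega> \<in> space M. \<exists>k\<le>n. \<epsilon> \<le> \<bar>\<Sum>i<k. \<gamma> i \<omega> * a i\<bar>} \<le> (\<Sum>i<n. (a i)\<^sup>2) / \<epsilon>\<^sup>2"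
proof -
  define S where "S n x = (\<Sum>i<n. x i * a i)" for n and x :: "nat \<Rightarrow> real"
  \<comment> \<open>the paths that have stayed below \<open>\<epsilon>\<close> up to time \<open>n\<close>\<close>
  define G where "G n x = (of_bool (\<forall>k\<le>n. \<bar>S k x\<bar> < \<epsilon>) :: real)" for n x
  have Sm: "S n \<in> borel_measurable (PiM {..<m} (\<lambda>_. borel))" if "n \<le> m" for n m
    unfolding S_def using that by (intro borel_measurable_sum borel_measurable_times measurable_component_singleton) auto
  have Gm: "G n \<in> borel_measurable (PiM {..<n} (\<lambda>_. borel))" for n
  proof -
    have "{x \<in> space (PiM {..<n} (\<lambda>_. borel)). \<forall>k\<in>{..n}. \<bar>S k x\<bar> < \<epsilon>} \<in> sets (PiM {..<n} (\<lambda>_. borel))"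
      by (intro sets.sets_Collect_finite_All borel_measurable_less borel_measurable_abs Sm) auto
    then have "(\<lambda>x. indicator {x \<in> space (PiM {..<n} (\<lambda>_. borel)). \<forall>k\<in>{..n}. \<bar>S k x\<bar> < \<epsilon>} x :: real) \<in> borel_measurable (PiM {..<n} (\<lambda>_. borel))"
      by (rule borel_measurable_indicator)
    then show ?thesis by (rule measurable_cong[THEN iffD1, rotated]) (auto simp: G_def indicator_def)
  qed
  define s where "s n \<omega> = S n (\<lambda>i. \<gamma> i \<omega>)" for n \<omega>
  define g where "g n \<omega> = G n (\<lambda>i. \<gamma> i \<omega>)" for n \<omega>
  have s_r: "S k (\<lambda>i\<in>{..<n}. \<gamma> i \<omega>) = s k \<omega>" if "k \<le> n" for k n \<omega>
    using that by (auto simp: s_def S_def intro!: sum.cong)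
  then have g_r: "G n (\<lambda>i\<in>{..<n}. \<gamma> i \<omega>) = g n \<omega>" for n \<omega>
    by (simp add: g_def G_def s_def)
  have sm[measurable]: "s n \<in> borel_measurable M" for n unfolding s_def S_def by measurable
  have gm[measurable]: "g n \<in> borel_measurable M" for n
    unfolding g_r[symmetric] by (rule measurable_compose[OF _ Gm]) measurable
  have g01: "g n \<omega> = 0 \<or> g n \<omega> = 1" for n \<omega>
  proof -
    have "of_bool P = (0::real) \<or> of_bool P = (1::real)" for P by (cases P) auto
    then show ?thesis unfolding g_def G_def .
  qed
  have s_bd: "AE \<omega> in M. \<bar>s n \<omega>\<bar> \<le> (\<Sum>i<n. \<bar>a i\<bar>)" for n
    using AE_signs
  proof eventually_elim
    case (elim \<omega>)
    have "\<bar>s n \<omega>\<bar> \<le> (\<Sum>i<n. \<bar>\<gamma> i \<omega> * a i\<bar>)" unfolding s_def S_def by (rule sum_abs)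
    also have "\<dots> = (\<Sum>i<n. \<bar>a i\<bar>)" using elim by (intro sum.cong refl) (metis abs_1 abs_minus_cancel abs_mult mult_1)
    finally show ?case .
  qed
  have g_bd: "0 \<le> g n \<omega>" "g n \<omega> \<le> 1" for n \<omega> using g01[of n \<omega>] by linarith+
  have int1: "integrable M (\<lambda>\<omega>. g m \<omega> * s n \<omega>)" for m n
  proof (intro integrable_const_bound[where B = "\<Sum>i<n. \<bar>a i\<bar>"])
    show "AE \<omega> in M. norm (g m \<omega> * s n \<omega>) \<le> (\<Sum>i<n. \<bar>a i\<bar>)"
      using s_bd[of n]
    proof eventually_elim
      case (elim \<omega>)
      then show ?case
        using mult_mono[OF g_bd(2)[of m \<omega>] elim] g_bd(1)[of m \<omega>] by (simp add: abs_mult)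
    qed
  qed measurable
  have int2: "integrable M (\<lambda>\<omega>. g m \<omega> * (s n \<omega>)\<^sup>2)" for m n
  proof (intro integrable_const_bound[where B = "(\<Sum>i<n. \<bar>a i\<bar>)\<^sup>2"])
    show "AE \<omega> in M. norm (g m \<omega> * (s n \<omega>)\<^sup>2) \<le> (\<Sum>i<n. \<bar>a i\<bar>)\<^sup>2"
      using s_bd[of n]
    proof eventually_elim
      case (elim \<omega>)
      then have "\<bar>s n \<omega>\<bar>\<^sup>2 \<le> (\<Sum>i<n. \<bar>a i\<bar>)\<^sup>2" by (rule power_mono) simp
      then have sq: "(s n \<omega>)\<^sup>2 \<le> (\<Sum>i<n. \<bar>a i\<bar>)\<^sup>2" by simp
      show ?case
        using mult_mono[OF g_bd(2)[of m \<omega>] sq] g_bd(1)[of m \<omega>] by (simp add: abs_mult)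
    qed
  qed measurable
  have intg: "integrable M (g m)" for m
    using g_bd[of m] by (intro integrable_const_bound[where B = 1]) (simp_all add: abs_le_iff le_minus_iff order_trans[of _ 0])
  have main: "\<epsilon>\<^sup>2 * (1 - (\<integral>\<omega>. g n \<omega> \<partial>M)) + (\<integral>\<omega>. g n \<omega> * (s n \<omega>)\<^sup>2 \<partial>M) \<le> (\<Sum>i<n. (a i)\<^sup>2)" for n
  proof (induction n)
    case 0
    have "g 0 \<omega> = 1" "s 0 \<omega> = 0" for \<omega> using \<epsilon> by (auto simp: g_def G_def s_def S_def)
    then show ?case by (simp add: prob_space)
  next
    case (Suc n)
    have orth: "(\<integral>\<omega>. \<gamma> n \<omega> * (g n \<omega> * s n \<omega>) \<partial>M) = 0"
      using sign_orthogonal_to_past[of "\<lambda>x. G n x * S n x" n] Gm[of n] Sm[of n n] int1[of n n]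
      by (simp add: g_r s_r)
    have int3: "integrable M (\<lambda>\<omega>. \<gamma> n \<omega> * (g n \<omega> * s n \<omega>))"
    proof (intro integrable_const_bound[where B = "\<Sum>i<n. \<bar>a i\<bar>"])
      show "AE \<omega> in M. norm (\<gamma> n \<omega> * (g n \<omega> * s n \<omega>)) \<le> (\<Sum>i<n. \<bar>a i\<bar>)"
        using AE_sign[of n] s_bd[of n]
      proof eventually_elim
        case (elim \<omega>)
        then show ?case
          using mult_mono[OF g_bd(2)[of n \<omega>] elim(2)] g_bd(1)[of n \<omega>] by (auto simp: abs_mult)
      qed
    qed measurable
    have "(\<integral>\<omega>. g n \<omega> * (s (Suc n) \<omega>)\<^sup>2 \<partial>M) = (\<integral>\<omega>. g n \<omega> * (s n \<omega>)\<^sup>2 + 2 * a n * (\<gamma> n \<omega> * (g n \<omega> * s n \<omega>)) + (a n)\<^sup>2 * g n \<omega> \<partial>M)"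
    proof (rule integral_cong_AE)
      show "AE \<omega> in M. g n \<omega> * (s (Suc n) \<omega>)\<^sup>2 = g n \<omega> * (s n \<omega>)\<^sup>2 + 2 * a n * (\<gamma> n \<omega> * (g n \<omega> * s n \<omega>)) + (a n)\<^sup>2 * g n \<omega>"
        using AE_sign[of n] by eventually_elim (auto simp: s_def S_def power2_eq_square algebra_simps)
    qed measurable
    also have "\<dots> = (\<integral>\<omega>. g n \<omega> * (s n \<omega>)\<^sup>2 \<partial>M) + (a n)\<^sup>2 * (\<integral>\<omega>. g n \<omega> \<partial>M)"
      using int2[of n n] int3 intg[of n] orth by simp
    finally have upd: "(\<integral>\<omega>. g n \<omega> * (s (Suc n) \<omega>)\<^sup>2 \<partial>M) = (\<integral>\<omega>. g n \<omega> * (s n \<omega>)\<^sup>2 \<partial>M) + (a n)\<^sup>2 * (\<integral>\<omega>. g n \<omega> \<partial>M)" .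
    have "(\<integral>\<omega>. \<epsilon>\<^sup>2 * (g n \<omega> - g (Suc n) \<omega>) + g (Suc n) \<omega> * (s (Suc n) \<omega>)\<^sup>2 \<partial>M) \<le> (\<integral>\<omega>. g n \<omega> * (s (Suc n) \<omega>)\<^sup>2 \<partial>M)"
    proof (rule integral_mono)
      fix \<omega>
      have "g (Suc n) \<omega> = g n \<omega> * of_bool (\<bar>s (Suc n) \<omega>\<bar> < \<epsilon>)"
        by (auto simp: g_def G_def s_def le_Suc_eq)
      moreover have "\<epsilon>\<^sup>2 \<le> (s (Suc n) \<omega>)\<^sup>2" if "\<not> \<bar>s (Suc n) \<omega>\<bar> < \<epsilon>"
        using that \<epsilon> by (simp add: abs_le_square_iff[symmetric])
      ultimately show "\<epsilon>\<^sup>2 * (g n \<omega> - g (Suc n) \<omega>) + g (Suc n) \<omega> * (s (Suc n) \<omega>)\<^sup>2 \<le> g n \<omega> * (s (Suc n) \<omega>)\<^sup>2"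
        using g01[of n \<omega>] by auto
    qed (use int2 intg in auto)
    then have "\<epsilon>\<^sup>2 * ((\<integral>\<omega>. g n \<omega> \<partial>M) - (\<integral>\<omega>. g (Suc n) \<omega> \<partial>M)) + (\<integral>\<omega>. g (Suc n) \<omega> * (s (Suc n) \<omega>)\<^sup>2 \<partial>M) \<le> (\<integral>\<omega>. g n \<omega> * (s (Suc n) \<omega>)\<^sup>2 \<partial>M)"
      using int2 intg by simp
    moreover have "(\<integral>\<omega>. g n \<omega> \<partial>M) \<le> 1"
      using integral_mono[OF intg[of n], of "\<lambda>_. 1"] g01[of n] g_bd(2)[of n] by (simp add: prob_space)
    then have "(a n)\<^sup>2 * (\<integral>\<omega>. g n \<omega> \<partial>M) \<le> (a n)\<^sup>2" by (simp add: mult_left_le)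
    ultimately show ?case using Suc upd by (simp add: algebra_simps)
  qed
  have "0 \<le> (\<integral>\<omega>. g n \<omega> * (s n \<omega>)\<^sup>2 \<partial>M)" using g_bd(1)[of n] by (intro integral_nonneg_AE AE_I2 mult_nonneg_nonneg) auto
  then have le: "\<epsilon>\<^sup>2 * (1 - (\<integral>\<omega>. g n \<omega> \<partial>M)) \<le> (\<Sum>i<n. (a i)\<^sup>2)" using main[of n] by linarith
  have "measure M {\<omega> \<in> space M. \<exists>k\<le>n. \<epsilon> \<le> \<bar>s k \<omega>\<bar>} = (\<integral>\<omega>. indicator {\<omega> \<in> space M. \<exists>k\<le>n. \<epsilon> \<le> \<bar>s k \<omega>\<bar>} \<omega> \<partial>M)" by simp
  also have "\<dots> = (\<integral>\<omega>. 1 - g n \<omega> \<partial>M)"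
    by (intro Bochner_Integration.integral_cong refl) (auto simp: g_def G_def s_def indicator_def not_less)
  also have "\<dots> = 1 - (\<integral>\<omega>. g n \<omega> \<partial>M)" using intg by (simp add: prob_space)
  finally show ?thesis using le \<epsilon> by (simp add: s_def S_def pos_le_divide_eq mult.commute)
qed

lemma kolmogorov_inequality_infinite:
  fixes a :: "nat \<Rightarrow> real"
  assumes \<epsilon>: "0 < \<epsilon>" and a: "summable (\<lambda>i. (a i)\<^sup>2)"
  shows "measure M {\<omega> \<in> space M. \<exists>k. \<epsilon> \<le> \<bar>\<Sum>i\<in>{m..<m+k}. \<gamma> i \<omega> * a i\<bar>} \<le> (\<Sum>i. (a (i + m))\<^sup>2) / \<epsilon>\<^sup>2"
proof -
  define b where "b i = (if m \<le> i then a i else 0)" for i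
  define A where "A n = {\<omega> \<in> space M. \<exists>k\<le>n. \<epsilon> \<le> \<bar>\<Sum>i<k. \<gamma> i \<omega> * b i\<bar>}" for n
  have sums_b: "(\<lambda>i. (b i)\<^sup>2) sums (\<Sum>i. (a (i + m))\<^sup>2)"
  proof -
    have "summable (\<lambda>i. (a (i + m))\<^sup>2)" using a by (subst summable_iff_shift)
    then have "(\<lambda>i. (b (i + m))\<^sup>2) sums (\<Sum>i. (a (i + m))\<^sup>2)" by (simp add: b_def summable_sums)
    then have "(\<lambda>i. (b i)\<^sup>2) sums ((\<Sum>i. (a (i + m))\<^sup>2) + (\<Sum>i<m. (b i)\<^sup>2))" by (subst (asm) sums_iff_shift)
    moreover have "(\<Sum>i<m. (b i)\<^sup>2) = 0" by (intro sum.neutral) (auto simp: b_def)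
    ultimately show ?thesis by simp
  qed
  have "(\<lambda>n. measure M (A n)) \<longlonglongrightarrow> measure M (\<Union>n. A n)"
    by (rule finite_Lim_measure_incseq) (auto simp: A_def incseq_def intro: order_trans)
  moreover have "measure M (A n) \<le> (\<Sum>i. (a (i + m))\<^sup>2) / \<epsilon>\<^sup>2" for n
  proof -
    have "measure M (A n) \<le> (\<Sum>i<n. (b i)\<^sup>2) / \<epsilon>\<^sup>2" unfolding A_def by (rule kolmogorov_inequality[OF \<epsilon>])
    also have "\<dots> \<le> (\<Sum>i. (b i)\<^sup>2) / \<epsilon>\<^sup>2"
      using sums_b by (intro divide_right_mono sum_le_suminf) (auto simp: sums_iff)
    finally show ?thesis using sums_b by (simp add: sums_iff)
  qed
  ultimately have le: "measure M (\<Union>n. A n) \<le> (\<Sum>i. (a (i + m))\<^sup>2) / \<epsilon>\<^sup>2"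
    by (intro LIMSEQ_le_const2) auto
  have sum_b: "(\<Sum>i<m+k. \<gamma> i \<omega> * b i) = (\<Sum>i\<in>{m..<m+k}. \<gamma> i \<omega> * a i)" for k \<omega>
    by (rule sum.mono_neutral_cong_right) (auto simp: b_def)
  have "measure M {\<omega> \<in> space M. \<exists>k. \<epsilon> \<le> \<bar>\<Sum>i\<in>{m..<m+k}. \<gamma> i \<omega> * a i\<bar>} \<le> measure M (\<Union>n. A n)"
  proof (rule finite_measure_mono)
    show "(\<Union>n. A n) \<in> sets M" by (auto simp: A_def)
    show "{\<omega> \<in> space M. \<exists>k. \<epsilon> \<le> \<bar>\<Sum>i\<in>{m..<m+k}. \<gamma> i \<omega> * a i\<bar>} \<subseteq> (\<Union>n. A n)"
      by (auto simp: A_def simp flip: sum_b)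
  qed
  with le show ?thesis by linarith
qed

text \<open>
  If the sum of the series exceeds \<open>\<epsilon>\<close>, then so does some partial sum.
\<close>

lemma sign_series_tail:
  fixes a :: "nat \<Rightarrow> real"
  assumes \<epsilon>: "0 < \<epsilon>" and a: "summable (\<lambda>i. (a i)\<^sup>2)"
  shows "measure M {\<omega> \<in> space M. \<epsilon> < \<bar>\<Sum>i. \<gamma> i \<omega> * a i\<bar> \<and> summable (\<lambda>i. \<gamma> i \<omega> * a i)} \<le> (\<Sum>i. (a i)\<^sup>2) / \<epsilon>\<^sup>2"
proof -
  have "measure M {\<omega> \<in> space M. \<epsilon> < \<bar>\<Sum>i. \<gamma> i \<omega> * a i\<bar> \<and> summable (\<lambda>i. \<gamma> i \<omega> * a i)} \<le>
    measure M {\<omega> \<in> space M. \<exists>k. \<epsilon> \<le> \<bar>\<Sum>i\<in>{0..<0+k}. \<gamma> i \<omega> * a i\<bar>}"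
  proof (rule finite_measure_mono)
    show "{\<omega> \<in> space M. \<epsilon> < \<bar>\<Sum>i. \<gamma> i \<omega> * a i\<bar> \<and> summable (\<lambda>i. \<gamma> i \<omega> * a i)} \<subseteq> {\<omega> \<in> space M. \<exists>k. \<epsilon> \<le> \<bar>\<Sum>i\<in>{0..<0+k}. \<gamma> i \<omega> * a i\<bar>}"
    proof safe
      fix \<omega> assume "\<epsilon> < \<bar>\<Sum>i. \<gamma> i \<omega> * a i\<bar>" "summable (\<lambda>i. \<gamma> i \<omega> * a i)"
      then have "(\<lambda>n. \<bar>\<Sum>i<n. \<gamma> i \<omega> * a i\<bar>) \<longlonglongrightarrow> \<bar>\<Sum>i. \<gamma> i \<omega> * a i\<bar>"
        by (intro tendsto_rabs summable_LIMSEQ)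
      from order_tendstoD(1)[OF this \<open>\<epsilon> < _\<close>]
      show "\<exists>k. \<epsilon> \<le> \<bar>\<Sum>i\<in>{0..<0+k}. \<gamma> i \<omega> * a i\<bar>"
        by (auto simp: eventually_sequentially atLeast0LessThan intro: less_imp_le)
    qed
  qed measurable
  also have "\<dots> \<le> (\<Sum>i. (a i)\<^sup>2) / \<epsilon>\<^sup>2" using kolmogorov_inequality_infinite[OF \<epsilon> a, of 0] by simp
  finally show ?thesis .
qed

text \<open>
  The maximal inequality for the tails shows that, for every threshold, almost every path has an \<open>m\<close> from
  which on all partial sums stay within the threshold of the \<open>m\<close>-th one. This is the Cauchy property.
\<close>

lemma sign_series_converges:
  fixes a :: "nat \<Rightarrow> real"
  assumes a: "summable (\<lambda>i. (a i)\<^sup>2)"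
  shows "AE \<omega> in M. summable (\<lambda>i. \<gamma> i \<omega> * a i)"
proof -
  have "AE \<omega> in M. \<exists>m. \<forall>k. \<bar>\<Sum>i\<in>{m..<m+k}. \<gamma> i \<omega> * a i\<bar> < 1 / Suc q" for q
  proof -
    define B where "B m = {\<omega> \<in> space M. \<exists>k. 1 / Suc q \<le> \<bar>\<Sum>i\<in>{m..<m+k}. \<gamma> i \<omega> * a i\<bar>}" for m
    have [measurable]: "B m \<in> sets M" for m unfolding B_def by measurable
    have le: "measure M (\<Inter>m. B m) \<le> (\<Sum>i. (a (i + m))\<^sup>2) / (1 / Suc q)\<^sup>2" for m
    proof -
      have "measure M (\<Inter>m. B m) \<le> measure M (B m)" by (intro finite_measure_mono) auto
      also have "\<dots> \<le> (\<Sum>i. (a (i + m))\<^sup>2) / (1 / Suc q)\<^sup>2"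
        unfolding B_def by (intro kolmogorov_inequality_infinite a) simp
      finally show ?thesis .
    qed
    have lim: "(\<lambda>m. (\<Sum>i. (a (i + m))\<^sup>2) / (1 / Suc q)\<^sup>2) \<longlonglongrightarrow> 0 / (1 / Suc q)\<^sup>2"
      by (intro tendsto_divide tendsto_const suminf_exist_split2[OF a]) auto
    have "measure M (\<Inter>m. B m) \<le> 0 / (1 / Suc q)\<^sup>2"
      by (rule LIMSEQ_le_const[OF lim]) (use le in blast)
    then have "(\<Inter>m. B m) \<in> null_sets M" by (auto simp: null_sets_def emeasure_eq_measure measure_nonneg antisym)
    then show ?thesis by (rule AE_I') (auto simp: B_def not_less)
  qed
  then have "AE \<omega> in M. \<forall>q. \<exists>m. \<forall>k. \<bar>\<Sum>i\<in>{m..<m+k}. \<gamma> i \<omega> * a i\<bar> < 1 / Suc q"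
    by (simp add: AE_all_countable)
  then show ?thesis
  proof eventually_elim
    case (elim \<omega>)
    show ?case unfolding summable_Cauchy
    proof (intro allI impI)
      fix e :: real assume "0 < e"
      then obtain q where q: "1 / Suc q < e / 2" using nat_approx_posE[of "e/2"] by auto
      obtain m where m: "\<And>k. \<bar>\<Sum>i\<in>{m..<m+k}. \<gamma> i \<omega> * a i\<bar> < 1 / Suc q" using elim by blast
      show "\<exists>N. \<forall>m\<ge>N. \<forall>n. norm (\<Sum>i\<in>{m..<n}. \<gamma> i \<omega> * a i) < e"
      proof (intro exI allI impI)
        fix l n assume l: "m \<le> l"
        show "norm (\<Sum>i\<in>{l..<n}. \<gamma> i \<omega> * a i) < e"
        proof (cases "l \<le> n")
          case True
          have "(\<Sum>i\<in>{m..<n}. \<gamma> i \<omega> * a i) = (\<Sum>i\<in>{m..<l}. \<gamma> i \<omega> * a i) + (\<Sum>i\<in>{l..<n}. \<gamma> i \<omega> * a i)"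
            using True l by (simp add: sum.atLeastLessThan_concat)
          then show ?thesis using m[of "l - m"] m[of "n - m"] True l q by simp
        qed (use \<open>0 < e\<close> in simp)
      qed
    qed
  qed
qed

end

section \<open>Arrival times of a unit-rate Poisson process\<close>

lemma nn_integral_poisson_pmf:
  assumes "0 < t"
  shows "(\<integral>\<^sup>+k. of_nat k \<partial>measure_pmf (poisson_pmf t)) = ennreal t"
proof -
  have "(\<lambda>k. t * exp (- t) * (t ^ k /\<^sub>R fact k)) sums (t * exp (- t) * exp t)"
    by (intro sums_mult exp_converges)
  then have "(\<lambda>k. real (Suc k) * (t ^ Suc k / fact (Suc k) * exp (- t))) sums t"
    by (simp add: exp_minus field_simps fact_Suc del: of_nat_Suc)
  then have s: "(\<lambda>k. real k * (t ^ k / fact k * exp (- t))) sums t"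
    by (subst (asm) sums_Suc_iff) simp
  have "(\<integral>\<^sup>+k. of_nat k \<partial>measure_pmf (poisson_pmf t)) = (\<Sum>k. ennreal (real k * (t ^ k / fact k * exp (- t))))"
    unfolding nn_integral_measure_pmf nn_integral_count_space_nat
    using assms by (intro suminf_cong) (simp add: ennreal_of_nat_eq_real_of_nat ennreal_mult[symmetric] field_simps)
  also have "\<dots> = ennreal t"
    using s assms by (subst suminf_ennreal2) (auto simp: sums_iff)
  finally show ?thesis .
qed

lemma poisson_pgf:
  fixes z :: real
  assumes "0 < t" "\<bar>z\<bar> \<le> 1"
  shows "(\<integral>k. z ^ k \<partial>measure_pmf (poisson_pmf t)) = exp (- (t * (1 - z)))"
proof -
  have s: "(\<lambda>k. exp (- t) * ((t * z) ^ k /\<^sub>R fact k)) sums (exp (- t) * exp (t * z))"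
    by (intro sums_mult exp_converges)
  have a: "summable (\<lambda>k. norm (exp (- t) * ((t * z) ^ k /\<^sub>R fact k)))"
    unfolding norm_mult by (intro summable_mult summable_norm_exp)
  have "(\<integral>k. z ^ k \<partial>measure_pmf (poisson_pmf t)) = (\<integral>k. pmf (poisson_pmf t) k *\<^sub>R z ^ k \<partial>count_space UNIV)"
    unfolding measure_pmf_eq_density by (subst integral_density) auto
  also have "\<dots> = (\<integral>k. exp (- t) * ((t * z) ^ k /\<^sub>R fact k) \<partial>count_space UNIV)"
    using assms by (intro Bochner_Integration.integral_cong) (auto simp: power_mult_distrib field_simps)
  also have "\<dots> = (\<Sum>k. exp (- t) * ((t * z) ^ k /\<^sub>R fact k))"
    by (rule integral_count_space_nat) (simp only: integrable_count_space_nat_iff a)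
  also have "\<dots> = exp (- t) * exp (t * z)" using s by (simp add: sums_iff)
  also have "\<dots> = exp (- (t * (1 - z)))" by (simp add: exp_add[symmetric] algebra_simps)
  finally show ?thesis .
qed

lemma grid_ceiling_tendsto:
  fixes x :: real
  shows "(\<lambda>m. real_of_int \<lceil>x * real (Suc m)\<rceil> / real (Suc m)) \<longlonglongrightarrow> x"
proof -
  define c where "c m = real_of_int \<lceil>x * real (Suc m)\<rceil> / real (Suc m)" for m
  have "(\<lambda>m. c m) \<longlonglongrightarrow> x"
  proof (rule tendsto_sandwich)
    have "x \<le> c m" "c m \<le> x + 1 / real (Suc m)" for m
      using ceiling_correct[of "x * real (Suc m)"] by (auto simp: c_def field_simps simp del: of_nat_Suc)
    then show "\<forall>\<^sub>F m in sequentially. x \<le> c m" "\<forall>\<^sub>F m in sequentially. c m \<le> x + 1 / real (Suc m)" by auto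
    show "(\<lambda>m. x + 1 / real (Suc m)) \<longlonglongrightarrow> x"
      using tendsto_add[OF tendsto_const LIMSEQ_Suc[OF lim_1_over_n], of x] by simp
  qed simp
  then show ?thesis by (simp only: c_def)
qed

text \<open>
  The right endpoint of each cell of the grid is used, so that \<open>\<psi>\<close> is never evaluated at 0, where it
  need not be continuous.
\<close>

lemma step_integral_tendsto:
  fixes \<psi> :: "real \<Rightarrow> real"
  assumes [measurable]: "\<psi> \<in> borel_measurable borel" and bd: "\<And>x. \<bar>\<psi> x\<bar> \<le> C" and cont: "continuous_on {0<..} \<psi>"
  shows "(\<lambda>m. \<Sum>k<Suc m * T. \<psi> (real (Suc k) / real (Suc m)) / real (Suc m)) \<longlonglongrightarrow> (LINT x:{0<..real T}|lborel. \<psi> x)"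
proof -
  define c where "c m x = real_of_int \<lceil>x * real (Suc m)\<rceil> / real (Suc m)" for m x
  have c_lim: "(\<lambda>m. c m x) \<longlonglongrightarrow> x" for x
    unfolding c_def by (rule grid_ceiling_tendsto)
  have "(\<lambda>m. LINT x:{0<..real T}|lborel. \<psi> (c m x)) \<longlonglongrightarrow> (LINT x:{0<..real T}|lborel. \<psi> x)"
    unfolding set_lebesgue_integral_def
  proof (rule integral_dominated_convergence[where w = "\<lambda>x. C * indicator {0<..real T} x"])
    show "AE x in lborel. (\<lambda>m. indicat_real {0<..real T} x *\<^sub>R \<psi> (c m x)) \<longlonglongrightarrow> indicat_real {0<..real T} x *\<^sub>R \<psi> x"
    proof (rule AE_I2)
      fix x :: real
      show "(\<lambda>m. indicat_real {0<..real T} x *\<^sub>R \<psi> (c m x)) \<longlonglongrightarrow> indicat_real {0<..real T} x *\<^sub>R \<psi> x"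
      proof (cases "0 < x")
        case True
        then have "isCont \<psi> x" using cont by (simp add: continuous_on_eq_continuous_at)
        from tendsto_compose[OF this[unfolded isCont_def] c_lim] isCont_tendsto_compose[OF this c_lim]
        show ?thesis by (intro tendsto_intros) 
      qed simp
    qed
    show "integrable lborel (\<lambda>x. C * indicator {0<..real T} x)" by simp
    show "AE x in lborel. norm (indicat_real {0<..real T} x *\<^sub>R \<psi> (c m x)) \<le> C * indicator {0<..real T} x" for m
      using bd by (auto simp: indicator_def)
  qed (simp_all add: c_def[abs_def])
  moreover have "(LINT x:{0<..real T}|lborel. \<psi> (c m x)) = (\<Sum>k<Suc m * T. \<psi> (real (Suc k) / real (Suc m)) / real (Suc m))" for m
  proof -
    have ind: "indicator {0<..real K / real (Suc m)} x * \<psi> (c m x) =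
      (\<Sum>k<K. indicator {real k / real (Suc m)<..real (Suc k) / real (Suc m)} x * \<psi> (real (Suc k) / real (Suc m)))" for K x
    proof (induction K)
      case (Suc K)
      have "indicator {real K / real (Suc m)<..real (Suc K) / real (Suc m)} x * \<psi> (c m x) = indicator {real K / real (Suc m)<..real (Suc K) / real (Suc m)} x * \<psi> (real (Suc K) / real (Suc m))"
      proof (cases "x \<in> {real K / real (Suc m)<..real (Suc K) / real (Suc m)}")
        case True
        then have "\<lceil>x * real (Suc m)\<rceil> = int (Suc K)"
          by (intro ceiling_unique) (auto simp: field_simps)
        then show ?thesis by (simp add: c_def)
      qed simp
      moreover have "indicator {0<..b} x = indicator {0<..a} x + (indicator {a<..b} x :: real)" if "0 \<le> a" "a \<le> b" for a b
        using that by (auto simp: indicator_def)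
      then have "indicator {0<..real (Suc K) / real (Suc m)} x = indicator {0<..real K / real (Suc m)} x + (indicator {real K / real (Suc m)<..real (Suc K) / real (Suc m)} x :: real)"
        by (rule meta_mp) (auto intro!: divide_right_mono)
      ultimately show ?case using Suc by (simp only: sum.lessThan_Suc distrib_right)
    qed simp
    have T: "real T = real (Suc m * T) / real (Suc m)" by (simp only: of_nat_mult) simp
    have "(LINT x:{0<..real T}|lborel. \<psi> (c m x)) = (\<integral>x. (\<Sum>k<Suc m * T. indicator {real k / real (Suc m)<..real (Suc k) / real (Suc m)} x * \<psi> (real (Suc k) / real (Suc m))) \<partial>lborel)"
      unfolding set_lebesgue_integral_def ind[symmetric] T[symmetric] by simp
    also have "\<dots> = (\<Sum>k<Suc m * T. measure lborel {real k / real (Suc m)<..real (Suc k) / real (Suc m)} * \<psi> (real (Suc k) / real (Suc m)))"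
    proof -
      have "integrable lborel (indicat_real {a<..b})" for a b :: real
        by (cases "a \<le> b") simp_all
      then show ?thesis by (subst Bochner_Integration.integral_sum) simp_all
    qed
    also have "\<dots> = (\<Sum>k<Suc m * T. \<psi> (real (Suc k) / real (Suc m)) / real (Suc m))"
      by (intro sum.cong refl) (simp add: divide_right_mono field_simps)
    finally show ?thesis .
  qed
  ultimately show ?thesis by simp
qed

text \<open>
  Arrival times and counting process linked by \<open>\<Gamma> i \<le> t \<longleftrightarrow> i < N t\<close>. All properties of the arrival times
  are derived from this equivalence and the increments of \<open>N\<close>; the joint law of the arrival times is
  never computed.
\<close>

locale poisson_points = prob_space M for M :: "'a measure" +
  fixes \<Gamma> :: "nat \<Rightarrow> 'a \<Rightarrow> real" and N :: "real \<Rightarrow> 'a \<Rightarrow> nat"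
  assumes measurable_\<Gamma>[measurable]: "\<And>i. \<Gamma> i \<in> borel_measurable M"
    and measurable_N: "\<And>t. 0 \<le> t \<Longrightarrow> N t \<in> measurable M (count_space UNIV)"
    and arrival_iff: "AE \<omega> in M. \<forall>i t. 0 \<le> t \<longrightarrow> (\<Gamma> i \<omega> \<le> t \<longleftrightarrow> i < N t \<omega>)"
    and arrival_pos: "AE \<omega> in M. \<forall>i. 0 < \<Gamma> i \<omega>"
    and N_0: "AE \<omega> in M. N 0 \<omega> = 0"
    and N_mono: "AE \<omega> in M. mono_on {0..} (\<lambda>t. N t \<omega>)"
    and N_indep: "\<And>t n. 0 \<le> t 0 \<Longrightarrow> incseq t \<Longrightarrow>
      indep_vars (\<lambda>_. count_space UNIV) (\<lambda>k \<omega>. N (t (Suc k)) \<omega> - N (t k) \<omega>) {..<n::nat}"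
    and N_law: "\<And>s t. 0 \<le> s \<Longrightarrow> s < t \<Longrightarrow>
      distr M (count_space UNIV) (\<lambda>\<omega>. N t \<omega> - N s \<omega>) = measure_pmf (poisson_pmf (t - s))"

text \<open>
  Almost surely the path of \<open>N\<close> is unbounded, so the infima are over nonempty sets. Right-continuity of
  a path with values in the naturals makes it constant on a short interval to the right, hence the
  infimum is attained, and the equivalence holds with \<open>\<le>\<close>.
\<close>

lemma poisson_arrival_timesE:
  assumes "poisson_arrival_times M 1 \<Gamma>"
  obtains N where "poisson_points M \<Gamma> N"
proof -
  obtain N where N: "poisson_process M 1 N" and \<Gamma>: "\<And>i. \<Gamma> i \<in> borel_measurable M"
    and \<Gamma>_eq: "\<And>i. AE \<omega> in M. \<Gamma> i \<omega> = Inf {t. 0 \<le> t \<and> i + 1 \<le> N t \<omega>}"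
    using assms unfolding poisson_arrival_times_def by blast
  interpret prob_space M using N by (simp add: poisson_process_def)
  have Nm: "\<And>t. 0 \<le> t \<Longrightarrow> N t \<in> measurable M (count_space UNIV)"
    and path: "AE \<omega> in M. N 0 \<omega> = 0 \<and> mono_on {0..} (\<lambda>t. N t \<omega>) \<and> (\<forall>t \<ge> 0. continuous (at_right t) (\<lambda>s. N s \<omega>))"
    and ind: "\<And>t n. 0 \<le> t 0 \<Longrightarrow> incseq t \<Longrightarrow>
      indep_vars (\<lambda>_. count_space UNIV) (\<lambda>k \<omega>. N (t (Suc k)) \<omega> - N (t k) \<omega>) {..<n::nat}"
    and law: "\<And>s t. 0 \<le> s \<Longrightarrow> s < t \<Longrightarrow>
      distr M (count_space UNIV) (\<lambda>\<omega>. N t \<omega> - N s \<omega>) = measure_pmf (poisson_pmf (t - s))"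
    using N by (auto simp: poisson_process_def)
  have unbounded: "AE \<omega> in M. \<exists>t\<ge>0. i + 1 \<le> N t \<omega>" for i
  proof -
    define B where "B n = {\<omega> \<in> space M. N (real n) \<omega> - N 0 \<omega> \<le> i}" for n
    have [measurable]: "N (real n) \<in> measurable M (count_space UNIV)" "N 0 \<in> measurable M (count_space UNIV)" for n
      by (auto intro: Nm)
    have Bm[measurable]: "B n \<in> sets M" for n unfolding B_def by measurable
    have B: "measure M (B n) = (\<Sum>j\<le>i. real n ^ j / fact j * exp (- real n))" if "0 < n" for n
    proof -
      have "measure M (B n) = measure (distr M (count_space UNIV) (\<lambda>\<omega>. N (real n) \<omega> - N 0 \<omega>)) {..i}"
        by (subst measure_distr) (auto simp: B_def intro!: arg_cong2[where f=measure])
      also have "\<dots> = (\<Sum>j\<le>i. pmf (poisson_pmf (real n)) j)"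
        using that by (subst law) (auto simp: measure_measure_pmf_finite)
      finally show ?thesis using that by simp
    qed
    have "(\<lambda>n. \<Sum>j\<le>i. real n ^ j / fact j * exp (- real n)) \<longlonglongrightarrow> (\<Sum>j\<le>i. 0)"
    proof (intro tendsto_sum)
      fix j
      have "((\<lambda>x::real. x ^ j / exp x) \<longlongrightarrow> 0) at_top" by (rule tendsto_power_div_exp_0)
      then have "(\<lambda>n. real n ^ j / exp (real n)) \<longlonglongrightarrow> 0" by (rule filterlim_compose[OF _ filterlim_real_sequentially])
      from tendsto_divide[OF this tendsto_const, of "fact j"]
      show "(\<lambda>n. real n ^ j / fact j * exp (- real n)) \<longlonglongrightarrow> 0" by (simp add: exp_minus field_simps)
    qed
    then have lim: "(\<lambda>n. \<Sum>j\<le>i. real n ^ j / fact j * exp (- real n)) \<longlonglongrightarrow> 0" by simp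
    have "measure M (\<Inter>n. B n) \<le> 0"
    proof (rule LIMSEQ_le_const[OF lim], intro exI allI impI)
      fix n :: nat assume "1 \<le> n"
      then have "measure M (B n) = (\<Sum>j\<le>i. real n ^ j / fact j * exp (- real n))" by (intro B) simp
      then show "measure M (\<Inter>n. B n) \<le> (\<Sum>j\<le>i. real n ^ j / fact j * exp (- real n))"
        using finite_measure_mono[of "\<Inter>n. B n" "B n"] by auto
    qed
    then have "(\<Inter>n. B n) \<in> null_sets M" by (auto simp: null_sets_def emeasure_eq_measure measure_nonneg antisym)
    then have "AE \<omega> in M. \<omega> \<notin> (\<Inter>n. B n)" by (rule AE_not_in)
    then show ?thesis
    proof (rule AE_mp, intro AE_I2 impI)
      fix \<omega> assume "\<omega> \<in> space M" "\<omega> \<notin> (\<Inter>n. B n)"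
      then obtain n where "i < N (real n) \<omega> - N 0 \<omega>" by (auto simp: B_def not_le)
      then show "\<exists>t\<ge>0. i + 1 \<le> N t \<omega>" by (intro exI[of _ "real n"]) auto
    qed
  qed
  have "AE \<omega> in M. \<forall>i. \<exists>t\<ge>0. i + 1 \<le> N t \<omega>" "AE \<omega> in M. \<forall>i. \<Gamma> i \<omega> = Inf {t. 0 \<le> t \<and> i + 1 \<le> N t \<omega>}"
    using unbounded \<Gamma>_eq by (auto simp: AE_all_countable)
  with path have AE: "AE \<omega> in M. (\<forall>i t. 0 \<le> t \<longrightarrow> (\<Gamma> i \<omega> \<le> t \<longleftrightarrow> i < N t \<omega>)) \<and> (\<forall>i. 0 < \<Gamma> i \<omega>)"
  proof eventually_elim
    case (elim \<omega>)
    note mono = mono_onD[of "{0..}" "\<lambda>t. N t \<omega>"]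
    have iff: "\<Gamma> i \<omega> \<le> t \<longleftrightarrow> i < N t \<omega>" if t: "0 \<le> t" for i t
    proof
      let ?S = "{t. 0 \<le> t \<and> i + 1 \<le> N t \<omega>}"
      have bdd: "bdd_below ?S" by (rule bdd_belowI[of _ 0]) auto
      have ne: "?S \<noteq> {}" using elim by auto
      have eq: "\<Gamma> i \<omega> = Inf ?S" using elim by auto
      { assume "i < N t \<omega>"
        then show "\<Gamma> i \<omega> \<le> t" unfolding eq using t by (intro cInf_lower bdd) auto }
      { assume le: "\<Gamma> i \<omega> \<le> t"
        have g0: "0 \<le> \<Gamma> i \<omega>" unfolding eq by (rule cInf_greatest[OF ne]) auto
        have above: "i < N s \<omega>" if "\<Gamma> i \<omega> < s" for s
        proof -
          have "Inf ?S < s" using that eq by simp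
          from cInf_lessD[OF ne this] obtain s' where "s' \<in> ?S" "s' < s" by auto
          then show ?thesis using mono[of s' s] elim by auto
        qed
        have "((\<lambda>s. N s \<omega>) \<longlongrightarrow> N (\<Gamma> i \<omega>) \<omega>) (at_right (\<Gamma> i \<omega>))"
          using elim g0 by (auto simp: continuous_within)
        then have "\<forall>\<^sub>F s in at_right (\<Gamma> i \<omega>). N s \<omega> = N (\<Gamma> i \<omega>) \<omega>"
          by (simp only: tendsto_discrete)
        moreover have "\<forall>\<^sub>F s in at_right (\<Gamma> i \<omega>). i < N s \<omega>"
          by (rule eventually_mono[OF eventually_at_right_less above])
        ultimately have "\<forall>\<^sub>F s in at_right (\<Gamma> i \<omega>). i < N (\<Gamma> i \<omega>) \<omega>" by eventually_elim simp
        then have "i < N (\<Gamma> i \<omega>) \<omega>" by simp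
        also have "\<dots> \<le> N t \<omega>" using mono[of "\<Gamma> i \<omega>" t] elim g0 le t by auto
        finally show "i < N t \<omega>" . }
    qed
    moreover have "0 < \<Gamma> i \<omega>" for i
      using iff[of 0 i] elim by auto
    ultimately show ?case by auto
  qed
  have "poisson_points M \<Gamma> N"
    by unfold_locales (use \<Gamma> Nm ind law path AE in \<open>auto elim: eventually_mono\<close>)
  then show thesis by (rule that)
qed

context poisson_points
begin

text \<open>
  Campbell's formula. The left-hand side is the integral of \<open>f\<close> over the intensity measure of the arrival
  times. That measure and Lebesgue measure on the half-line agree on \<open>{..t}\<close>, because the expected number
  of arrivals up to \<open>t\<close> is \<open>t\<close>.
\<close>

lemma campbell:
  assumes [measurable]: "f \<in> borel_measurable borel"
  shows "(\<Sum>i. \<integral>\<^sup>+\<omega>. f (\<Gamma> i \<omega>) \<partial>M) = (\<integral>\<^sup>+x. f x * indicator {0<..} x \<partial>lborel)"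
proof -
  interpret C: sigma_finite_measure "count_space (UNIV :: nat set)" by (rule sigma_finite_measure_count_space)
  interpret P: pair_sigma_finite "count_space (UNIV :: nat set)" M ..
  define \<nu> where "\<nu> = distr (count_space (UNIV :: nat set) \<Otimes>\<^sub>M M) borel (\<lambda>(i, \<omega>). \<Gamma> i \<omega>)"
  have m[measurable]: "(\<lambda>(i, \<omega>). \<Gamma> i \<omega>) \<in> borel_measurable (count_space (UNIV :: nat set) \<Otimes>\<^sub>M M)"
    unfolding split_beta' by (rule measurable_compose_countable'[where I = UNIV and f = "\<lambda>i x. \<Gamma> i (snd x)"]) auto
  have int: "integral\<^sup>N \<nu> f = (\<Sum>i. \<integral>\<^sup>+\<omega>. f (\<Gamma> i \<omega>) \<partial>M)" if [measurable]: "f \<in> borel_measurable borel" for f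
  proof -
    have "integral\<^sup>N \<nu> f = (\<integral>\<^sup>+x. f (case x of (i, \<omega>) \<Rightarrow> \<Gamma> i \<omega>) \<partial>(count_space (UNIV :: nat set) \<Otimes>\<^sub>M M))"
      unfolding \<nu>_def by (subst nn_integral_distr) auto
    also have "\<dots> = (\<integral>\<^sup>+i. \<integral>\<^sup>+\<omega>. f (\<Gamma> i \<omega>) \<partial>M \<partial>count_space UNIV)"
      by (subst nn_integral_fst[symmetric]) auto
    finally show ?thesis by (simp add: nn_integral_count_space_nat)
  qed
  have atMost: "emeasure \<nu> {..t} = ennreal (max 0 t)" for t
  proof -
    have "emeasure \<nu> {..t} = integral\<^sup>N \<nu> (indicator {..t})" by (simp add: \<nu>_def)
    also have "\<dots> = (\<Sum>i. emeasure M {\<omega> \<in> space M. \<Gamma> i \<omega> \<le> t})"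
      by (subst int) (auto intro!: suminf_cong simp: nn_integral_indicator[symmetric] simp del: nn_integral_indicator cong: nn_integral_cong intro!: nn_integral_cong split: split_indicator)
    also have "\<dots> = ennreal (max 0 t)"
    proof (cases "0 < t")
      case False
      have "emeasure M {\<omega> \<in> space M. \<Gamma> i \<omega> \<le> t} = 0" for i
        using arrival_pos False by (intro emeasure_eq_0_AE) (auto elim!: eventually_mono simp: not_le dest: spec[of _ i])
      then show ?thesis using False by simp
    next
      case True
      note [measurable] = measurable_N[of t, OF less_imp_le[OF True]] measurable_N[of 0, simplified]
      have "emeasure M {\<omega> \<in> space M. \<Gamma> i \<omega> \<le> t} = emeasure M {\<omega> \<in> space M. i < N t \<omega> - N 0 \<omega>}" for i
        using arrival_iff N_0 True by (intro emeasure_eq_AE) (auto elim: eventually_elim2)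
      then have "(\<Sum>i. emeasure M {\<omega> \<in> space M. \<Gamma> i \<omega> \<le> t}) = (\<integral>\<^sup>+\<omega>. of_nat (N t \<omega> - N 0 \<omega>) \<partial>M)"
        by (subst nn_integral_nat_function) auto
      also have "\<dots> = (\<integral>\<^sup>+k. of_nat k \<partial>distr M (count_space UNIV) (\<lambda>\<omega>. N t \<omega> - N 0 \<omega>))"
        by (subst nn_integral_distr) auto
      also have "\<dots> = ennreal t" using True by (subst N_law) (auto simp: nn_integral_poisson_pmf)
      finally show ?thesis using True by simp
    qed
    finally show ?thesis .
  qed
  have "\<nu> = density lborel (indicator {0<..})"
  proof (rule measure_eqI_generator_eq[where E = "range atMost" and \<Omega> = UNIV and A = "\<lambda>n. {..real n}"])
    show "Int_stable (range (atMost :: real \<Rightarrow> _))" by (auto simp: Int_stable_def)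
    show "sets \<nu> = sigma_sets UNIV (range atMost)" by (simp add: \<nu>_def) (simp add: borel_eq_atMost)
    show "sets (density lborel (indicator {0<..})) = sigma_sets UNIV (range (atMost :: real \<Rightarrow> _))" by simp (simp add: borel_eq_atMost)
    show "(\<Union>i. {..real i}) = UNIV" using real_arch_simple by auto
    show "emeasure \<nu> {..real i} \<noteq> \<infinity>" for i by (simp add: atMost)
    fix X :: "real set" assume "X \<in> range atMost"
    then obtain t where X: "X = {..t}" by auto
    have "emeasure (density lborel (indicator {0<..})) {..t} = emeasure lborel ({0<..} \<inter> {..t})"
      by (simp add: emeasure_density nn_integral_set_ennreal indicator_inter_arith[symmetric])
    also have "{0<..} \<inter> {..t} = {0<..t}" by auto
    finally show "emeasure \<nu> X = emeasure (density lborel (indicator {0<..})) X"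
      unfolding X atMost by (cases "0 \<le> t") (auto simp: max_def)
  qed auto
  then have "integral\<^sup>N \<nu> f = (\<integral>\<^sup>+x. indicator {0<..} x * f x \<partial>lborel)"
    by (simp add: nn_integral_density)
  then show ?thesis by (simp add: int mult.commute)
qed

text \<open>
  The Laplace functional of the Poisson process, in multiplicative form. If every arrival is rounded up
  to a grid, the product becomes a product of powers of values of \<open>\<phi>\<close> over independent increments of \<open>N\<close>,
  whose expectations are given by the Poisson generating function. Refining the grid turns
  the exponent into an integral.
\<close>

lemma expectation_prod_arrivals:
  fixes \<phi> :: "real \<Rightarrow> real"
  assumes \<phi>[measurable]: "\<phi> \<in> borel_measurable borel" and bd: "\<And>x. \<bar>\<phi> x\<bar> \<le> 1" and cont: "continuous_on {0<..} \<phi>"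
  shows "(\<integral>\<omega>. (\<Prod>i<N (real T) \<omega>. \<phi> (\<Gamma> i \<omega>)) \<partial>M) = exp (- (LINT x:{0<..real T}|lborel. 1 - \<phi> x))"
proof -
  define c where "c m x = real_of_int \<lceil>x * real (Suc m)\<rceil> / real (Suc m)" for m x
  have c_lim: "(\<lambda>m. c m x) \<longlonglongrightarrow> x" for x
    unfolding c_def by (rule grid_ceiling_tendsto)
  have Nm[measurable]: "N (real k / real (Suc m)) \<in> measurable M (count_space UNIV)" "N (real k) \<in> measurable M (count_space UNIV)" for k m
    by (auto intro: measurable_N)
  have prod_m: "(\<lambda>\<omega>. \<Prod>i<N (real T) \<omega>. f (\<Gamma> i \<omega>)) \<in> borel_measurable M" if [measurable]: "f \<in> borel_measurable borel" for f :: "real \<Rightarrow> real"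
    by (rule measurable_compose_countable[where f = "\<lambda>n \<omega>. \<Prod>i<n. f (\<Gamma> i \<omega>)"]) auto
  have prod_bd: "\<bar>\<Prod>i\<in>A. f i\<bar> \<le> 1" if "\<And>i. \<bar>f i\<bar> \<le> 1" for A :: "'i set" and f :: "'i \<Rightarrow> real"
    unfolding abs_prod using that by (intro prod_le_1) auto
  \<comment> \<open>on a grid cell \<open>\<phi>\<close> takes one value, once for each arrival in the cell\<close>
  have grid: "AE \<omega> in M. (\<Prod>k<K. \<phi> (real (Suc k) / real (Suc m)) ^ (N (real (Suc k) / real (Suc m)) \<omega> - N (real k / real (Suc m)) \<omega>)) =
    (\<Prod>i<N (real K / real (Suc m)) \<omega>. \<phi> (c m (\<Gamma> i \<omega>)))" for K m
    using arrival_iff N_0 N_mono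
  proof eventually_elim
    case (elim \<omega>)
    show ?case
    proof (induction K)
      case 0 then show ?case using elim(2) by simp
    next
      case (Suc K)
      let ?s = "real K / real (Suc m)" and ?t = "real (Suc K) / real (Suc m)"
      have st: "0 \<le> ?s" "?s \<le> ?t" "0 \<le> ?t" by (auto simp: divide_right_mono)
      have le: "N ?s \<omega> \<le> N ?t \<omega>" using mono_onD[OF elim(3), of ?s ?t] st by simp
      have "\<phi> (c m (\<Gamma> i \<omega>)) = \<phi> ?t" if "i \<in> {N ?s \<omega>..<N ?t \<omega>}" for i
      proof -
        have "\<not> \<Gamma> i \<omega> \<le> ?s" "\<Gamma> i \<omega> \<le> ?t" using that elim(1) st by auto
        then have "\<lceil>\<Gamma> i \<omega> * real (Suc m)\<rceil> = int (Suc K)"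
          by (intro ceiling_unique) (auto simp: field_simps)
        then show ?thesis by (simp add: c_def)
      qed
      then have "(\<Prod>i\<in>{N ?s \<omega>..<N ?t \<omega>}. \<phi> (c m (\<Gamma> i \<omega>))) = \<phi> ?t ^ (N ?t \<omega> - N ?s \<omega>)" by simp
      moreover have "(\<Prod>i<N ?t \<omega>. \<phi> (c m (\<Gamma> i \<omega>))) = (\<Prod>i<N ?s \<omega>. \<phi> (c m (\<Gamma> i \<omega>))) * (\<Prod>i\<in>{N ?s \<omega>..<N ?t \<omega>}. \<phi> (c m (\<Gamma> i \<omega>)))"
        using le by (simp add: prod.atLeastLessThan_concat lessThan_atLeast0)
      ultimately show ?case using Suc by simp
    qed
  qed
  have step: "(\<integral>\<omega>. (\<Prod>i<N (real T) \<omega>. \<phi> (c m (\<Gamma> i \<omega>))) \<partial>M) = exp (- (\<Sum>k<Suc m * T. (1 - \<phi> (real (Suc k) / real (Suc m))) / real (Suc m)))" for m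
  proof -
    define t where "t k = real k / real (Suc m)" for k
    have t: "0 \<le> t k" "t k < t (Suc k)" "t (Suc k) - t k = 1 / real (Suc m)" for k
      by (auto simp: t_def divide_strict_right_mono diff_divide_distrib[symmetric])
    have [measurable]: "N (t k) \<in> measurable M (count_space UNIV)" for k by (simp add: t_def del: of_nat_Suc)
    have T: "real T = t (Suc m * T)" by (simp only: t_def of_nat_mult) simp
    have "indep_vars (\<lambda>_. borel) (\<lambda>k \<omega>. \<phi> (t (Suc k)) ^ (N (t (Suc k)) \<omega> - N (t k) \<omega>)) {..<Suc m * T}"
      by (rule indep_vars_compose2[OF N_indep[of t "Suc m * T"], where Y = "\<lambda>k j. \<phi> (t (Suc k)) ^ j"])
        (use t in \<open>auto intro!: incseq_SucI less_imp_le\<close>)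
    then have "(\<integral>\<omega>. (\<Prod>k<Suc m * T. \<phi> (t (Suc k)) ^ (N (t (Suc k)) \<omega> - N (t k) \<omega>)) \<partial>M) =
      (\<Prod>k<Suc m * T. \<integral>\<omega>. \<phi> (t (Suc k)) ^ (N (t (Suc k)) \<omega> - N (t k) \<omega>) \<partial>M)"
      by (intro indep_vars_lebesgue_integral integrable_const_bound[where B = 1]) (auto simp: power_abs bd power_le_one)
    also have "\<dots> = (\<Prod>k<Suc m * T. exp (- ((1 - \<phi> (t (Suc k))) / real (Suc m))))"
    proof (intro prod.cong refl)
      fix k
      have "(\<integral>\<omega>. \<phi> (t (Suc k)) ^ (N (t (Suc k)) \<omega> - N (t k) \<omega>) \<partial>M) =
        (\<integral>j. \<phi> (t (Suc k)) ^ j \<partial>distr M (count_space UNIV) (\<lambda>\<omega>. N (t (Suc k)) \<omega> - N (t k) \<omega>))"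
        by (subst integral_distr) auto
      also have "\<dots> = exp (- ((t (Suc k) - t k) * (1 - \<phi> (t (Suc k)))))"
        using t[of k] bd by (subst N_law) (simp_all only: poisson_pgf diff_gt_0_iff_gt)
      finally show "(\<integral>\<omega>. \<phi> (t (Suc k)) ^ (N (t (Suc k)) \<omega> - N (t k) \<omega>) \<partial>M) = exp (- ((1 - \<phi> (t (Suc k))) / real (Suc m)))"
        unfolding t by simp
    qed
    also have "\<dots> = exp (- (\<Sum>k<Suc m * T. (1 - \<phi> (t (Suc k))) / real (Suc m)))"
      by (simp only: exp_sum[OF finite_lessThan, symmetric] sum_negf)
    finally have "(\<integral>\<omega>. (\<Prod>k<Suc m * T. \<phi> (t (Suc k)) ^ (N (t (Suc k)) \<omega> - N (t k) \<omega>)) \<partial>M) = exp (- (\<Sum>k<Suc m * T. (1 - \<phi> (t (Suc k))) / real (Suc m)))" .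
    moreover have "(\<integral>\<omega>. (\<Prod>k<Suc m * T. \<phi> (t (Suc k)) ^ (N (t (Suc k)) \<omega> - N (t k) \<omega>)) \<partial>M) = (\<integral>\<omega>. (\<Prod>i<N (real T) \<omega>. \<phi> (c m (\<Gamma> i \<omega>))) \<partial>M)"
    proof (rule integral_cong_AE)
      show "AE \<omega> in M. (\<Prod>k<Suc m * T. \<phi> (t (Suc k)) ^ (N (t (Suc k)) \<omega> - N (t k) \<omega>)) = (\<Prod>i<N (real T) \<omega>. \<phi> (c m (\<Gamma> i \<omega>)))"
        unfolding T using grid[of m "Suc m * T"] by (simp only: t_def)
      show "(\<lambda>\<omega>. \<Prod>i<N (real T) \<omega>. \<phi> (c m (\<Gamma> i \<omega>))) \<in> borel_measurable M"
        by (rule prod_m) (simp add: c_def)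
    qed measurable
    ultimately show ?thesis by (simp only: t_def)
  qed
  have "(\<lambda>m. \<integral>\<omega>. (\<Prod>i<N (real T) \<omega>. \<phi> (c m (\<Gamma> i \<omega>))) \<partial>M) \<longlonglongrightarrow> (\<integral>\<omega>. (\<Prod>i<N (real T) \<omega>. \<phi> (\<Gamma> i \<omega>)) \<partial>M)"
  proof (rule integral_dominated_convergence[where w = "\<lambda>_. 1"])
    show "AE \<omega> in M. (\<lambda>m. \<Prod>i<N (real T) \<omega>. \<phi> (c m (\<Gamma> i \<omega>))) \<longlonglongrightarrow> (\<Prod>i<N (real T) \<omega>. \<phi> (\<Gamma> i \<omega>))"
      using arrival_pos
    proof eventually_elim
      case (elim \<omega>)
      show ?case
      proof (rule tendsto_prod)
        fix i
        have "isCont \<phi> (\<Gamma> i \<omega>)" using cont elim by (simp add: continuous_on_eq_continuous_at)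
        then show "(\<lambda>m. \<phi> (c m (\<Gamma> i \<omega>))) \<longlonglongrightarrow> \<phi> (\<Gamma> i \<omega>)" using c_lim by (rule isCont_tendsto_compose)
      qed
    qed
    show "AE \<omega> in M. norm (\<Prod>i<N (real T) \<omega>. \<phi> (c m (\<Gamma> i \<omega>))) \<le> 1" for m
      by (simp add: prod_bd bd)
    show "(\<lambda>\<omega>. \<Prod>i<N (real T) \<omega>. \<phi> (c m (\<Gamma> i \<omega>))) \<in> borel_measurable M" for m
      by (rule prod_m) (simp add: c_def)
  qed (auto simp: prod_m)
  moreover have "(\<lambda>m. exp (- (\<Sum>k<Suc m * T. (1 - \<phi> (real (Suc k) / real (Suc m))) / real (Suc m)))) \<longlonglongrightarrow> exp (- (LINT x:{0<..real T}|lborel. 1 - \<phi> x))"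
  proof (intro tendsto_exp tendsto_minus step_integral_tendsto)
    show "\<bar>1 - \<phi> x\<bar> \<le> 2" for x using bd[of x] by (simp add: abs_le_iff)
  qed (auto intro!: continuous_intros cont)
  ultimately show ?thesis unfolding step by (rule LIMSEQ_unique)
qed

text \<open>
  The random number of factors is replaced by a deterministic one. In this form the independence of
  arrivals, marks and signs can be applied to finitely many factors at a time.
\<close>

lemma expectation_prod_arrivals_truncated:
  fixes \<phi> :: "real \<Rightarrow> real"
  assumes \<phi>[measurable]: "\<phi> \<in> borel_measurable borel" and bd: "\<And>x. \<bar>\<phi> x\<bar> \<le> 1" and cont: "continuous_on {0<..} \<phi>"
  shows "(\<lambda>n. \<integral>\<omega>. (\<Prod>i<n. if \<Gamma> i \<omega> \<le> real T then \<phi> (\<Gamma> i \<omega>) else 1) \<partial>M) \<longlonglongrightarrow> exp (- (LINT x:{0<..real T}|lborel. 1 - \<phi> x))"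
  unfolding expectation_prod_arrivals[OF assms, symmetric]
proof (rule integral_dominated_convergence[where w = "\<lambda>_. 1"])
  have [measurable]: "N (real T) \<in> measurable M (count_space UNIV)" by (rule measurable_N) simp
  show "(\<lambda>\<omega>. \<Prod>i<N (real T) \<omega>. \<phi> (\<Gamma> i \<omega>)) \<in> borel_measurable M"
    by (rule measurable_compose_countable[where f = "\<lambda>n \<omega>. \<Prod>i<n. \<phi> (\<Gamma> i \<omega>)"]) auto
  show "AE \<omega> in M. (\<lambda>n. \<Prod>i<n. if \<Gamma> i \<omega> \<le> real T then \<phi> (\<Gamma> i \<omega>) else 1) \<longlonglongrightarrow> (\<Prod>i<N (real T) \<omega>. \<phi> (\<Gamma> i \<omega>))"
    using arrival_iff
  proof eventually_elim
    case (elim \<omega>)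
    have "(\<Prod>i<n. if \<Gamma> i \<omega> \<le> real T then \<phi> (\<Gamma> i \<omega>) else 1) = (\<Prod>i<N (real T) \<omega>. \<phi> (\<Gamma> i \<omega>))" if "N (real T) \<omega> \<le> n" for n
      by (rule prod.mono_neutral_cong_right) (use that elim in auto)
    then show ?case by (intro tendsto_eventually eventually_sequentiallyI[of "N (real T) \<omega>"])
  qed
  show "AE \<omega> in M. norm (\<Prod>i<n. if \<Gamma> i \<omega> \<le> real T then \<phi> (\<Gamma> i \<omega>) else 1) \<le> 1" for n
    by (intro AE_I2) (auto simp: abs_prod bd intro!: prod_le_1)
qed auto

end

section \<open>Series over a marked Poisson process\<close>

text \<open>
  The components may take values in different types, as they do for a sequence paired with a pair of
  sequences; therefore independence is expressed by the product form of the joint law.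
\<close>

definition (in prob_space) independent where
  "independent S X T Y \<longleftrightarrow> X \<in> measurable M S \<and> Y \<in> measurable M T \<and>
    distr M (S \<Otimes>\<^sub>M T) (\<lambda>x. (X x, Y x)) = distr M S X \<Otimes>\<^sub>M distr M T Y"

lemma (in prob_space) indep_var_imp_independent: "indep_var S X T Y \<Longrightarrow> independent S X T Y"
  by (simp add: independent_def indep_var_distribution_eq)

lemma (in prob_space) independent_compose:
  assumes ind: "independent S X T Y" and [measurable]: "f \<in> measurable S S'" "g \<in> measurable T T'"
  shows "independent S' (\<lambda>\<omega>. f (X \<omega>)) T' (\<lambda>\<omega>. g (Y \<omega>))"
proof -
  have [measurable]: "X \<in> measurable M S" "Y \<in> measurable M T" using ind by (auto simp: independent_def)
  have eq: "distr M (S \<Otimes>\<^sub>M T) (\<lambda>x. (X x, Y x)) = distr M S X \<Otimes>\<^sub>M distr M T Y"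
    using ind by (simp add: independent_def)
  have X: "distr M S' (\<lambda>\<omega>. f (X \<omega>)) = distr (distr M S X) S' f"
    and Y: "distr M T' (\<lambda>\<omega>. g (Y \<omega>)) = distr (distr M T Y) T' g"
    by (simp_all add: distr_distr comp_def)
  have "sigma_finite_measure (distr (distr M T Y) T' g)"
    unfolding Y[symmetric] by (intro prob_space_imp_sigma_finite prob_space_distr) simp
  then have "distr M S' (\<lambda>\<omega>. f (X \<omega>)) \<Otimes>\<^sub>M distr M T' (\<lambda>\<omega>. g (Y \<omega>)) =
      distr (distr M S X \<Otimes>\<^sub>M distr M T Y) (S' \<Otimes>\<^sub>M T') (\<lambda>(x, y). (f x, g y))"
    unfolding X Y by (intro pair_measure_distr) auto
  also have "\<dots> = distr M (S' \<Otimes>\<^sub>M T') (\<lambda>\<omega>. (f (X \<omega>), g (Y \<omega>)))"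
    unfolding eq[symmetric] by (subst distr_distr) (auto simp: comp_def)
  finally show ?thesis by (simp add: independent_def)
qed

lemma (in prob_space) independent_nn_integral:
  assumes ind: "independent S X T Y" and f[measurable]: "f \<in> borel_measurable (S \<Otimes>\<^sub>M T)"
  shows "(\<integral>\<^sup>+\<omega>. f (X \<omega>, Y \<omega>) \<partial>M) = (\<integral>\<^sup>+\<omega>. \<integral>\<^sup>+\<omega>'. f (X \<omega>, Y \<omega>') \<partial>M \<partial>M)"
proof -
  have [measurable]: "X \<in> measurable M S" "Y \<in> measurable M T"
    using ind by (auto simp: independent_def)
  have eq: "distr M S X \<Otimes>\<^sub>M distr M T Y = distr M (S \<Otimes>\<^sub>M T) (\<lambda>x. (X x, Y x))"
    using ind by (auto simp: independent_def)
  interpret Y: prob_space "distr M T Y" by (rule prob_space_distr) simp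
  have "(\<integral>\<^sup>+\<omega>. f (X \<omega>, Y \<omega>) \<partial>M) = (\<integral>\<^sup>+p. f p \<partial>(distr M S X \<Otimes>\<^sub>M distr M T Y))"
    unfolding eq by (simp add: nn_integral_distr)
  also have "\<dots> = (\<integral>\<^sup>+x. \<integral>\<^sup>+y. f (x, y) \<partial>distr M T Y \<partial>distr M S X)"
    by (rule Y.nn_integral_fst[symmetric]) simp
  also have "\<dots> = (\<integral>\<^sup>+x. \<integral>\<^sup>+\<omega>'. f (x, Y \<omega>') \<partial>M \<partial>distr M S X)"
    by (intro nn_integral_cong nn_integral_distr) auto
  also have "\<dots> = (\<integral>\<^sup>+\<omega>. \<integral>\<^sup>+\<omega>'. f (X \<omega>, Y \<omega>') \<partial>M \<partial>M)"
    by (rule nn_integral_distr) auto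
  finally show ?thesis .
qed

text \<open>
  The second component may be resampled independently of the first.
\<close>

lemma (in prob_space) independent_integral:
  fixes f :: "_ \<Rightarrow> 'b::{banach, second_countable_topology}"
  assumes ind: "independent S X T Y" and f[measurable]: "f \<in> borel_measurable (S \<Otimes>\<^sub>M T)" and bd: "\<And>p. norm (f p) \<le> C"
  shows "(\<integral>\<omega>. f (X \<omega>, Y \<omega>) \<partial>M) = (\<integral>\<omega>. \<integral>\<omega>'. f (X \<omega>, Y \<omega>') \<partial>M \<partial>M)"
proof -
  have [measurable]: "X \<in> measurable M S" "Y \<in> measurable M T"
    using ind by (auto simp: independent_def)
  have eq: "distr M S X \<Otimes>\<^sub>M distr M T Y = distr M (S \<Otimes>\<^sub>M T) (\<lambda>x. (X x, Y x))"
    using ind by (auto simp: independent_def)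
  interpret X: prob_space "distr M S X" by (rule prob_space_distr) simp
  interpret Y: prob_space "distr M T Y" by (rule prob_space_distr) simp
  interpret XY: pair_prob_space "distr M S X" "distr M T Y" ..
  have "(\<integral>\<omega>. f (X \<omega>, Y \<omega>) \<partial>M) = (\<integral>p. f p \<partial>(distr M S X \<Otimes>\<^sub>M distr M T Y))"
    unfolding eq by (simp add: integral_distr)
  also have "\<dots> = (\<integral>x. \<integral>y. f (x, y) \<partial>distr M T Y \<partial>distr M S X)"
    using bd by (intro XY.integral_fst'[symmetric] XY.integrable_const_bound[where B = C]) auto
  also have "\<dots> = (\<integral>x. \<integral>\<omega>'. f (x, Y \<omega>') \<partial>M \<partial>distr M S X)"
    by (intro Bochner_Integration.integral_cong refl integral_distr) auto
  also have "\<dots> = (\<integral>\<omega>. \<integral>\<omega>'. f (X \<omega>, Y \<omega>') \<partial>M \<partial>M)"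
    by (rule integral_distr) auto
  finally show ?thesis .
qed

lemma (in prob_space) independent_AE:
  assumes ind: "independent S X T Y" and P[measurable]: "Measurable.pred (S \<Otimes>\<^sub>M T) P"
    and AE: "AE \<omega> in M. AE \<omega>' in M. P (X \<omega>, Y \<omega>')"
  shows "AE \<omega> in M. P (X \<omega>, Y \<omega>)"
proof -
  have [measurable]: "X \<in> measurable M S" "Y \<in> measurable M T"
    using ind by (auto simp: independent_def)
  define f where "f p = (if P p then 0 else 1 :: ennreal)" for p
  have [measurable]: "f \<in> borel_measurable (S \<Otimes>\<^sub>M T)" unfolding f_def by measurable
  have X[measurable]: "X \<omega> \<in> space S" if "\<omega> \<in> space M" for \<omega> using that by (rule measurable_space[rotated]) simp
  have "AE \<omega> in M. (\<integral>\<^sup>+\<omega>'. f (X \<omega>, Y \<omega>') \<partial>M) = 0"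
    using AE
  proof (rule AE_mp, intro AE_I2 impI)
    fix \<omega> assume "\<omega> \<in> space M" "AE \<omega>' in M. P (X \<omega>, Y \<omega>')"
    then have "AE \<omega>' in M. f (X \<omega>, Y \<omega>') = 0" by (auto simp: f_def elim: eventually_mono)
    then show "(\<integral>\<^sup>+\<omega>'. f (X \<omega>, Y \<omega>') \<partial>M) = 0" by (simp add: nn_integral_cong_AE)
  qed
  then have "(\<integral>\<^sup>+\<omega>. f (X \<omega>, Y \<omega>) \<partial>M) = 0"
    by (subst independent_nn_integral[OF ind]) (simp_all add: nn_integral_cong_AE)
  then have "AE \<omega> in M. f (X \<omega>, Y \<omega>) = 0" by (subst (asm) nn_integral_0_iff_AE) auto
  then show ?thesis by (auto simp: f_def elim!: eventually_mono split: if_splits)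
qed

text \<open>
  Series over a Poisson process have no finite variance in general. The truncation keeps the
  square-integrability for small values of \<open>F\<close> and only counts the points where \<open>F\<close> is large.
\<close>

definition truncated_energy :: "(real \<Rightarrow> real \<Rightarrow> real) \<Rightarrow> ennreal" where
  "truncated_energy F = (\<integral>\<^sup>+y. \<integral>\<^sup>+z. ennreal (min 1 ((F z y)\<^sup>2)) * indicator {0<..} z \<partial>lborel \<partial>lborel)"

lemma one_minus_cos_le_square: "1 - cos x \<le> (x::real)\<^sup>2"
proof -
  have "1 - cos x = 2 * (sin (x / 2))\<^sup>2" using cos_double_sin[of "x / 2"] by simp
  also have "(sin (x / 2))\<^sup>2 \<le> (x / 2)\<^sup>2"
    using abs_sin_x_le_abs_x[of "x/2"] by (simp only: abs_le_square_iff)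
  finally have "1 - cos x \<le> x\<^sup>2 / 2" by (simp add: power_divide)
  also have "\<dots> \<le> x\<^sup>2" by simp
  finally show ?thesis .
qed

lemma one_minus_cos_nonneg: "0 \<le> 1 - cos (x::real)"
  by simp

lemma one_minus_cos_le_two: "1 - cos (x::real) \<le> 2"
  using cos_ge_minus_one[of x] by linarith

lemma one_minus_cos_le:
  fixes x :: real
  shows "1 - cos x \<le> 2 * min 1 (x\<^sup>2)"
  using one_minus_cos_le_square[of x] one_minus_cos_le_two[of x] zero_le_power2[of x]
  unfolding min_def by (smt (verit))

lemma measurable_binary_app:
  assumes "case_prod F \<in> borel_measurable (borel \<Otimes>\<^sub>M borel)" "a \<in> borel_measurable K" "b \<in> borel_measurable K"
  shows "(\<lambda>x. F (a x) (b x)) \<in> borel_measurable K"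
  using measurable_compose[OF measurable_Pair[OF assms(2,3)] assms(1)] by simp

lemma measurable_summable:
  fixes f :: "nat \<Rightarrow> 'a \<Rightarrow> real"
  assumes [measurable]: "\<And>i. f i \<in> borel_measurable K"
  shows "Measurable.pred K (\<lambda>x. summable (\<lambda>i. f i x))"
  unfolding summable_iff_convergent Cauchy_convergent_iff[symmetric] pred_def
  by (rule sets_Collect_Cauchy) measurable

lemma measurable_product_coordinates:
  fixes K :: "(((nat \<Rightarrow> real) \<times> (nat \<Rightarrow> real)) \<times> (nat \<Rightarrow> real)) measure"
  defines "K \<equiv> (PiM UNIV (\<lambda>_. borel) \<Otimes>\<^sub>M PiM UNIV (\<lambda>_. borel)) \<Otimes>\<^sub>M PiM UNIV (\<lambda>_. borel)"
  shows "(\<lambda>p. snd p i) \<in> borel_measurable K" "(\<lambda>p. fst (fst p) i) \<in> borel_measurable K"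
    "(\<lambda>p. snd (fst p) i) \<in> borel_measurable K"
proof -
  have c: "(\<lambda>x. x i) \<in> borel_measurable (PiM UNIV (\<lambda>_. borel) :: (nat \<Rightarrow> real) measure)" by measurable
  show "(\<lambda>p. snd p i) \<in> borel_measurable K" "(\<lambda>p. fst (fst p) i) \<in> borel_measurable K"
    "(\<lambda>p. snd (fst p) i) \<in> borel_measurable K"
    unfolding K_def by (rule measurable_compose[OF _ c]; measurable)+
qed

locale marked_poisson = poisson_points M \<Gamma> N + rademacher M \<gamma>
  for M :: "'a measure" and \<Gamma> N \<gamma> +
  fixes V :: "nat \<Rightarrow> 'a \<Rightarrow> real" and \<rho> :: "real \<Rightarrow> real"
  assumes measurable_\<rho>[measurable]: "\<rho> \<in> borel_measurable borel" and \<rho>_pos: "\<And>y. 0 < \<rho> y"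
    and V_law: "\<And>i. distributed M lborel (V i) (\<lambda>y. ennreal (\<rho> y))"
    and V_indep: "indep_vars (\<lambda>_. borel) V UNIV"
    and \<Gamma>_V_indep: "independent (PiM UNIV (\<lambda>_. borel)) (\<lambda>\<omega> i. \<Gamma> i \<omega>) (PiM UNIV (\<lambda>_. borel)) (\<lambda>\<omega> i. V i \<omega>)"
    and \<Gamma>V_\<gamma>_indep: "independent (PiM UNIV (\<lambda>_. borel) \<Otimes>\<^sub>M PiM UNIV (\<lambda>_. borel)) (\<lambda>\<omega>. ((\<lambda>i. \<Gamma> i \<omega>), (\<lambda>i. V i \<omega>)))
      (PiM UNIV (\<lambda>_. borel)) (\<lambda>\<omega> i. \<gamma> i \<omega>)"
begin

lemma measurable_V[measurable]: "V i \<in> borel_measurable M"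
  using V_indep by (auto simp: indep_vars_def)

text \<open>
  Scaling the arrival by the density of its mark turns the intensity of the marked process into Lebesgue
  measure on the half-plane, see \<open>marked_campbell\<close>.
\<close>

definition level :: "nat \<Rightarrow> 'a \<Rightarrow> real" where
  "level i \<omega> = \<Gamma> i \<omega> * \<rho> (V i \<omega>)"

text \<open>
  A series of Ferguson--Klass--LePage type over the points \<open>(level i, V i)\<close>.
\<close>

definition fkl_series :: "(real \<Rightarrow> real \<Rightarrow> real) \<Rightarrow> 'a \<Rightarrow> real" where
  "fkl_series F \<omega> = (\<Sum>i. \<gamma> i \<omega> * F (level i \<omega>) (V i \<omega>))"

lemma measurable_level[measurable]: "level i \<in> borel_measurable M"
  unfolding level_def by measurable

lemma measurable_fkl_series:
  assumes "case_prod F \<in> borel_measurable (borel \<Otimes>\<^sub>M borel)"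
  shows "fkl_series F \<in> borel_measurable M"
proof -
  note [measurable] = measurable_binary_app[OF assms]
  show ?thesis unfolding fkl_series_def by measurable
qed

lemma measurable_term:
  fixes i :: nat and F :: "real \<Rightarrow> real \<Rightarrow> real"
  assumes "case_prod F \<in> borel_measurable (borel \<Otimes>\<^sub>M borel)"
  shows "(\<lambda>p. snd p i * F (fst (fst p) i * \<rho> (snd (fst p) i)) (snd (fst p) i)) \<in> borel_measurable
    ((PiM UNIV (\<lambda>_. borel) \<Otimes>\<^sub>M PiM UNIV (\<lambda>_. borel)) \<Otimes>\<^sub>M PiM UNIV (\<lambda>_. borel))"
proof -
  note c = measurable_product_coordinates[where i = i]
  show ?thesis
    by (rule borel_measurable_times[OF c(1) measurable_binary_app[OF assms borel_measurable_times[OF c(2) measurable_compose[OF c(3) measurable_\<rho>]] c(3)]])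
qed

lemma nn_integral_V:
  assumes "f \<in> borel_measurable borel"
  shows "(\<integral>\<^sup>+\<omega>. f (V i \<omega>) \<partial>M) = (\<integral>\<^sup>+y. ennreal (\<rho> y) * f y \<partial>lborel)"
  using distributed_nn_integral[OF V_law, of f i] assms by simp

text \<open>
  For a fixed mark \<open>y\<close> Campbell's formula gives the integral of \<open>H (x * \<rho> y) y\<close> over \<open>x > 0\<close>. The substitution
  \<open>z = x * \<rho> y\<close> produces \<open>1 / \<rho> y\<close>, which cancels the density of the mark.
\<close>

lemma marked_campbell:
  assumes H: "case_prod H \<in> borel_measurable (borel \<Otimes>\<^sub>M borel)"
  shows "(\<Sum>i. \<integral>\<^sup>+\<omega>. H (level i \<omega>) (V i \<omega>) \<partial>M) = (\<integral>\<^sup>+y. \<integral>\<^sup>+z. H z y * indicator {0<..} z \<partial>lborel \<partial>lborel)"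
proof -
  note [measurable] = measurable_binary_app[OF H]
  have "(\<integral>\<^sup>+\<omega>. H (level i \<omega>) (V i \<omega>) \<partial>M) = (\<integral>\<^sup>+y. ennreal (\<rho> y) * (\<integral>\<^sup>+\<omega>. H (\<Gamma> i \<omega> * \<rho> y) y \<partial>M) \<partial>lborel)" for i
  proof -
    have "independent borel (\<lambda>\<omega>. \<Gamma> i \<omega>) borel (\<lambda>\<omega>. V i \<omega>)"
      by (rule independent_compose[OF \<Gamma>_V_indep, where f = "\<lambda>x. x i" and g = "\<lambda>x. x i"]) auto
    then have "(\<integral>\<^sup>+\<omega>. H (level i \<omega>) (V i \<omega>) \<partial>M) = (\<integral>\<^sup>+\<omega>'. \<integral>\<^sup>+\<omega>. H (\<Gamma> i \<omega>' * \<rho> (V i \<omega>)) (V i \<omega>) \<partial>M \<partial>M)"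
      unfolding level_def
      by (rule independent_nn_integral[where f = "\<lambda>p. H (fst p * \<rho> (snd p)) (snd p)", simplified]) measurable
    also have "\<dots> = (\<integral>\<^sup>+\<omega>'. \<integral>\<^sup>+y. ennreal (\<rho> y) * H (\<Gamma> i \<omega>' * \<rho> y) y \<partial>lborel \<partial>M)"
      by (intro nn_integral_cong nn_integral_V) measurable
    also have "\<dots> = (\<integral>\<^sup>+y. \<integral>\<^sup>+\<omega>'. ennreal (\<rho> y) * H (\<Gamma> i \<omega>' * \<rho> y) y \<partial>M \<partial>lborel)"
    proof -
      interpret pair_sigma_finite M "lborel :: real measure" ..
      show ?thesis by (rule Fubini'[symmetric]) measurable
    qed
    also have "\<dots> = (\<integral>\<^sup>+y. ennreal (\<rho> y) * (\<integral>\<^sup>+\<omega>. H (\<Gamma> i \<omega> * \<rho> y) y \<partial>M) \<partial>lborel)"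
      by (intro nn_integral_cong nn_integral_cmult) measurable
    finally show ?thesis .
  qed
  then have "(\<Sum>i. \<integral>\<^sup>+\<omega>. H (level i \<omega>) (V i \<omega>) \<partial>M) = (\<Sum>i. \<integral>\<^sup>+y. ennreal (\<rho> y) * (\<integral>\<^sup>+\<omega>. H (\<Gamma> i \<omega> * \<rho> y) y \<partial>M) \<partial>lborel)"
    by simp
  also have "\<dots> = (\<integral>\<^sup>+y. ennreal (\<rho> y) * (\<Sum>i. \<integral>\<^sup>+\<omega>. H (\<Gamma> i \<omega> * \<rho> y) y \<partial>M) \<partial>lborel)"
  proof -
    have "(\<lambda>y. \<integral>\<^sup>+\<omega>. H (\<Gamma> i \<omega> * \<rho> y) y \<partial>M) \<in> borel_measurable lborel" for i
      using measurable_binary_app[OF H, of "\<lambda>p. \<Gamma> i (snd p) * \<rho> (fst p)" "lborel \<Otimes>\<^sub>M M" fst]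
      by (intro borel_measurable_nn_integral) (simp add: split_beta')
    then show ?thesis
      by (subst nn_integral_suminf[symmetric]) (auto simp: ennreal_suminf_cmult)
  qed
  also have "\<dots> = (\<integral>\<^sup>+y. \<integral>\<^sup>+z. H z y * indicator {0<..} z \<partial>lborel \<partial>lborel)"
  proof (rule nn_integral_cong)
    fix y
    have "(\<Sum>i. \<integral>\<^sup>+\<omega>. H (\<Gamma> i \<omega> * \<rho> y) y \<partial>M) = (\<integral>\<^sup>+x. H (x * \<rho> y) y * indicator {0<..} x \<partial>lborel)"
      by (rule campbell) measurable
    also have "ennreal (\<rho> y) * \<dots> = ennreal \<bar>\<rho> y\<bar> * (\<integral>\<^sup>+x. H (0 + \<rho> y * x) y * indicator {0<..} (0 + \<rho> y * x) \<partial>lborel)"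
      using \<rho>_pos[of y] by (auto intro!: arg_cong2[where f = "(*)"] nn_integral_cong simp: mult.commute zero_less_mult_iff indicator_def)
    also have "\<dots> = (\<integral>\<^sup>+z. H z y * indicator {0<..} z \<partial>lborel)"
      using \<rho>_pos[of y]
      by (intro nn_integral_real_affine[symmetric] borel_measurable_times_ennreal measurable_binary_app[OF H] borel_measurable_indicator) auto
    finally show "ennreal (\<rho> y) * (\<Sum>i. \<integral>\<^sup>+\<omega>. H (\<Gamma> i \<omega> * \<rho> y) y \<partial>M) = (\<integral>\<^sup>+z. H z y * indicator {0<..} z \<partial>lborel)" .
  qed
  finally show ?thesis .
qed

lemma truncated_energy_eq:
  assumes F: "case_prod F \<in> borel_measurable (borel \<Otimes>\<^sub>M borel)"
  shows "(\<integral>\<^sup>+\<omega>. (\<Sum>i. ennreal (min 1 ((F (level i \<omega>) (V i \<omega>))\<^sup>2))) \<partial>M) = truncated_energy F"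
proof -
  note [measurable] = measurable_binary_app[OF F]
  show ?thesis unfolding truncated_energy_def
    by (subst nn_integral_suminf, measurable) (rule marked_campbell[of "\<lambda>z y. ennreal (min 1 ((F z y)\<^sup>2))"], simp add: split_beta')
qed

text \<open>
  A finite sum of the terms \<open>min 1 (a\<^sup>2)\<close> leaves only finitely many \<open>a\<close> beyond 1 in absolute value.
\<close>

lemma AE_square_summable:
  assumes F: "case_prod F \<in> borel_measurable (borel \<Otimes>\<^sub>M borel)" and fin: "truncated_energy F < \<infinity>"
  shows "AE \<omega> in M. summable (\<lambda>i. (F (level i \<omega>) (V i \<omega>))\<^sup>2)"
proof -
  note [measurable] = measurable_binary_app[OF F]
  have "AE \<omega> in M. (\<Sum>i. ennreal (min 1 ((F (level i \<omega>) (V i \<omega>))\<^sup>2))) \<noteq> \<infinity>"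
    by (rule nn_integral_PInf_AE) (use fin in \<open>auto simp: truncated_energy_eq[OF F]\<close>)
  then show ?thesis
  proof eventually_elim
    case (elim \<omega>)
    define a where "a i = (F (level i \<omega>) (V i \<omega>))\<^sup>2" for i
    have s: "summable (\<lambda>i. min 1 (a i))"
      using elim by (intro summable_suminf_not_top) (auto simp: a_def)
    then have "\<forall>\<^sub>F i in sequentially. min 1 (a i) < 1"
      by (intro order_tendstoD(2)[OF summable_LIMSEQ_zero]) auto
    then have "\<forall>\<^sub>F i in sequentially. min 1 (a i) = a i" by eventually_elim (auto simp: min_def split: if_splits)
    from summable_cong[OF this] s show ?case by (simp add: a_def)
  qed
qed

text \<open>
  Given the points, the coefficients are square summable, so the series converges for almost all signs.
\<close>

lemma AE_fkl_summable:
  assumes F: "case_prod F \<in> borel_measurable (borel \<Otimes>\<^sub>M borel)" and fin: "truncated_energy F < \<infinity>"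
  shows "AE \<omega> in M. summable (\<lambda>i. \<gamma> i \<omega> * F (level i \<omega>) (V i \<omega>))"
proof -
  note [measurable] = measurable_binary_app[OF F]
  define P where "P p \<longleftrightarrow> summable (\<lambda>i. snd p i * F (fst (fst p) i * \<rho> (snd (fst p) i)) (snd (fst p) i))"
    for p :: "((nat \<Rightarrow> real) \<times> (nat \<Rightarrow> real)) \<times> (nat \<Rightarrow> real)"
  have "AE \<omega> in M. P (((\<lambda>i. \<Gamma> i \<omega>), (\<lambda>i. V i \<omega>)), \<lambda>i. \<gamma> i \<omega>)"
  proof (rule independent_AE[OF \<Gamma>V_\<gamma>_indep])
    show "Measurable.pred ((PiM UNIV (\<lambda>_. borel) \<Otimes>\<^sub>M PiM UNIV (\<lambda>_. borel)) \<Otimes>\<^sub>M PiM UNIV (\<lambda>_. borel)) P"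
      unfolding P_def by (rule measurable_summable[OF measurable_term[OF F]])
    show "AE \<omega> in M. AE \<omega>' in M. P (((\<lambda>i. \<Gamma> i \<omega>), (\<lambda>i. V i \<omega>)), \<lambda>i. \<gamma> i \<omega>')"
      using AE_square_summable[OF assms] by eventually_elim (auto simp: P_def level_def intro: sign_series_converges)
  qed
  then show ?thesis by (simp add: P_def level_def)
qed

text \<open>
  Given the points there are two cases. If all coefficients are at most 1 in absolute value, the truncation has no effect
  and the bound is \<open>sign_series_tail\<close>. Otherwise the truncated sum is at least 1
  and the bound is trivial since \<open>\<epsilon> \<le> 1\<close>. Averaging over the points with Campbell's formula gives the energy.
\<close>

lemma fkl_series_tail:
  assumes F: "case_prod F \<in> borel_measurable (borel \<Otimes>\<^sub>M borel)" and fin: "truncated_energy F < \<infinity>"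
    and \<epsilon>: "0 < \<epsilon>" "\<epsilon> \<le> 1"
  shows "ennreal (measure M {\<omega> \<in> space M. \<epsilon> < \<bar>fkl_series F \<omega>\<bar>}) \<le> ennreal (1 / \<epsilon>\<^sup>2) * truncated_energy F"
proof -
  note [measurable] = measurable_binary_app[OF F]
  define t where "t p i = snd p i * F (fst (fst p) i * \<rho> (snd (fst p) i)) (snd (fst p) i)"
    for p :: "((nat \<Rightarrow> real) \<times> (nat \<Rightarrow> real)) \<times> (nat \<Rightarrow> real)" and i
  have t_eq: "t p = (\<lambda>i. snd p i * F (fst (fst p) i * \<rho> (snd (fst p) i)) (snd (fst p) i))" for p
    by (simp add: t_def fun_eq_iff)
  define B where "B p = (if \<epsilon> < \<bar>suminf (t p)\<bar> \<and> summable (t p) then 1 else 0 :: ennreal)" for p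
  have Bm: "B \<in> borel_measurable ((PiM UNIV (\<lambda>_. borel) \<Otimes>\<^sub>M PiM UNIV (\<lambda>_. borel)) \<Otimes>\<^sub>M PiM UNIV (\<lambda>_. borel))"
  proof -
    have tm[measurable]: "(\<lambda>p. t p i) \<in> borel_measurable ((PiM UNIV (\<lambda>_. borel) \<Otimes>\<^sub>M PiM UNIV (\<lambda>_. borel)) \<Otimes>\<^sub>M PiM UNIV (\<lambda>_. borel))" for i
      unfolding t_def by (rule measurable_term[OF F])
    note [measurable] = measurable_summable[where f = "\<lambda>i p. t p i", OF tm]
    show ?thesis unfolding B_def[abs_def] by measurable
  qed
  have sm[measurable]: "fkl_series F \<in> borel_measurable M" by (rule measurable_fkl_series[OF F])
  have "ennreal (measure M {\<omega> \<in> space M. \<epsilon> < \<bar>fkl_series F \<omega>\<bar>}) = (\<integral>\<^sup>+\<omega>. indicator {\<omega> \<in> space M. \<epsilon> < \<bar>fkl_series F \<omega>\<bar>} \<omega> \<partial>M)"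
    by (simp add: emeasure_eq_measure)
  also have "\<dots> = (\<integral>\<^sup>+\<omega>. B (((\<lambda>i. \<Gamma> i \<omega>), (\<lambda>i. V i \<omega>)), \<lambda>i. \<gamma> i \<omega>) \<partial>M)"
    using AE_fkl_summable[OF F fin] by (intro nn_integral_cong_AE) (auto simp: B_def t_eq fkl_series_def level_def indicator_def elim!: eventually_mono)
  also have "\<dots> = (\<integral>\<^sup>+\<omega>. \<integral>\<^sup>+\<omega>'. B (((\<lambda>i. \<Gamma> i \<omega>), (\<lambda>i. V i \<omega>)), \<lambda>i. \<gamma> i \<omega>') \<partial>M \<partial>M)"
    by (rule independent_nn_integral[OF \<Gamma>V_\<gamma>_indep Bm])
  also have "\<dots> \<le> (\<integral>\<^sup>+\<omega>. ennreal (1 / \<epsilon>\<^sup>2) * (\<Sum>i. ennreal (min 1 ((F (level i \<omega>) (V i \<omega>))\<^sup>2))) \<partial>M)"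
  proof (rule nn_integral_mono_AE)
    show "AE \<omega> in M. (\<integral>\<^sup>+\<omega>'. B (((\<lambda>i. \<Gamma> i \<omega>), (\<lambda>i. V i \<omega>)), \<lambda>i. \<gamma> i \<omega>') \<partial>M) \<le> ennreal (1 / \<epsilon>\<^sup>2) * (\<Sum>i. ennreal (min 1 ((F (level i \<omega>) (V i \<omega>))\<^sup>2)))"
      using AE_square_summable[OF F fin]
    proof eventually_elim
      case (elim \<omega>)
      define a where "a i = F (level i \<omega>) (V i \<omega>)" for i
      have a: "summable (\<lambda>i. (a i)\<^sup>2)" using elim by (simp add: a_def)
      have [measurable]: "Measurable.pred M (\<lambda>\<omega>'. summable (\<lambda>i. \<gamma> i \<omega>' * a i))" by (rule measurable_summable) measurable
      have "(\<integral>\<^sup>+\<omega>'. B (((\<lambda>i. \<Gamma> i \<omega>), (\<lambda>i. V i \<omega>)), \<lambda>i. \<gamma> i \<omega>') \<partial>M) =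
        (\<integral>\<^sup>+\<omega>'. indicator {\<omega>' \<in> space M. \<epsilon> < \<bar>\<Sum>i. \<gamma> i \<omega>' * a i\<bar> \<and> summable (\<lambda>i. \<gamma> i \<omega>' * a i)} \<omega>' \<partial>M)"
        by (intro nn_integral_cong) (auto simp: B_def t_eq a_def level_def indicator_def)
      also have "\<dots> = ennreal (measure M {\<omega>' \<in> space M. \<epsilon> < \<bar>\<Sum>i. \<gamma> i \<omega>' * a i\<bar> \<and> summable (\<lambda>i. \<gamma> i \<omega>' * a i)})"
        by (simp add: emeasure_eq_measure)
      also have "\<dots> \<le> ennreal (1 / \<epsilon>\<^sup>2) * (\<Sum>i. ennreal (min 1 ((a i)\<^sup>2)))"
      proof (cases "\<exists>i. 1 < (a i)\<^sup>2")
        case True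
        then obtain i where i: "1 < (a i)\<^sup>2" by auto
        have "1 = (\<Sum>i\<in>{i}. ennreal (min 1 ((a i)\<^sup>2)))" using i by (simp add: min_def)
        also have "\<dots> \<le> (\<Sum>i. ennreal (min 1 ((a i)\<^sup>2)))" by (intro sum_le_suminf summableI) auto
        finally have "1 \<le> (\<Sum>i. ennreal (min 1 ((a i)\<^sup>2)))" .
        moreover have "1 \<le> ennreal (1 / \<epsilon>\<^sup>2)" using \<epsilon> by (simp add: power_le_one)
        ultimately have "1 * 1 \<le> ennreal (1 / \<epsilon>\<^sup>2) * (\<Sum>i. ennreal (min 1 ((a i)\<^sup>2)))" by (intro mult_mono) auto
        moreover have "ennreal (measure M {\<omega>' \<in> space M. \<epsilon> < \<bar>\<Sum>i. \<gamma> i \<omega>' * a i\<bar> \<and> summable (\<lambda>i. \<gamma> i \<omega>' * a i)}) \<le> 1 * 1"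
          by (simp only: mult_1 ennreal_le_1 prob_le_1)
        ultimately show ?thesis by (rule order_trans[rotated])
      next
        case False
        then have "(\<lambda>i. ennreal (min 1 ((a i)\<^sup>2))) = (\<lambda>i. ennreal ((a i)\<^sup>2))" by (simp add: not_less min_absorb2)
        then have "ennreal (1 / \<epsilon>\<^sup>2) * (\<Sum>i. ennreal (min 1 ((a i)\<^sup>2))) = ennreal ((\<Sum>i. (a i)\<^sup>2) / \<epsilon>\<^sup>2)"
          using a by (simp add: suminf_ennreal2 ennreal_mult[symmetric] suminf_nonneg)
        then show ?thesis using sign_series_tail[OF \<epsilon>(1) a] by (simp add: ennreal_leI)
      qed
      finally show ?case by (simp add: a_def)
    qed
  qed
  also have "\<dots> = ennreal (1 / \<epsilon>\<^sup>2) * truncated_energy F"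
    by (subst nn_integral_cmult) (measurable, simp add: truncated_energy_eq[OF F])
  finally show ?thesis .
qed

end

context marked_poisson
begin

text \<open>
  The signs are symmetric, so averaging over them leaves the cosine of each exponential.
\<close>

lemma expectation_sign_product:
  fixes c :: "nat \<Rightarrow> bool" and a :: "nat \<Rightarrow> real"
  shows "(\<integral>\<omega>. (\<Prod>i<n. if c i then iexp (\<gamma> i \<omega> * a i) else 1) \<partial>M) = complex_of_real (\<Prod>i<n. if c i then cos (a i) else 1)"
proof -
  define f where "f i s = (if c i then iexp (s * a i) else 1)" for i and s :: real
  have [measurable]: "f i \<in> borel_measurable borel" for i unfolding f_def by (cases "c i") auto
  have fn: "norm (f i s) = 1" for i s by (simp add: f_def)
  have "indep_vars (\<lambda>_. borel) (\<lambda>i \<omega>. f i (\<gamma> i \<omega>)) {..<n}"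
    by (rule indep_vars_compose2[OF indep_vars_subset[OF indep]]) auto
  then have "(\<integral>\<omega>. (\<Prod>i<n. f i (\<gamma> i \<omega>)) \<partial>M) = (\<Prod>i<n. \<integral>\<omega>. f i (\<gamma> i \<omega>) \<partial>M)"
    by (intro indep_vars_lebesgue_integral integrable_const_bound[where B = 1]) (auto simp: fn)
  also have "\<dots> = (\<Prod>i<n. complex_of_real (if c i then cos (a i) else 1))"
  proof (intro prod.cong refl)
    fix i
    have "(\<integral>\<omega>. f i (\<gamma> i \<omega>) \<partial>M) = (1/2) *\<^sub>R (f i 1 + f i (- 1))" by (rule integral_sign_fun) measurable
    also have "\<dots> = complex_of_real (if c i then cos (a i) else 1)"
      by (auto simp: f_def cos_exp_eq cos_of_real[symmetric] scaleR_conv_of_real)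
    finally show "(\<integral>\<omega>. f i (\<gamma> i \<omega>) \<partial>M) = complex_of_real (if c i then cos (a i) else 1)" .
  qed
  finally show ?thesis by (simp add: f_def)
qed

text \<open>
  The conditional expectation of \<open>cos (F (level i) (V i))\<close> given \<open>\<Gamma> i = x\<close>. The marks are identically
  distributed, so \<open>V 0\<close> can stand for each of them.
\<close>

definition mark_average :: "(real \<Rightarrow> real \<Rightarrow> real) \<Rightarrow> real \<Rightarrow> real" where
  "mark_average F x = (\<integral>\<omega>. cos (F (x * \<rho> (V 0 \<omega>)) (V 0 \<omega>)) \<partial>M)"

lemma mark_average_eq:
  assumes F: "case_prod F \<in> borel_measurable (borel \<Otimes>\<^sub>M borel)"
  shows "(\<integral>\<omega>. cos (F (x * \<rho> (V i \<omega>)) (V i \<omega>)) \<partial>M) = mark_average F x"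
proof -
  have m: "(\<lambda>y. cos (F (x * \<rho> y) y)) \<in> borel_measurable lborel"
    by (rule measurable_compose[OF measurable_binary_app[OF F]]) measurable
  show ?thesis
    unfolding mark_average_def
    using distributed_integral[OF V_law[of i] m] distributed_integral[OF V_law[of 0] m] \<rho>_pos by (simp add: less_imp_le)
qed

lemma mark_average_bound: "\<bar>mark_average F x\<bar> \<le> 1"
proof -
  have "norm (\<integral>\<omega>. cos (F (x * \<rho> (V 0 \<omega>)) (V 0 \<omega>)) \<partial>M) \<le> (\<integral>\<omega>. norm (cos (F (x * \<rho> (V 0 \<omega>)) (V 0 \<omega>))) \<partial>M)"
    by (rule integral_norm_bound)
  also have "\<dots> \<le> (\<integral>\<omega>. 1 \<partial>M)" by (rule integral_mono') auto
  finally show ?thesis by (simp add: mark_average_def prob_space)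
qed

lemma mark_average_measurable:
  assumes F: "case_prod F \<in> borel_measurable (borel \<Otimes>\<^sub>M borel)"
  shows "mark_average F \<in> borel_measurable borel"
proof -
  have "(\<lambda>p. cos (F (fst p * \<rho> (V 0 (snd p))) (V 0 (snd p)))) \<in> borel_measurable (borel \<Otimes>\<^sub>M M)"
    by (rule measurable_compose[OF measurable_binary_app[OF F]]) measurable
  then show ?thesis
    unfolding mark_average_def[abs_def] by (intro borel_measurable_lebesgue_integral) (simp add: split_beta')
qed

lemma mark_average_continuous:
  assumes F: "case_prod F \<in> borel_measurable (borel \<Otimes>\<^sub>M borel)" and cont: "\<And>y. continuous_on {0<..} (\<lambda>z. F z y)"
  shows "continuous_on {0<..} (mark_average F)"
  unfolding continuous_on_sequentially
proof (intro allI impI ballI, elim conjE)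
  fix s :: "nat \<Rightarrow> real" and x assume x: "x \<in> {0<..}" and s: "\<forall>n. s n \<in> {0<..}" "s \<longlonglongrightarrow> x"
  have m: "(\<lambda>\<omega>. cos (F (x * \<rho> (V 0 \<omega>)) (V 0 \<omega>))) \<in> borel_measurable M" for x
    by (rule measurable_compose[OF measurable_binary_app[OF F]]) measurable
  show "(mark_average F \<circ> s) \<longlonglongrightarrow> mark_average F x"
    unfolding comp_def mark_average_def
  proof (rule integral_dominated_convergence[where w = "\<lambda>_. 1", OF m m])
    show "AE \<omega> in M. (\<lambda>n. cos (F (s n * \<rho> (V 0 \<omega>)) (V 0 \<omega>))) \<longlonglongrightarrow> cos (F (x * \<rho> (V 0 \<omega>)) (V 0 \<omega>))"
    proof (rule AE_I2)
      fix \<omega>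
      have "isCont (\<lambda>z. F z (V 0 \<omega>)) (x * \<rho> (V 0 \<omega>))"
        using cont[of "V 0 \<omega>"] x \<rho>_pos by (simp add: continuous_on_eq_continuous_at)
      then show "(\<lambda>n. cos (F (s n * \<rho> (V 0 \<omega>)) (V 0 \<omega>))) \<longlonglongrightarrow> cos (F (x * \<rho> (V 0 \<omega>)) (V 0 \<omega>))"
        by (intro tendsto_cos isCont_tendsto_compose[of _ "\<lambda>z. F z (V 0 \<omega>)"] tendsto_mult s tendsto_const)
    qed
  qed auto
qed

text \<open>
  The expectation is taken over the signs, then over the marks, with the arrivals fixed. What remains
  is a functional of the arrivals alone, a product to which the Laplace functional applies.
\<close>

lemma truncated_char:
  assumes F: "case_prod F \<in> borel_measurable (borel \<Otimes>\<^sub>M borel)"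
  shows "(\<integral>\<omega>. (\<Prod>i<n. if \<Gamma> i \<omega> \<le> T then iexp (\<gamma> i \<omega> * F (level i \<omega>) (V i \<omega>)) else 1) \<partial>M) =
    complex_of_real (\<integral>\<omega>. (\<Prod>i<n. if \<Gamma> i \<omega> \<le> T then mark_average F (\<Gamma> i \<omega>) else 1) \<partial>M)"
proof -
  let ?P = "PiM UNIV (\<lambda>_. borel) :: (nat \<Rightarrow> real) measure"
  define f where "f p = (\<Prod>i<n. if fst (fst p) i \<le> T then iexp (snd p i * F (fst (fst p) i * \<rho> (snd (fst p) i)) (snd (fst p) i)) else 1)"
    for p :: "((nat \<Rightarrow> real) \<times> (nat \<Rightarrow> real)) \<times> (nat \<Rightarrow> real)"
  have fm: "f \<in> borel_measurable ((?P \<Otimes>\<^sub>M ?P) \<Otimes>\<^sub>M ?P)"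
  proof -
    note [measurable] = measurable_term[OF F] measurable_product_coordinates(2)
    show ?thesis unfolding f_def[abs_def] by measurable
  qed
  have fb: "norm (f p) \<le> 1" for p
    unfolding f_def prod_norm[symmetric] by (intro prod_le_1) auto
  have "(\<integral>\<omega>. (\<Prod>i<n. if \<Gamma> i \<omega> \<le> T then iexp (\<gamma> i \<omega> * F (level i \<omega>) (V i \<omega>)) else 1) \<partial>M) =
    (\<integral>\<omega>. f (((\<lambda>i. \<Gamma> i \<omega>), (\<lambda>i. V i \<omega>)), (\<lambda>i. \<gamma> i \<omega>)) \<partial>M)"
    by (simp only: f_def level_def fst_conv snd_conv)
  also have "\<dots> = (\<integral>\<omega>. \<integral>\<omega>'. f (((\<lambda>i. \<Gamma> i \<omega>), (\<lambda>i. V i \<omega>)), (\<lambda>i. \<gamma> i \<omega>')) \<partial>M \<partial>M)"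
    by (rule independent_integral[OF \<Gamma>V_\<gamma>_indep fm fb])
  also have "\<dots> = (\<integral>\<omega>. complex_of_real (\<Prod>i<n. if \<Gamma> i \<omega> \<le> T then cos (F (\<Gamma> i \<omega> * \<rho> (V i \<omega>)) (V i \<omega>)) else 1) \<partial>M)"
    unfolding f_def fst_conv snd_conv expectation_sign_product ..
  also have "\<dots> = complex_of_real (\<integral>\<omega>. (\<Prod>i<n. if \<Gamma> i \<omega> \<le> T then cos (F (\<Gamma> i \<omega> * \<rho> (V i \<omega>)) (V i \<omega>)) else 1) \<partial>M)"
    by (rule integral_complex_of_real)
  also have "(\<integral>\<omega>. (\<Prod>i<n. if \<Gamma> i \<omega> \<le> T then cos (F (\<Gamma> i \<omega> * \<rho> (V i \<omega>)) (V i \<omega>)) else 1) \<partial>M) =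
    (\<integral>\<omega>. (\<Prod>i<n. if \<Gamma> i \<omega> \<le> T then mark_average F (\<Gamma> i \<omega>) else 1) \<partial>M)"
  proof -
    define g where "g p = (\<Prod>i<n. if fst p i \<le> T then cos (F (fst p i * \<rho> (snd p i)) (snd p i)) else 1)"
      for p :: "(nat \<Rightarrow> real) \<times> (nat \<Rightarrow> real)"
    have gm: "g \<in> borel_measurable (?P \<Otimes>\<^sub>M ?P)"
    proof -
      have c: "(\<lambda>x. x i) \<in> borel_measurable ?P" for i by measurable
      have [measurable]: "(\<lambda>p. fst p i) \<in> borel_measurable (?P \<Otimes>\<^sub>M ?P)" "(\<lambda>p. snd p i) \<in> borel_measurable (?P \<Otimes>\<^sub>M ?P)" for i
        by (rule measurable_compose[OF _ c]; measurable)+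
      have [measurable]: "(\<lambda>p. F (fst p i * \<rho> (snd p i)) (snd p i)) \<in> borel_measurable (?P \<Otimes>\<^sub>M ?P)" for i
        by (rule measurable_binary_app[OF F]) measurable
      show ?thesis unfolding g_def[abs_def] by measurable
    qed
    have gb: "norm (g p) \<le> 1" for p
      unfolding g_def real_norm_def abs_prod by (intro prod_le_1) auto
    have "(\<integral>\<omega>. (\<Prod>i<n. if \<Gamma> i \<omega> \<le> T then cos (F (\<Gamma> i \<omega> * \<rho> (V i \<omega>)) (V i \<omega>)) else 1) \<partial>M) =
      (\<integral>\<omega>. g ((\<lambda>i. \<Gamma> i \<omega>), (\<lambda>i. V i \<omega>)) \<partial>M)" by (simp only: g_def fst_conv snd_conv)
    also have "\<dots> = (\<integral>\<omega>. \<integral>\<omega>'. g ((\<lambda>i. \<Gamma> i \<omega>), (\<lambda>i. V i \<omega>')) \<partial>M \<partial>M)"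
      by (rule independent_integral[OF \<Gamma>_V_indep gm gb])
    also have "\<dots> = (\<integral>\<omega>. (\<Prod>i<n. if \<Gamma> i \<omega> \<le> T then mark_average F (\<Gamma> i \<omega>) else 1) \<partial>M)"
    proof (rule Bochner_Integration.integral_cong[OF refl])
      fix \<omega>
      define k where "k i y = (if \<Gamma> i \<omega> \<le> T then cos (F (\<Gamma> i \<omega> * \<rho> y) y) else 1)" for i y
      have [measurable]: "(\<lambda>y. F (x * \<rho> y) y) \<in> borel_measurable borel" for x
        by (rule measurable_binary_app[OF F]) measurable
      have [measurable]: "k i \<in> borel_measurable borel" for i unfolding k_def by measurable
      have "indep_vars (\<lambda>_. borel) (\<lambda>i \<omega>'. k i (V i \<omega>')) {..<n}"
        by (rule indep_vars_compose2[OF indep_vars_subset[OF V_indep]]) auto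
      then have "(\<integral>\<omega>'. (\<Prod>i<n. k i (V i \<omega>')) \<partial>M) = (\<Prod>i<n. \<integral>\<omega>'. k i (V i \<omega>') \<partial>M)"
        by (intro indep_vars_lebesgue_integral integrable_const_bound[where B = 1]) (auto simp: k_def)
      also have "\<dots> = (\<Prod>i<n. if \<Gamma> i \<omega> \<le> T then mark_average F (\<Gamma> i \<omega>) else 1)"
        by (intro prod.cong refl) (auto simp: k_def mark_average_eq[OF F] prob_space)
      finally show "(\<integral>\<omega>'. g ((\<lambda>i. \<Gamma> i \<omega>), (\<lambda>i. V i \<omega>')) \<partial>M) = (\<Prod>i<n. if \<Gamma> i \<omega> \<le> T then mark_average F (\<Gamma> i \<omega>) else 1)"
        by (simp only: g_def k_def fst_conv snd_conv)
    qed
    finally show ?thesis .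
  qed
  finally show ?thesis .
qed

text \<open>
  The characteristic exponent of \<open>fkl_series F\<close> at 1.
\<close>

definition levy_exponent :: "(real \<Rightarrow> real \<Rightarrow> real) \<Rightarrow> ennreal" where
  "levy_exponent F = (\<integral>\<^sup>+y. \<integral>\<^sup>+z. ennreal (1 - cos (F z y)) * indicator {0<..} z \<partial>lborel \<partial>lborel)"

lemma levy_exponent_le:
  assumes F: "case_prod F \<in> borel_measurable (borel \<Otimes>\<^sub>M borel)"
  shows "levy_exponent F \<le> 2 * truncated_energy F"
proof -
  have m1: "(\<lambda>p. ennreal (min 1 ((F (snd p) (fst p))\<^sup>2)) * indicator {0<..} (snd p)) \<in> borel_measurable (lborel \<Otimes>\<^sub>M lborel)"
    using measurable_binary_app[OF F, of snd "lborel \<Otimes>\<^sub>M lborel" fst] by measurable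
  have m2: "(\<lambda>z. ennreal (min 1 ((F z y)\<^sup>2)) * indicator {0<..} z) \<in> borel_measurable lborel" for y
    using measurable_binary_app[OF F, of "\<lambda>z. z" lborel "\<lambda>_. y"] by measurable
  have "levy_exponent F \<le> (\<integral>\<^sup>+y. \<integral>\<^sup>+z. 2 * (ennreal (min 1 ((F z y)\<^sup>2)) * indicator {0<..} z) \<partial>lborel \<partial>lborel)"
    unfolding levy_exponent_def
  proof (intro nn_integral_mono)
    fix y z
    have "ennreal (1 - cos (F z y)) \<le> 2 * ennreal (min 1 ((F z y)\<^sup>2))"
      using one_minus_cos_le[of "F z y"] by (simp add: ennreal_leI ennreal_mult'[symmetric] flip: ennreal_numeral)
    then show "ennreal (1 - cos (F z y)) * indicator {0<..} z \<le> 2 * (ennreal (min 1 ((F z y)\<^sup>2)) * indicator {0<..} z)"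
      by (auto simp: indicator_def)
  qed
  also have "\<dots> = (\<integral>\<^sup>+y. 2 * (\<integral>\<^sup>+z. ennreal (min 1 ((F z y)\<^sup>2)) * indicator {0<..} z \<partial>lborel) \<partial>lborel)"
    by (intro nn_integral_cong nn_integral_cmult m2)
  also have "\<dots> = 2 * truncated_energy F"
    unfolding truncated_energy_def
    by (intro nn_integral_cmult lborel.borel_measurable_nn_integral) (use m1 in \<open>simp add: split_beta'\<close>)
  finally show ?thesis .
qed

lemma levy_exponent_eq:
  assumes F: "case_prod F \<in> borel_measurable (borel \<Otimes>\<^sub>M borel)"
  shows "levy_exponent F = (\<integral>\<^sup>+x. ennreal (1 - mark_average F x) * indicator {0<..} x \<partial>lborel)"
proof -
  define H where "H z y = ennreal (1 - cos (F z y))" for z y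
  have Hm: "case_prod H \<in> borel_measurable (borel \<Otimes>\<^sub>M borel)"
    using F by (simp add: H_def split_beta')
  note [measurable] = mark_average_measurable[OF F]
  have "(\<integral>\<^sup>+\<omega>. H (level i \<omega>) (V i \<omega>) \<partial>M) = (\<integral>\<^sup>+\<omega>. ennreal (1 - mark_average F (\<Gamma> i \<omega>)) \<partial>M)" for i
  proof -
    have ind: "independent borel (\<lambda>\<omega>. \<Gamma> i \<omega>) borel (\<lambda>\<omega>. V i \<omega>)"
      by (rule independent_compose[OF \<Gamma>_V_indep, where f = "\<lambda>x. x i" and g = "\<lambda>x. x i"]) auto
    have "(\<lambda>p. H (fst p * \<rho> (snd p)) (snd p)) \<in> borel_measurable (borel \<Otimes>\<^sub>M borel)"
      by (rule measurable_binary_app[OF Hm]) measurable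
    from independent_nn_integral[OF ind this]
    have "(\<integral>\<^sup>+\<omega>. H (level i \<omega>) (V i \<omega>) \<partial>M) = (\<integral>\<^sup>+\<omega>. \<integral>\<^sup>+\<omega>'. H (\<Gamma> i \<omega> * \<rho> (V i \<omega>')) (V i \<omega>') \<partial>M \<partial>M)"
      by (simp add: level_def)
    also have "\<dots> = (\<integral>\<^sup>+\<omega>. ennreal (1 - mark_average F (\<Gamma> i \<omega>)) \<partial>M)"
    proof (rule nn_integral_cong)
      fix \<omega>
      have [measurable]: "(\<lambda>\<omega>'. F (\<Gamma> i \<omega> * \<rho> (V i \<omega>')) (V i \<omega>')) \<in> borel_measurable M"
        by (rule measurable_binary_app[OF F]) measurable
      have int: "integrable M (\<lambda>\<omega>'. cos (F (\<Gamma> i \<omega> * \<rho> (V i \<omega>')) (V i \<omega>')))"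
        by (rule integrable_const_bound[where B = 1]) auto
      have "(\<integral>\<^sup>+\<omega>'. H (\<Gamma> i \<omega> * \<rho> (V i \<omega>')) (V i \<omega>') \<partial>M) = ennreal (\<integral>\<omega>'. 1 - cos (F (\<Gamma> i \<omega> * \<rho> (V i \<omega>')) (V i \<omega>')) \<partial>M)"
        unfolding H_def by (rule nn_integral_eq_integral) (use int in auto)
      also have "(\<integral>\<omega>'. 1 - cos (F (\<Gamma> i \<omega> * \<rho> (V i \<omega>')) (V i \<omega>')) \<partial>M) = 1 - mark_average F (\<Gamma> i \<omega>)"
        using int by (simp add: mark_average_eq[OF F] prob_space)
      finally show "(\<integral>\<^sup>+\<omega>'. H (\<Gamma> i \<omega> * \<rho> (V i \<omega>')) (V i \<omega>') \<partial>M) = ennreal (1 - mark_average F (\<Gamma> i \<omega>))" .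
    qed
    finally show ?thesis .
  qed
  then have "(\<Sum>i. \<integral>\<^sup>+\<omega>. H (level i \<omega>) (V i \<omega>) \<partial>M) = (\<integral>\<^sup>+x. ennreal (1 - mark_average F x) * indicator {0<..} x \<partial>lborel)"
    using campbell[of "\<lambda>x. ennreal (1 - mark_average F x)"] by simp
  then show ?thesis
    using marked_campbell[OF Hm] by (simp add: levy_exponent_def H_def)
qed

text \<open>
  The partial products over the arrivals up to time \<open>T\<close> have expectation
  \<open>exp (- \<integral>\<^bsub>(0, T]\<^esub> (1 - mark_average F))\<close> by \<open>truncated_char\<close> and the Laplace functional. As \<open>T\<close> tends to
  infinity the products converge almost surely to the exponential of the whole series, and the
  integral to the exponent by \<open>levy_exponent_eq\<close>.
\<close>

lemma char_fkl_series:
  assumes F: "case_prod F \<in> borel_measurable (borel \<Otimes>\<^sub>M borel)" and fin: "truncated_energy F < \<infinity>"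
    and cont: "\<And>y. continuous_on {0<..} (\<lambda>z. F z y)"
  shows "(\<integral>\<omega>. iexp (fkl_series F \<omega>) \<partial>M) = complex_of_real (exp (- enn2real (levy_exponent F)))"
proof -
  note [measurable] = mark_average_measurable[OF F]
  define \<psi> where "\<psi> i \<omega> = iexp (\<gamma> i \<omega> * F (level i \<omega>) (V i \<omega>))" for i \<omega>
  have [measurable]: "(\<lambda>\<omega>. F (level i \<omega>) (V i \<omega>)) \<in> borel_measurable M" for i
    by (rule measurable_binary_app[OF F]) measurable
  have [measurable]: "\<psi> i \<in> borel_measurable M" for i unfolding \<psi>_def by measurable
  have \<psi>1: "norm (\<psi> i \<omega>) = 1" for i \<omega> by (simp add: \<psi>_def)
  define \<Psi> where "\<Psi> T \<omega> = (\<Prod>i<N (real T) \<omega>. \<psi> i \<omega>)" for T \<omega>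
  have [measurable]: "N (real T) \<in> measurable M (count_space UNIV)" for T by (rule measurable_N) simp
  have \<Psi>m[measurable]: "\<Psi> T \<in> borel_measurable M" for T
    unfolding \<Psi>_def by (rule measurable_compose_countable[where f = "\<lambda>n \<omega>. \<Prod>i<n. \<psi> i \<omega>"]) auto
  have \<Psi>1: "norm (\<Psi> T \<omega>) = 1" for T \<omega> unfolding \<Psi>_def by (simp add: prod_norm[symmetric] \<psi>1)
  have E\<Psi>: "(\<integral>\<omega>. \<Psi> T \<omega> \<partial>M) = complex_of_real (exp (- (LINT x:{0<..real T}|lborel. 1 - mark_average F x)))" for T
  proof -
    have "(\<lambda>n. \<integral>\<omega>. (\<Prod>i<n. if \<Gamma> i \<omega> \<le> real T then \<psi> i \<omega> else 1) \<partial>M) \<longlonglongrightarrow> (\<integral>\<omega>. \<Psi> T \<omega> \<partial>M)"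
    proof (rule integral_dominated_convergence[where w = "\<lambda>_. 1"])
      show "AE \<omega> in M. (\<lambda>n. \<Prod>i<n. if \<Gamma> i \<omega> \<le> real T then \<psi> i \<omega> else 1) \<longlonglongrightarrow> \<Psi> T \<omega>"
        using arrival_iff
      proof eventually_elim
        case (elim \<omega>)
        have "(\<Prod>i<n. if \<Gamma> i \<omega> \<le> real T then \<psi> i \<omega> else 1) = \<Psi> T \<omega>" if "N (real T) \<omega> \<le> n" for n
          unfolding \<Psi>_def by (rule prod.mono_neutral_cong_right) (use that elim in auto)
        then show ?case by (intro tendsto_eventually eventually_sequentiallyI[of "N (real T) \<omega>"])
      qed
      show "AE \<omega> in M. norm (\<Prod>i<n. if \<Gamma> i \<omega> \<le> real T then \<psi> i \<omega> else 1) \<le> 1" for n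
        unfolding prod_norm[symmetric] by (intro AE_I2 prod_le_1) (auto simp: \<psi>1)
    qed auto
    moreover have "(\<lambda>n. \<integral>\<omega>. (\<Prod>i<n. if \<Gamma> i \<omega> \<le> real T then \<psi> i \<omega> else 1) \<partial>M) \<longlonglongrightarrow> complex_of_real (exp (- (LINT x:{0<..real T}|lborel. 1 - mark_average F x)))"
      unfolding \<psi>_def truncated_char[OF F]
      by (intro tendsto_of_real expectation_prod_arrivals_truncated mark_average_bound mark_average_continuous F cont) measurable
    ultimately show ?thesis by (rule LIMSEQ_unique)
  qed
  have "(\<lambda>T. \<integral>\<omega>. \<Psi> T \<omega> \<partial>M) \<longlonglongrightarrow> (\<integral>\<omega>. iexp (fkl_series F \<omega>) \<partial>M)"
  proof (rule integral_dominated_convergence[where w = "\<lambda>_. 1"])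
    show "AE \<omega> in M. (\<lambda>T. \<Psi> T \<omega>) \<longlonglongrightarrow> iexp (fkl_series F \<omega>)"
      using arrival_iff AE_fkl_summable[OF F fin]
    proof eventually_elim
      case (elim \<omega>)
      have "filterlim (\<lambda>T. N (real T) \<omega>) at_top sequentially"
        unfolding filterlim_at_top
      proof
        fix n
        obtain T0 where "\<Gamma> n \<omega> \<le> real T0" using real_arch_simple by blast
        then have "n \<le> N (real T) \<omega>" if "T0 \<le> T" for T
          using elim(1) that by (intro less_imp_le) (meson of_nat_0_le_iff of_nat_le_iff order_trans)
        then show "\<forall>\<^sub>F T in sequentially. n \<le> N (real T) \<omega>" by (rule eventually_sequentiallyI)
      qed
      from filterlim_compose[OF summable_LIMSEQ[OF elim(2)] this]
      have "(\<lambda>T. iexp (\<Sum>i<N (real T) \<omega>. \<gamma> i \<omega> * F (level i \<omega>) (V i \<omega>))) \<longlonglongrightarrow> iexp (fkl_series F \<omega>)"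
        unfolding fkl_series_def by (intro tendsto_intros)
      then show ?case by (simp add: \<Psi>_def \<psi>_def exp_sum[symmetric] sum_distrib_left)
    qed
  qed (use measurable_fkl_series[OF F] in \<open>auto simp: \<Psi>1\<close>)
  moreover have "(\<lambda>T. \<integral>\<omega>. \<Psi> T \<omega> \<partial>M) \<longlonglongrightarrow> complex_of_real (exp (- enn2real (levy_exponent F)))"
    unfolding E\<Psi>
  proof (intro tendsto_of_real tendsto_exp tendsto_minus)
    let ?G = "\<lambda>x. 1 - mark_average F x"
    have G0: "0 \<le> ?G x" for x using mark_average_bound[of F x] by (simp add: abs_le_iff)
    have fin': "levy_exponent F < \<infinity>"
      using levy_exponent_le[OF F] fin by (auto simp: ennreal_mult_less_top order_le_less_trans)
    have nn: "(\<integral>\<^sup>+x. ennreal (indicat_real {0<..} x * ?G x) \<partial>lborel) = levy_exponent F"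
      unfolding levy_exponent_eq[OF F] by (intro nn_integral_cong) (auto simp: indicator_def)
    have int: "integrable lborel (\<lambda>x. indicat_real {0<..} x * ?G x)"
      by (rule integrableI_nonneg) (use G0 fin' in \<open>auto simp: nn\<close>)
    have val: "(\<integral>x. indicat_real {0<..} x * ?G x \<partial>lborel) = enn2real (levy_exponent F)"
      by (subst integral_eq_nn_integral) (use G0 in \<open>auto simp: nn\<close>)
    show "(\<lambda>T. LINT x:{0<..real T}|lborel. ?G x) \<longlonglongrightarrow> enn2real (levy_exponent F)"
      unfolding val[symmetric] set_lebesgue_integral_def
    proof (rule integral_dominated_convergence[OF _ _ int])
      show "AE x in lborel. (\<lambda>T. indicat_real {0<..real T} x *\<^sub>R ?G x) \<longlonglongrightarrow> indicat_real {0<..} x * ?G x"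
      proof (rule AE_I2)
        fix x :: real
        obtain T0 where "x \<le> real T0" using real_arch_simple by blast
        then have "indicat_real {0<..real T} x *\<^sub>R ?G x = indicat_real {0<..} x * ?G x" if "T0 \<le> T" for T
          using that by (auto simp: indicator_def)
        then show "(\<lambda>T. indicat_real {0<..real T} x *\<^sub>R ?G x) \<longlonglongrightarrow> indicat_real {0<..} x * ?G x"
          by (intro tendsto_eventually eventually_sequentiallyI[of T0])
      qed
      show "AE x in lborel. norm (indicat_real {0<..real T} x *\<^sub>R ?G x) \<le> indicat_real {0<..} x * ?G x" for T
        using G0 by (intro AE_I2) (auto simp: indicator_def)
    qed auto
  qed
  ultimately show ?thesis by (rule LIMSEQ_unique)
qed

end

section \<open>The constant of stable laws\<close>

text \<open>
  Logarithms, which appear whenever powers are compared in their exponents, are absorbed by small changes of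
  the exponent in both directions.
\<close>

lemma abs_ln_le_powr:
  fixes x \<eta> :: real
  assumes "0 < x" "0 < \<eta>"
  shows "\<bar>ln x\<bar> \<le> (x powr \<eta> + x powr (- \<eta>)) / \<eta>"
proof -
  have "\<eta> * ln x \<le> x powr \<eta>" "- \<eta> * ln x \<le> x powr (- \<eta>)"
    using ln_le_minus_one[of "x powr \<eta>"] ln_le_minus_one[of "x powr (- \<eta>)"] assms by (simp_all add: ln_powr)
  then have "\<eta> * \<bar>ln x\<bar> \<le> x powr \<eta> + x powr (- \<eta>)"
    using powr_ge_zero[of x \<eta>] powr_ge_zero[of x "-\<eta>"] assms unfolding abs_real_def by (auto simp del: powr_ge_zero)
  then show ?thesis using assms by (simp add: field_simps)
qed

lemma powr_exponent_diff_le: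
  fixes x p q :: real
  assumes "0 < x"
  shows "\<bar>x powr p - x powr q\<bar> \<le> \<bar>p - q\<bar> * \<bar>ln x\<bar> * (x powr p + x powr q)"
proof -
  have *: "exp a - exp b \<le> \<bar>a - b\<bar> * (exp a + exp b)" for a b :: real
  proof (cases "b \<le> a")
    case True
    have "exp a * (1 - exp (b - a)) \<le> exp a * (a - b)"
    proof (rule mult_left_mono)
      show "1 - exp (b - a) \<le> a - b" using exp_ge_add_one_self[of "b - a"] by linarith
    qed simp
    moreover have "exp a * (1 - exp (b - a)) = exp a - exp b"
      by (simp add: right_diff_distrib exp_add[symmetric])
    moreover have "0 \<le> (a - b) * exp b" using True by simp
    moreover have "\<bar>a - b\<bar> * (exp a + exp b) = exp a * (a - b) + (a - b) * exp b"
      using True by (simp add: distrib_left mult.commute)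
    ultimately show ?thesis by linarith
  next
    case False
    then have "exp a \<le> exp b" "0 \<le> \<bar>a - b\<bar> * (exp a + exp b)" by auto
    then show ?thesis by linarith
  qed
  have "\<bar>exp (p * ln x) - exp (q * ln x)\<bar> \<le> \<bar>p * ln x - q * ln x\<bar> * (exp (p * ln x) + exp (q * ln x))"
    using *[of "p * ln x" "q * ln x"] *[of "q * ln x" "p * ln x"] by (simp add: abs_le_iff abs_minus_commute add.commute)
  also have "\<bar>p * ln x - q * ln x\<bar> = \<bar>p - q\<bar> * \<bar>ln x\<bar>" by (simp add: abs_mult[symmetric] left_diff_distrib)
  finally show ?thesis using assms by (simp add: powr_def)
qed

text \<open>
  The standard integrable majorant on the half-line: for \<open>-1 < a\<close> and \<open>b < -1\<close> it is integrable at
  both ends.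
\<close>

definition two_power :: "real \<Rightarrow> real \<Rightarrow> real \<Rightarrow> real" where
  "two_power a b x = (if x \<le> 1 then x powr a else x powr b)"

lemma two_power_measurable[measurable]: "two_power a b \<in> borel_measurable borel"
  unfolding two_power_def by measurable

lemma set_integrable_lborelI:
  fixes f :: "real \<Rightarrow> real"
  assumes [measurable]: "f \<in> borel_measurable borel" "A \<in> sets borel" and "f integrable_on A" "\<And>x. x \<in> A \<Longrightarrow> 0 \<le> f x"
  shows "set_integrable lborel A f"
proof -
  have "f absolutely_integrable_on A" using assms by (intro nonnegative_absolutely_integrable_1)
  then show ?thesis unfolding set_integrable_def by (subst (asm) integrable_completion) auto
qed

lemma two_power_integrable:
  assumes "-1 < a" "b < -1"
  shows "set_integrable lborel {0<..} (two_power a b)"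
proof -
  have "set_integrable lborel {0<..1} (\<lambda>x. x powr a)"
    using integrable_on_powr_from_0'[of a 1] assms by (intro set_integrable_lborelI) auto
  then have 1: "set_integrable lborel {0<..1} (two_power a b)"
    by (rule set_integrable_cong[THEN iffD1, rotated -1]) (auto simp: two_power_def)
  have "set_integrable lborel {1..} (\<lambda>x. x powr b)"
    using has_integral_powr_to_inf[of b 1] assms by (intro set_integrable_lborelI) (auto simp: integrable_on_def)
  then have "set_integrable lborel {1<..} (\<lambda>x. x powr b)"
    by (rule set_integrable_subset) auto
  then have 2: "set_integrable lborel {1<..} (two_power a b)"
    by (rule set_integrable_cong[THEN iffD1, rotated -1]) (auto simp: two_power_def)
  have "set_integrable lborel ({0<..1} \<union> {1<..}) (two_power a b)"
    using 1 2 by (rule set_integrable_Un) auto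
  also have "{0<..1} \<union> {1<..} = {0::real<..}" by auto
  finally show ?thesis .
qed

text \<open>
  The fundamental theorem of calculus on a half-line for the gauge integral, where \<open>f\<close> need not be absolutely
  integrable, nor bounded near 0.
\<close>

lemma has_integral_halfline:
  fixes F f :: "real \<Rightarrow> real"
  assumes cont: "continuous_on {0..} F" and der: "\<And>x. 0 < x \<Longrightarrow> (F has_real_derivative f x) (at x)"
    and lim: "(F \<longlongrightarrow> L) at_top"
  shows "(f has_integral (L - F 0)) {0..}"
proof -
  have fin: "(f has_integral (F b - F 0)) {0..b}" if "0 \<le> b" for b
    using that by (intro fundamental_theorem_of_calculus_interior continuous_on_subset[OF cont])
      (auto simp: has_real_derivative_iff_has_vector_derivative[symmetric] intro!: der)
  show ?thesis unfolding has_integral_alt'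
  proof (intro conjI allI impI)
    fix a b :: real
    have sub: "f integrable_on {0..max 0 b}" using fin[of "max 0 b"] by auto
    show "(\<lambda>x. if x \<in> {0..} then f x else 0) integrable_on cbox a b"
      unfolding integrable_restrict_Int by (rule integrable_on_subinterval[OF sub, of "max 0 a" b, THEN back_subst[of "\<lambda>A. f integrable_on A"]]) auto
  next
    fix e :: real assume "0 < e"
    then obtain B where B: "\<And>x. B \<le> x \<Longrightarrow> \<bar>F x - L\<bar> < e"
      using tendstoD[OF lim, of e] by (auto simp: eventually_at_top_linorder dist_real_def)
    show "\<exists>B>0. \<forall>a b. ball 0 B \<subseteq> cbox a b \<longrightarrow> norm (integral (cbox a b) (\<lambda>x. if x \<in> {0..} then f x else 0) - (L - F 0)) < e"
    proof (intro exI[of _ "max 1 (\<bar>B\<bar> + 1)"] conjI allI impI)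
      fix a b assume sub: "ball 0 (max 1 (\<bar>B\<bar> + 1)) \<subseteq> cbox a (b::real)"
      have "0 \<in> ball (0::real) (max 1 (\<bar>B\<bar> + 1))" "\<bar>B\<bar> \<in> ball (0::real) (max 1 (\<bar>B\<bar> + 1))" by auto
      then have ab: "a \<le> 0" "\<bar>B\<bar> \<le> b" using sub by (auto simp: subset_eq)
      then have "{0..} \<inter> cbox a b = {0..b}" by auto
      moreover have "(f has_integral (F b - F 0)) {0..b}" using ab by (intro fin) auto
      ultimately have "integral (cbox a b) (\<lambda>x. if x \<in> {0..} then f x else 0) = F b - F 0"
        by (simp only: integral_restrict_Int integral_unique)
      then show "norm (integral (cbox a b) (\<lambda>x. if x \<in> {0..} then f x else 0) - (L - F 0)) < e"
        using B[of b] ab by auto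
    qed simp
  qed
qed

lemma halfline_primitive:
  fixes g :: "real \<Rightarrow> real"
  assumes int: "set_integrable lborel {0<..} g" and cont: "continuous_on {0<..} g"
  defines "W \<equiv> \<lambda>z. LINT x:{0<..z}|lborel. g x"
  shows "W 0 = 0" "continuous_on {0..} W" "\<And>z. 0 < z \<Longrightarrow> (W has_real_derivative g z) (at z)"
    "(W \<longlongrightarrow> (LINT x:{0<..}|lborel. g x)) at_top"
proof -
  have int_sub: "set_integrable lborel {0<..z} g" for z by (rule set_integrable_subset[OF int]) auto
  have W: "W z = integral {0..z} g" "g integrable_on {0..z}" for z
  proof -
    have i: "g integrable_on {0<..z}" "(LINT x:{0<..z}|lborel. g x) = integral {0<..z} g"
      using set_borel_integral_eq_integral[OF int_sub[of z]] by auto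
    have sp: "negligible {x \<in> {0<..z} - {0..z}. g x \<noteq> 0}" "negligible {x \<in> {0..z} - {0<..z}. g x \<noteq> 0}"
      by (rule negligible_subset[of "{0}"]; auto)+
    show "g integrable_on {0..z}" by (rule integrable_spike_set[OF i(1)]) (use sp in auto)
    show "W z = integral {0..z} g" unfolding W_def i(2) by (rule integral_spike_set) (use sp in auto)
  qed
  have W_fun: "W = (\<lambda>z. integral {0..z} g)" using W(1) by (rule ext)
  show "W 0 = 0" by (simp add: W_def set_lebesgue_integral_def)
  show W_der: "(W has_real_derivative g z) (at z)" if "0 < z" for z
  proof -
    have "continuous (at z within {0..z+1}) g"
    proof (rule continuous_at_imp_continuous_at_within)
      show "isCont g z" using cont that by (simp add: continuous_on_eq_continuous_at)
    qed
    then have "((\<lambda>u. integral {0..u} g) has_vector_derivative g z) (at z within {0..z+1})"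
      using integral_has_vector_derivative_continuous_at[OF W(2)[of "z+1"], of z "{}"] that by simp
    moreover have "at z within {0..z+1} = at z" using that by (intro at_within_interior) auto
    ultimately show ?thesis by (simp only: W_fun has_real_derivative_iff_has_vector_derivative)
  qed
  show "continuous_on {0..} W"
  proof -
    have c: "continuous_on {0..b} W" for b
      unfolding W_fun by (rule indefinite_integral_continuous_1[OF W(2)])
    show ?thesis unfolding continuous_on_eq_continuous_within
    proof
      fix x :: real assume x: "x \<in> {0..}"
      then have "continuous (at x within {0..x+1}) W" using c[of "x+1"] by (simp add: continuous_on_eq_continuous_within)
      moreover have "at x within {0..x+1} = at x within {0..}"
        by (rule at_within_nhd[of x "{..<x+1}"]) auto
      ultimately show "continuous (at x within {0..}) W" by simp
    qed
  qed
  have "((\<lambda>z. \<integral>x. indicator {..z} x *\<^sub>R (indicator {0<..} x *\<^sub>R g x) \<partial>lborel) \<longlongrightarrow> (LINT x:{0<..}|lborel. g x)) at_top"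
    unfolding set_lebesgue_integral_def by (rule tendsto_integral_at_top) (use int in \<open>auto simp: set_integrable_def\<close>)
  moreover have "(\<integral>x. indicator {..z} x *\<^sub>R (indicator {0<..} x *\<^sub>R g x) \<partial>lborel) = W z" for z
    unfolding W_def set_lebesgue_integral_def by (intro Bochner_Integration.integral_cong) (auto simp: indicator_def)
  ultimately show "(W \<longlongrightarrow> (LINT x:{0<..}|lborel. g x)) at_top" by simp
qed

text \<open>
  Both this integral and the next one equal \<open>\<integral> x powr (- \<alpha>) * sin x\<close>. The present form, obtained through
  integration by parts, converges absolutely and depends on \<open>\<alpha>\<close> in an explicitly Lipschitz way.
\<close>

definition levy_moment :: "real \<Rightarrow> real" where
  "levy_moment \<alpha> = (LINT x:{0<..}|lborel. (1 - cos x) * (\<alpha> * x powr (- \<alpha> - 1)))"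

text \<open>
  The form that comes out of the characteristic exponent of a series over a Poisson process; the
  substitution \<open>z = x powr (- \<alpha>)\<close> relates it to \<open>levy_moment\<close>.
\<close>

definition tail_moment :: "real \<Rightarrow> real" where
  "tail_moment \<alpha> = (LINT z:{0<..}|lborel. 1 - cos (z powr (- 1 / \<alpha>)))"

lemma set_integrable_two_powerI:
  fixes g :: "real \<Rightarrow> real"
  assumes "g \<in> borel_measurable borel" "- 1 < a" "b < - 1" "\<And>x. 0 < x \<Longrightarrow> \<bar>g x\<bar> \<le> C * two_power a b x"
  shows "set_integrable lborel {0<..} g"
proof (rule set_integrable_bound)
  show "set_integrable lborel {0<..} (\<lambda>x. C * two_power a b x)"
    by (intro set_integrable_mult_right two_power_integrable assms)
  show "set_borel_measurable lborel {0<..} g" using assms(1) by (simp add: set_borel_measurable_def)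
  show "AE x in lborel. x \<in> {0<..} \<longrightarrow> norm (g x) \<le> norm (C * two_power a b x)"
  proof (intro AE_I2 impI)
    fix x :: real assume "x \<in> {0<..}"
    then have "\<bar>g x\<bar> \<le> C * two_power a b x" using assms(4) by simp
    then show "norm (g x) \<le> norm (C * two_power a b x)" by (simp only: real_norm_def)
  qed
qed

lemma levy_moment_integrable:
  fixes \<alpha> :: real
  assumes \<alpha>: "0 < \<alpha>" "\<alpha> < 2"
  shows "set_integrable lborel {0<..} (\<lambda>x. (1 - cos x) * (\<alpha> * x powr (- \<alpha> - 1)))"
proof (rule set_integrable_two_powerI)
  show "- 1 < 1 - \<alpha>" "- \<alpha> - 1 < - 1" using \<alpha> by auto
  fix x :: real assume x: "0 < x"
  have pos: "0 \<le> \<alpha> * x powr (- \<alpha> - 1)" using \<alpha> by simp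
  have "(1 - cos x) * (\<alpha> * x powr (- \<alpha> - 1)) \<le> 2 * \<alpha> * two_power (1 - \<alpha>) (- \<alpha> - 1) x"
  proof (cases "x \<le> 1")
    case True
    have "(1 - cos x) * (\<alpha> * x powr (- \<alpha> - 1)) \<le> x\<^sup>2 * (\<alpha> * x powr (- \<alpha> - 1))"
      by (intro mult_right_mono one_minus_cos_le_square pos)
    also have "\<dots> = \<alpha> * (x powr 2 * x powr (- \<alpha> - 1))" using x by simp
    also have "\<dots> = \<alpha> * x powr (1 - \<alpha>)" by (simp add: powr_add[symmetric])
    also have "\<dots> \<le> 2 * \<alpha> * x powr (1 - \<alpha>)" using \<alpha> by (intro mult_right_mono) auto
    finally show ?thesis using True by (simp add: two_power_def)
  next
    case False
    have "(1 - cos x) * (\<alpha> * x powr (- \<alpha> - 1)) \<le> 2 * (\<alpha> * x powr (- \<alpha> - 1))"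
      by (intro mult_right_mono one_minus_cos_le_two pos)
    then show ?thesis using False by (simp add: two_power_def mult.assoc)
  qed
  then show "\<bar>(1 - cos x) * (\<alpha> * x powr (- \<alpha> - 1))\<bar> \<le> 2 * \<alpha> * two_power (1 - \<alpha>) (- \<alpha> - 1) x"
    by (simp only: abs_of_nonneg[OF mult_nonneg_nonneg[OF one_minus_cos_nonneg pos]])
qed simp

lemma tail_moment_integrable:
  fixes \<alpha> :: real
  assumes \<alpha>: "0 < \<alpha>" "\<alpha> < 2"
  shows "set_integrable lborel {0<..} (\<lambda>z. 1 - cos (z powr (- 1 / \<alpha>)))"
proof (rule set_integrable_two_powerI)
  show "- 1 < (0::real)" "- 2 / \<alpha> < - 1" using \<alpha> by (auto simp: field_simps)
  fix x :: real assume x: "0 < x"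
  have "1 - cos (x powr (- 1 / \<alpha>)) \<le> 2 * two_power 0 (- 2 / \<alpha>) x"
  proof (cases "x \<le> 1")
    case True
    then show ?thesis using x one_minus_cos_le_two by (simp add: two_power_def)
  next
    case False
    have "1 - cos (x powr (- 1 / \<alpha>)) \<le> (x powr (- 1 / \<alpha>))\<^sup>2" by (rule one_minus_cos_le_square)
    also have "\<dots> = x powr (- 2 / \<alpha>)" using x by (simp add: powr_power)
    finally show ?thesis using False powr_ge_zero[of x "- 2 / \<alpha>"] by (simp add: two_power_def del: powr_ge_zero)
  qed
  then show "\<bar>1 - cos (x powr (- 1 / \<alpha>))\<bar> \<le> 2 * two_power 0 (- 2 / \<alpha>) x" by simp
qed simp

lemma boundary_term_tendsto:
  fixes \<alpha> :: real
  assumes \<alpha>: "0 < \<alpha>" "\<alpha> < 2"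
  shows "((\<lambda>x. x powr (- \<alpha>) * (1 - cos x)) \<longlongrightarrow> 0) (at_right 0)"
    and "((\<lambda>x. x powr (- \<alpha>) * (1 - cos x)) \<longlongrightarrow> 0) at_top"
proof -
  have "((\<lambda>x. x powr (2 - \<alpha>)) \<longlongrightarrow> 0) (at_right 0)"
    using \<alpha> by real_asymp
  then show "((\<lambda>x. x powr (- \<alpha>) * (1 - cos x)) \<longlongrightarrow> 0) (at_right 0)"
  proof (rule tendsto_0_le[where K = 1])
    show "\<forall>\<^sub>F x in at_right 0. norm (x powr (- \<alpha>) * (1 - cos x)) \<le> norm (x powr (2 - \<alpha>)) * 1"
      using eventually_at_right_less[of 0]
    proof eventually_elim
      case (elim x)
      have "x powr (- \<alpha>) * (1 - cos x) \<le> x powr (- \<alpha>) * x\<^sup>2" by (intro mult_left_mono one_minus_cos_le_square) simp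
      also have "\<dots> = x powr (2 - \<alpha>)" using elim by (simp add: powr_add[symmetric] powr_numeral[symmetric] del: powr_numeral)
      finally show ?case by (simp add: abs_mult)
    qed
  qed
  have "((\<lambda>x. x powr (- \<alpha>)) \<longlongrightarrow> 0) at_top" using \<alpha> by (intro tendsto_neg_powr filterlim_ident) auto
  then show "((\<lambda>x. x powr (- \<alpha>) * (1 - cos x)) \<longlongrightarrow> 0) at_top"
  proof (rule tendsto_0_le[where K = 2])
    show "\<forall>\<^sub>F x in at_top. norm (x powr (- \<alpha>) * (1 - cos x)) \<le> norm (x powr (- \<alpha>)) * 2"
      using one_minus_cos_le_two by (intro always_eventually allI) (simp add: abs_mult mult_left_mono)
  qed
qed

text \<open>
  An antiderivative of \<open>x powr (- \<alpha>) * sin x\<close> is \<open>x powr (- \<alpha>) * (1 - cos x)\<close> plus a primitive of the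
  integrand of \<open>levy_moment \<alpha>\<close>. The first term vanishes at 0 and at infinity.
\<close>

lemma stable_integral_eq_levy_moment:
  fixes \<alpha> :: real
  assumes \<alpha>: "0 < \<alpha>" "\<alpha> < 2"
  shows "((\<lambda>x. x powr (- \<alpha>) * sin x) has_integral levy_moment \<alpha>) {0..}"
proof -
  define g where "g x = (1 - cos x) * (\<alpha> * x powr (- \<alpha> - 1))" for x
  define W where "W z = (LINT x:{0<..z}|lborel. g x)" for z
  have gc: "continuous_on {0<..} g" unfolding g_def by (intro continuous_intros) auto
  note W = halfline_primitive[OF levy_moment_integrable[OF \<alpha>, folded g_def] gc, folded W_def]
  define A where "A x = x powr (- \<alpha>) * (1 - cos x) + W x" for x
  have "((\<lambda>x. x powr (- \<alpha>) * sin x) has_integral (levy_moment \<alpha> - A 0)) {0..}"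
  proof (rule has_integral_halfline)
    show "continuous_on {0..} A" unfolding A_def
    proof (intro continuous_on_add W)
      show "continuous_on {0..} (\<lambda>x. x powr (- \<alpha>) * (1 - cos x))"
        unfolding continuous_on_def
      proof
        fix x :: real assume x: "x \<in> {0..}"
        show "((\<lambda>x. x powr (- \<alpha>) * (1 - cos x)) \<longlongrightarrow> x powr (- \<alpha>) * (1 - cos x)) (at x within {0..})"
        proof (cases "x = 0")
          case True
          then show ?thesis using boundary_term_tendsto(1)[OF \<alpha>] by (simp add: at_within_Ici_at_right)
        next
          case False
          then show ?thesis using x by (intro tendsto_intros) auto
        qed
      qed
    qed
    show "(A has_real_derivative x powr (- \<alpha>) * sin x) (at x)" if "0 < x" for x
      unfolding A_def
      by (rule derivative_eq_intros W(3) refl that)+ (use that in \<open>simp add: g_def algebra_simps\<close>)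
    show "(A \<longlongrightarrow> levy_moment \<alpha>) at_top"
      unfolding A_def using tendsto_add[OF boundary_term_tendsto(2)[OF \<alpha>] W(4)] by (simp add: levy_moment_def g_def)
  qed
  then show ?thesis using W(1) by (simp add: A_def)
qed

text \<open>
  With \<open>W\<close> a primitive of \<open>1 - cos (z powr (- 1 / \<alpha>))\<close>, another antiderivative of \<open>x powr (- \<alpha>) * sin x\<close> is
  \<open>x powr (- \<alpha>) * (1 - cos x) - W (x powr (- \<alpha>))\<close>. Comparing antiderivatives in this way takes the place of
  a change of variables in an improper integral.
\<close>

lemma stable_integral_eq_tail_moment:
  fixes \<alpha> :: real
  assumes \<alpha>: "0 < \<alpha>" "\<alpha> < 2"
  shows "((\<lambda>x. x powr (- \<alpha>) * sin x) has_integral tail_moment \<alpha>) {0..}"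
proof -
  define g where "g z = 1 - cos (z powr (- 1 / \<alpha>))" for z :: real
  define W where "W z = (LINT x:{0<..z}|lborel. g x)" for z
  have gc: "continuous_on {0<..} g" unfolding g_def by (intro continuous_intros) auto
  note W = halfline_primitive[OF tail_moment_integrable[OF \<alpha>, folded g_def] gc, folded W_def]
  have W_lim: "(W \<longlongrightarrow> tail_moment \<alpha>) at_top" using W(4) by (simp add: tail_moment_def g_def)
  have inv: "((\<lambda>x. x powr (- \<alpha>)) \<longlongrightarrow> 0) at_top" using \<alpha> by (intro tendsto_neg_powr filterlim_ident) auto
  have inv0: "filterlim (\<lambda>x. x powr (- \<alpha>)) at_top (at_right 0)"
    using \<alpha> by real_asymp
  \<comment> \<open>the value at 0 is the limit, because \<open>W (x powr - \<alpha>)\<close> tends to the full integral there\<close>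
  define A where "A x = (if x = 0 then - tail_moment \<alpha> else x powr (- \<alpha>) * (1 - cos x) - W (x powr (- \<alpha>)))" for x
  have derA: "(A has_real_derivative x powr (- \<alpha>) * sin x) (at x)" if x: "0 < x" for x
  proof -
    have "((\<lambda>x. x powr (- \<alpha>) * (1 - cos x) - W (x powr (- \<alpha>))) has_real_derivative x powr (- \<alpha>) * sin x) (at x)"
    proof -
      have d: "((\<lambda>x. x powr (- \<alpha>)) has_real_derivative - \<alpha> * x powr (- \<alpha> - 1)) (at x)"
        using x by (auto intro!: derivative_eq_intros)
      have dW: "((\<lambda>x. W (x powr (- \<alpha>))) has_real_derivative g (x powr (- \<alpha>)) * (- \<alpha> * x powr (- \<alpha> - 1))) (at x)"
        by (rule DERIV_chain2[OF W(3) d]) (use x in simp)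
      have "((\<lambda>x. x powr (- \<alpha>) * (1 - cos x) - W (x powr (- \<alpha>))) has_real_derivative
        - \<alpha> * x powr (- \<alpha> - 1) * (1 - cos x) + sin x * x powr (- \<alpha>) - g (x powr (- \<alpha>)) * (- \<alpha> * x powr (- \<alpha> - 1))) (at x)"
        by (rule derivative_eq_intros d dW refl)+ simp
      moreover have "g (x powr (- \<alpha>)) = 1 - cos x"
        using x \<alpha> by (simp add: g_def powr_powr)
      ultimately show ?thesis by (simp add: algebra_simps)
    qed
    then show ?thesis
    proof (rule DERIV_cong_ev[THEN iffD1, OF refl _ refl, rotated])
      show "\<forall>\<^sub>F x in nhds x. x powr (- \<alpha>) * (1 - cos x) - W (x powr (- \<alpha>)) = A x"
        by (rule eventually_mono[OF eventually_nhds_in_open[of "{0<..}" x]]) (use x in \<open>auto simp: A_def\<close>)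
    qed
  qed
  have "((\<lambda>x. x powr (- \<alpha>) * sin x) has_integral (0 - A 0)) {0..}"
  proof (rule has_integral_halfline[OF _ derA])
    show "continuous_on {0..} A" unfolding continuous_on_eq_continuous_within
    proof
      fix x :: real assume x: "x \<in> {0..}"
      show "continuous (at x within {0..}) A"
      proof (cases "x = 0")
        case True
        have "((\<lambda>x. x powr (- \<alpha>) * (1 - cos x) - W (x powr (- \<alpha>))) \<longlongrightarrow> 0 - tail_moment \<alpha>) (at_right 0)"
          by (intro tendsto_diff boundary_term_tendsto(1)[OF \<alpha>] filterlim_compose[OF W_lim inv0])
        then have "(A \<longlongrightarrow> 0 - tail_moment \<alpha>) (at_right 0)"
          by (rule Lim_transform_eventually) (auto simp: A_def eventually_at_filter)
        then have "(A \<longlongrightarrow> A 0) (at_right 0)" by (simp add: A_def)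
        then show ?thesis by (simp add: True continuous_within at_within_Ici_at_right)
      next
        case False
        then show ?thesis using x DERIV_isCont[OF derA, of x] by (auto intro: continuous_at_imp_continuous_at_within)
      qed
    qed
    have "((\<lambda>x. W (x powr (- \<alpha>))) \<longlongrightarrow> W 0) at_top"
    proof -
      have "(W \<longlongrightarrow> W 0) (at 0 within {0..})" using W(2) by (simp add: continuous_on_def)
      then have "(W \<longlongrightarrow> W 0) (at_right 0)" by (simp only: at_within_Ici_at_right)
      moreover have "filterlim (\<lambda>x. x powr (- \<alpha>)) (at_right 0) at_top"
        unfolding filterlim_at using inv by (auto intro!: eventually_mono[OF eventually_gt_at_top[of 0]])
      ultimately show ?thesis by (rule filterlim_compose)
    qed
    then have "((\<lambda>x. x powr (- \<alpha>) * (1 - cos x) - W (x powr (- \<alpha>))) \<longlongrightarrow> 0 - 0) at_top"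
      using W(1) by (intro tendsto_diff boundary_term_tendsto(2)[OF \<alpha>]) simp
    then have "(A \<longlongrightarrow> 0 - 0) at_top"
    proof (rule Lim_transform_eventually)
      show "\<forall>\<^sub>F x in at_top. x powr (- \<alpha>) * (1 - cos x) - W (x powr (- \<alpha>)) = A x"
        by (rule eventually_mono[OF eventually_gt_at_top[of 0]]) (auto simp: A_def)
    qed
    then show "(A \<longlongrightarrow> 0) at_top" by simp
  qed auto
  then show ?thesis by (simp add: A_def)
qed

lemma stable_const_eq:
  fixes \<alpha> :: real
  assumes \<alpha>: "0 < \<alpha>" "\<alpha> < 2"
  shows "stable_const \<alpha> = inverse (levy_moment \<alpha>)" "tail_moment \<alpha> = levy_moment \<alpha>"
proof -
  show "stable_const \<alpha> = inverse (levy_moment \<alpha>)"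
    unfolding stable_const_def using stable_integral_eq_levy_moment[OF \<alpha>] by (simp add: integral_unique)
  show "tail_moment \<alpha> = levy_moment \<alpha>"
    using stable_integral_eq_levy_moment[OF \<alpha>] stable_integral_eq_tail_moment[OF \<alpha>] by (metis integral_unique)
qed

lemma levy_moment_pos:
  fixes \<alpha> :: real
  assumes \<alpha>: "0 < \<alpha>" "\<alpha> < 2"
  shows "0 < levy_moment \<alpha>"
proof -
  let ?g = "\<lambda>x. indicat_real {0<..} x *\<^sub>R ((1 - cos x) * (\<alpha> * x powr (- \<alpha> - 1)))"
  have int: "integrable lborel ?g" using levy_moment_integrable[OF \<alpha>] by (simp add: set_integrable_def)
  have nn: "0 \<le> ?g x" for x using \<alpha> by (simp add: indicator_def)
  have "levy_moment \<alpha> \<noteq> 0"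
  proof
    assume "levy_moment \<alpha> = 0"
    then have "AE x in lborel. ?g x = 0"
      using integral_nonneg_eq_0_iff_AE[OF int] nn by (simp add: levy_moment_def set_lebesgue_integral_def)
    then have "AE x in lborel. x \<notin> {0<..<1::real}"
    proof (rule AE_mp, intro AE_I2 impI notI)
      fix x :: real assume x: "?g x = 0" "x \<in> {0<..<1}"
      have "cos x < cos 0" using x pi_gt3 by (intro cos_monotone_0_pi) auto
      then show False using x \<alpha> by simp
    qed
    then have "emeasure lborel {x \<in> space lborel. x \<in> {0<..<1::real}} = 0" by (rule emeasure_eq_0_AE)
    moreover have "{x \<in> space lborel. x \<in> {0<..<1::real}} = {0<..<1}" by auto
    ultimately show False by simp
  qed
  moreover have "0 \<le> levy_moment \<alpha>"
    unfolding levy_moment_def set_lebesgue_integral_def using nn by (intro integral_nonneg_AE AE_I2)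
  ultimately show ?thesis by simp
qed

text \<open>
  The derivative of the integrand in \<open>\<alpha>\<close> costs a logarithm. For \<open>\<alpha>\<close> in a compact part of \<open>(0, 2)\<close> there is
  room for it at both ends: near 0 the integrand is of order \<open>x powr (1 - \<alpha>)\<close> with \<open>1 - \<alpha> > -1\<close>, and at
  infinity of order \<open>x powr (- \<alpha> - 1)\<close> with \<open>- \<alpha> - 1 < -1\<close>.
\<close>

lemma levy_moment_lipschitz:
  assumes c: "0 < c" and d: "d < 2"
  obtains L where "\<And>a a'. a \<in> {c..d} \<Longrightarrow> a' \<in> {c..d} \<Longrightarrow> \<bar>levy_moment a - levy_moment a'\<bar> \<le> L * \<bar>a - a'\<bar>"
proof -
  \<comment> \<open>\<open>\<eta>\<close> is the change of exponent that absorbs the logarithm\<close>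
  define \<eta> where "\<eta> = min c (2 - d) / 2"
  have \<eta>: "0 < \<eta>" "\<eta> < c" "\<eta> < 2 - d" using c d by (auto simp: \<eta>_def min_def)
  define p q where "p = 1 - d - \<eta>" and "q = - c - 1 + \<eta>"
  define K where "K = 2 * (1 + 8 / \<eta>)"
  have bound: "\<bar>(1 - cos x) * (a * x powr (- a - 1)) - (1 - cos x) * (a' * x powr (- a' - 1))\<bar> \<le> K * \<bar>a - a'\<bar> * two_power p q x"
    if a: "a \<in> {c..d}" "a' \<in> {c..d}" and x: "0 < x" for a a' x
  proof -
    \<comment> \<open>one majorant \<open>m\<close> for all the powers that occur, logarithms included\<close>
    have key: "\<bar>a * x powr (- a - 1) - a' * x powr (- a' - 1)\<bar> \<le> \<bar>a - a'\<bar> * ((1 + 8 / \<eta>) * m)"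
      if m: "x powr (- a - 1) \<le> m" "x powr (- a' - 1) \<le> m" "\<bar>ln x\<bar> * x powr (- a - 1) \<le> 2 / \<eta> * m" "\<bar>ln x\<bar> * x powr (- a' - 1) \<le> 2 / \<eta> * m" for m
    proof -
      have "0 \<le> m" using m(1) powr_ge_zero[of x "- a - 1"] by linarith
      have "a * x powr (- a - 1) - a' * x powr (- a' - 1) = (a - a') * x powr (- a - 1) + a' * (x powr (- a - 1) - x powr (- a' - 1))"
        by (simp add: algebra_simps)
      then have "\<bar>a * x powr (- a - 1) - a' * x powr (- a' - 1)\<bar> \<le> \<bar>a - a'\<bar> * x powr (- a - 1) + \<bar>a'\<bar> * \<bar>x powr (- a - 1) - x powr (- a' - 1)\<bar>"
        using abs_triangle_ineq[of "(a - a') * x powr (- a - 1)" "a' * (x powr (- a - 1) - x powr (- a' - 1))"] by (simp add: abs_mult)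
      also have "\<dots> \<le> \<bar>a - a'\<bar> * m + 2 * (\<bar>a - a'\<bar> * (4 / \<eta> * m))"
      proof (intro add_mono mult_mono)
        have "\<bar>x powr (- a - 1) - x powr (- a' - 1)\<bar> \<le> \<bar>(- a - 1) - (- a' - 1)\<bar> * \<bar>ln x\<bar> * (x powr (- a - 1) + x powr (- a' - 1))"
          by (rule powr_exponent_diff_le[OF x])
        also have "\<dots> = \<bar>a - a'\<bar> * (\<bar>ln x\<bar> * x powr (- a - 1) + \<bar>ln x\<bar> * x powr (- a' - 1))"
          by (simp add: algebra_simps abs_minus_commute)
        also have "\<dots> \<le> \<bar>a - a'\<bar> * (4 / \<eta> * m)"
          using m(3,4) by (intro mult_left_mono) auto
        finally show "\<bar>x powr (- a - 1) - x powr (- a' - 1)\<bar> \<le> \<bar>a - a'\<bar> * (4 / \<eta> * m)" .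
      qed (use a c d m \<open>0 \<le> m\<close> in auto)
      also have "\<dots> = \<bar>a - a'\<bar> * ((1 + 8 / \<eta>) * m)" by (simp add: algebra_simps)
      finally show ?thesis .
    qed
    have eq: "\<bar>(1 - cos x) * (a * x powr (- a - 1)) - (1 - cos x) * (a' * x powr (- a' - 1))\<bar> = (1 - cos x) * \<bar>a * x powr (- a - 1) - a' * x powr (- a' - 1)\<bar>"
      using one_minus_cos_nonneg[of x] by (simp only: right_diff_distrib[symmetric] abs_mult abs_of_nonneg)
    have "0 \<le> (1 + 8 / \<eta>)" using \<eta> by simp
    show ?thesis
    proof (cases "x \<le> 1")
      case True
      define m where "m = x powr (- d - 1 - \<eta>)"
      have pw: "x powr (- e - 1) \<le> m" "\<bar>ln x\<bar> * x powr (- e - 1) \<le> 2 / \<eta> * m" if "e \<in> {c..d}" for e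
      proof -
        have le: "x powr (- e - 1 - \<eta>) \<le> m" "x powr (- e - 1 + \<eta>) \<le> m" "x powr (- e - 1) \<le> m"
          unfolding m_def using True x that \<eta> by (intro powr_mono'; auto)+
        then show "x powr (- e - 1) \<le> m" by simp
        have "\<bar>ln x\<bar> * x powr (- e - 1) \<le> (x powr \<eta> + x powr (- \<eta>)) / \<eta> * x powr (- e - 1)"
          by (intro mult_right_mono abs_ln_le_powr x \<eta>) simp
        also have "\<dots> = (x powr (- e - 1 + \<eta>) + x powr (- e - 1 - \<eta>)) / \<eta>"
        proof -
          have "x powr \<eta> * x powr (- e - 1) = x powr (- e - 1 + \<eta>)" "x powr (- \<eta>) * x powr (- e - 1) = x powr (- e - 1 - \<eta>)"
            unfolding powr_add[symmetric] by (rule arg_cong[where f = "\<lambda>y. x powr y"]; simp)+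
          then show ?thesis by (simp add: distrib_right)
        qed
        also have "\<dots> \<le> (m + m) / \<eta>" using le \<eta> by (intro divide_right_mono add_mono) auto
        finally show "\<bar>ln x\<bar> * x powr (- e - 1) \<le> 2 / \<eta> * m" by simp
      qed
      have "(1 - cos x) * \<bar>a * x powr (- a - 1) - a' * x powr (- a' - 1)\<bar> \<le> x\<^sup>2 * (\<bar>a - a'\<bar> * ((1 + 8 / \<eta>) * m))"
        by (rule mult_mono[OF one_minus_cos_le_square key[OF pw(1)[OF a(1)] pw(1)[OF a(2)] pw(2)[OF a(1)] pw(2)[OF a(2)]]]) auto
      also have "\<dots> = \<bar>a - a'\<bar> * (1 + 8 / \<eta>) * (x powr 2 * x powr (- d - 1 - \<eta>))" using x by (simp add: m_def)
      also have "x powr 2 * x powr (- d - 1 - \<eta>) = x powr p"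
        unfolding powr_add[symmetric] p_def by (rule arg_cong[where f = "\<lambda>y. x powr y"]) simp
      also have "\<bar>a - a'\<bar> * (1 + 8 / \<eta>) * x powr p \<le> 2 * (\<bar>a - a'\<bar> * (1 + 8 / \<eta>) * x powr p)"
        using \<open>0 \<le> 1 + 8 / \<eta>\<close> by simp
      finally show ?thesis using True unfolding eq by (simp only: two_power_def K_def if_True mult_ac)
    next
      case False
      define m where "m = x powr q"
      have pw: "x powr (- e - 1) \<le> m" "\<bar>ln x\<bar> * x powr (- e - 1) \<le> 2 / \<eta> * m" if "e \<in> {c..d}" for e
      proof -
        have le: "x powr (- e - 1 - \<eta>) \<le> m" "x powr (- e - 1 + \<eta>) \<le> m" "x powr (- e - 1) \<le> m"
          unfolding m_def q_def using False x that \<eta> by (intro powr_mono; auto)+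
        then show "x powr (- e - 1) \<le> m" by simp
        have "\<bar>ln x\<bar> * x powr (- e - 1) \<le> (x powr \<eta> + x powr (- \<eta>)) / \<eta> * x powr (- e - 1)"
          by (intro mult_right_mono abs_ln_le_powr x \<eta>) simp
        also have "\<dots> = (x powr (- e - 1 + \<eta>) + x powr (- e - 1 - \<eta>)) / \<eta>"
        proof -
          have "x powr \<eta> * x powr (- e - 1) = x powr (- e - 1 + \<eta>)" "x powr (- \<eta>) * x powr (- e - 1) = x powr (- e - 1 - \<eta>)"
            unfolding powr_add[symmetric] by (rule arg_cong[where f = "\<lambda>y. x powr y"]; simp)+
          then show ?thesis by (simp add: distrib_right)
        qed
        also have "\<dots> \<le> (m + m) / \<eta>" using le \<eta> by (intro divide_right_mono add_mono) auto
        finally show "\<bar>ln x\<bar> * x powr (- e - 1) \<le> 2 / \<eta> * m" by simp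
      qed
      have "(1 - cos x) * \<bar>a * x powr (- a - 1) - a' * x powr (- a' - 1)\<bar> \<le> 2 * (\<bar>a - a'\<bar> * ((1 + 8 / \<eta>) * m))"
        by (rule mult_mono[OF one_minus_cos_le_two key[OF pw(1)[OF a(1)] pw(1)[OF a(2)] pw(2)[OF a(1)] pw(2)[OF a(2)]]]) auto
      then show ?thesis using False unfolding eq by (simp only: two_power_def K_def m_def if_False mult_ac)
    qed
  qed
  have int2: "set_integrable lborel {0<..} (two_power p q)"
    using \<eta> by (intro two_power_integrable) (auto simp: p_def q_def)
  show thesis
  proof (rule that[of "K * (LINT x:{0<..}|lborel. two_power p q x)"])
    fix a a' assume a: "a \<in> {c..d}" "a' \<in> {c..d}"
    have ia: "set_integrable lborel {0<..} (\<lambda>x. (1 - cos x) * (a * x powr (- a - 1)))" "set_integrable lborel {0<..} (\<lambda>x. (1 - cos x) * (a' * x powr (- a' - 1)))"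
      using a c d by (intro levy_moment_integrable; auto)+
    have "\<bar>levy_moment a - levy_moment a'\<bar> = \<bar>LINT x:{0<..}|lborel. (1 - cos x) * (a * x powr (- a - 1)) - (1 - cos x) * (a' * x powr (- a' - 1))\<bar>"
      using ia by (simp add: levy_moment_def set_integral_diff)
    also have "\<dots> \<le> (LINT x:{0<..}|lborel. \<bar>(1 - cos x) * (a * x powr (- a - 1)) - (1 - cos x) * (a' * x powr (- a' - 1))\<bar>)"
      using set_integral_norm_bound[OF set_integral_diff(1)[OF ia]] by simp
    also have "\<dots> \<le> (LINT x:{0<..}|lborel. K * \<bar>a - a'\<bar> * two_power p q x)"
      using bound[OF a] by (intro set_integral_mono set_integrable_abs set_integral_diff(1) ia set_integrable_mult_right int2) auto
    also have "\<dots> = K * (LINT x:{0<..}|lborel. two_power p q x) * \<bar>a - a'\<bar>" by simp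
    finally show "\<bar>levy_moment a - levy_moment a'\<bar> \<le> K * (LINT x:{0<..}|lborel. two_power p q x) * \<bar>a - a'\<bar>" .
  qed
qed

text \<open>
  The substitution \<open>z = k powr \<alpha> * z'\<close> reduces the integral to the case \<open>k = 1\<close>, that is, to
  \<open>tail_moment \<alpha>\<close>. In this way \<open>stable_const \<alpha>\<close> enters the characteristic exponent of the series.
\<close>

lemma nn_integral_one_minus_cos_power:
  fixes \<alpha> :: real
  assumes \<alpha>: "0 < \<alpha>" "\<alpha> < 2" and k: "0 \<le> k"
  shows "(\<integral>\<^sup>+z. ennreal (1 - cos (k * z powr (- 1 / \<alpha>))) * indicator {0<..} z \<partial>lborel) = ennreal (k powr \<alpha> / stable_const \<alpha>)"
proof (cases "k = 0")
  case False
  then have k: "0 < k" using k by simp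
  have kp: "0 < k powr \<alpha>" using k by simp
  have base: "(\<integral>\<^sup>+z. ennreal (1 - cos (z powr (- 1 / \<alpha>))) * indicator {0<..} z \<partial>lborel) = ennreal (levy_moment \<alpha>)"
  proof -
    have "(\<integral>\<^sup>+z. ennreal (1 - cos (z powr (- 1 / \<alpha>))) * indicator {0<..} z \<partial>lborel) = (\<integral>\<^sup>+z. ennreal (indicator {0<..} z *\<^sub>R (1 - cos (z powr (- 1 / \<alpha>)))) \<partial>lborel)"
      by (intro nn_integral_cong) (auto simp: indicator_def)
    also have "\<dots> = ennreal (tail_moment \<alpha>)"
      unfolding tail_moment_def set_lebesgue_integral_def
      using tail_moment_integrable[OF \<alpha>] by (intro nn_integral_eq_integral) (auto simp: set_integrable_def indicator_def)
    finally show ?thesis by (simp add: stable_const_eq[OF \<alpha>])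
  qed
  have "(\<integral>\<^sup>+z. ennreal (1 - cos (k * z powr (- 1 / \<alpha>))) * indicator {0<..} z \<partial>lborel) =
    ennreal \<bar>k powr \<alpha>\<bar> * (\<integral>\<^sup>+z. ennreal (1 - cos (k * (0 + k powr \<alpha> * z) powr (- 1 / \<alpha>))) * indicator {0<..} (0 + k powr \<alpha> * z) \<partial>lborel)"
    using kp by (intro nn_integral_real_affine) auto
  also have "(\<integral>\<^sup>+z. ennreal (1 - cos (k * (0 + k powr \<alpha> * z) powr (- 1 / \<alpha>))) * indicator {0<..} (0 + k powr \<alpha> * z) \<partial>lborel) = ennreal (levy_moment \<alpha>)"
    unfolding base[symmetric]
  proof (intro nn_integral_cong)
    fix z :: real
    show "ennreal (1 - cos (k * (0 + k powr \<alpha> * z) powr (- 1 / \<alpha>))) * indicator {0<..} (0 + k powr \<alpha> * z) = ennreal (1 - cos (z powr (- 1 / \<alpha>))) * indicator {0<..} z"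
    proof (cases "0 < z")
      case True
      have "k * (k powr \<alpha> * z) powr (- 1 / \<alpha>) = k * (k powr (- 1)) * z powr (- 1 / \<alpha>)"
        using k True \<alpha> by (simp add: powr_mult powr_powr)
      also have "\<dots> = z powr (- 1 / \<alpha>)" using k by (simp add: powr_minus)
      finally show ?thesis using True kp by simp
    next
      case False
      then show ?thesis using kp by (simp add: zero_less_mult_iff)
    qed
  qed
  also have "ennreal \<bar>k powr \<alpha>\<bar> * ennreal (levy_moment \<alpha>) = ennreal (k powr \<alpha> / stable_const \<alpha>)"
    using levy_moment_pos[OF \<alpha>] by (simp add: ennreal_mult[symmetric] stable_const_eq[OF \<alpha>] divide_inverse less_imp_le)
  finally show ?thesis .
qed simp

section \<open>Kernels of fractional stable motions\<close>

definition kernel_increment :: "real \<Rightarrow> real \<Rightarrow> real \<Rightarrow> real" where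
  "kernel_increment p s y = \<bar>s - y\<bar> powr p - \<bar>y\<bar> powr p"

text \<open>
  The kernel has singularities at 0 and \<open>s\<close> and decays like \<open>\<bar>y\<bar> powr (p - 1)\<close> at infinity. The exponents
  \<open>q < p\<close> and \<open>q' > p - 1\<close> leave room for a neighbourhood of parameters and for logarithms.
\<close>

definition kernel_majorant :: "real \<Rightarrow> real \<Rightarrow> real \<Rightarrow> real \<Rightarrow> real \<Rightarrow> real" where
  "kernel_majorant R q q' s y = (if \<bar>y\<bar> \<le> R then \<bar>s - y\<bar> powr q + \<bar>y\<bar> powr q else \<bar>y\<bar> powr q')"

lemma kernel_measurable[measurable]:
  "kernel_increment p s \<in> borel_measurable borel" "kernel_majorant R q q' s \<in> borel_measurable borel"
  unfolding kernel_increment_def[abs_def] kernel_majorant_def[abs_def] by measurable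

lemma kernel_majorant_nonneg: "0 \<le> kernel_majorant R q q' s y"
  by (simp add: kernel_majorant_def)

text \<open>
  Near the two singularities \<open>y = 0\<close> and \<open>y = s\<close> the two terms are estimated separately by the size of
  the profile. Far away the difference is small by the mean value theorem, and \<open>\<bar>s - y\<bar>\<close> and \<open>\<bar>y\<bar>\<close>
  differ by a factor of at most 2. The profile is \<open>x powr p\<close> or a difference of two such powers.
\<close>

lemma profile_increment_le:
  fixes f f' :: "real \<Rightarrow> real"
  assumes S: "0 \<le> S" "\<bar>s\<bar> \<le> S" and c: "0 \<le> c" and q': "q' \<le> 0"
    and near: "\<And>x. 0 \<le> x \<Longrightarrow> x \<le> 3 * S + 2 \<Longrightarrow> \<bar>f x\<bar> \<le> c * x powr q"
    and der: "\<And>x. 1 \<le> x \<Longrightarrow> (f has_real_derivative f' x) (at x)"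
    and far: "\<And>x. 1 \<le> x \<Longrightarrow> \<bar>f' x\<bar> \<le> c * x powr q'"
  shows "\<bar>f \<bar>s - y\<bar> - f \<bar>y\<bar>\<bar> \<le> c * (1 + S * 2 powr (- q')) * kernel_majorant (2 * S + 2) q q' s y"
proof (cases "\<bar>y\<bar> \<le> 2 * S + 2")
  case True
  have "\<bar>f \<bar>s - y\<bar> - f \<bar>y\<bar>\<bar> \<le> \<bar>f \<bar>s - y\<bar>\<bar> + \<bar>f \<bar>y\<bar>\<bar>" by linarith
  also have "\<dots> \<le> c * \<bar>s - y\<bar> powr q + c * \<bar>y\<bar> powr q"
    using True S by (intro add_mono near) auto
  also have "\<dots> = c * 1 * kernel_majorant (2 * S + 2) q q' s y" using True by (simp add: kernel_majorant_def algebra_simps)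
  also have "\<dots> \<le> c * (1 + S * 2 powr (- q')) * kernel_majorant (2 * S + 2) q q' s y"
    using S c by (intro mult_right_mono mult_left_mono kernel_majorant_nonneg) auto
  finally show ?thesis .
next
  case False
  define B where "B = c * (\<bar>y\<bar> / 2) powr q'"
  have half: "1 \<le> \<bar>y\<bar> / 2" "\<bar>y\<bar> / 2 \<le> \<bar>s - y\<bar>" using False S by linarith+
  have "norm (f \<bar>s - y\<bar> - f \<bar>y\<bar>) \<le> B * norm (\<bar>s - y\<bar> - \<bar>y\<bar>)"
  proof (rule field_differentiable_bound[where S = "{\<bar>y\<bar> / 2..}" and f' = f'])
    show "(f has_field_derivative f' z) (at z within {\<bar>y\<bar> / 2..})" if "z \<in> {\<bar>y\<bar> / 2..}" for z
      using that half by (intro has_field_derivative_at_within[OF der]) auto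
    show "norm (f' z) \<le> B" if z: "z \<in> {\<bar>y\<bar> / 2..}" for z
    proof -
      have "\<bar>f' z\<bar> \<le> c * z powr q'" using z half by (intro far) auto
      also have "\<dots> \<le> B" unfolding B_def using z half q' c by (intro mult_left_mono powr_mono2') auto
      finally show ?thesis by simp
    qed
  qed (use half in auto)
  also have "\<dots> \<le> B * S"
  proof (rule mult_left_mono)
    show "norm (\<bar>s - y\<bar> - \<bar>y\<bar>) \<le> S" using S by (simp add: abs_le_iff) linarith
    show "0 \<le> B" using c by (simp add: B_def)
  qed
  also have "\<dots> = c * (S * 2 powr (- q')) * \<bar>y\<bar> powr q'"
  proof -
    have "(\<bar>y\<bar> / 2) powr q' = \<bar>y\<bar> powr q' / 2 powr q'" by (rule powr_divide)
    moreover have "2 powr (- q') = 1 / 2 powr q'" by (rule powr_minus_divide)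
    ultimately show ?thesis by (simp add: B_def)
  qed
  also have "\<dots> \<le> c * (1 + S * 2 powr (- q')) * \<bar>y\<bar> powr q'"
    using S c by (intro mult_right_mono mult_left_mono) auto
  finally show ?thesis using False by (simp add: kernel_majorant_def)
qed

text \<open>
  On a bounded interval a power with exponent in \<open>[q, q + m]\<close> is dominated by the power with exponent \<open>q\<close>.
\<close>

lemma powr_le_scaled:
  fixes x X e q m :: real
  assumes "0 \<le> x" "x \<le> X" "1 \<le> X" "q \<le> e" "e \<le> q + m"
  shows "x powr e \<le> X powr m * x powr q"
proof (cases "x = 0")
  case False
  have "x powr e = x powr (e - q) * x powr q" by (simp add: powr_add[symmetric])
  also have "x powr (e - q) \<le> X powr (e - q)" using assms by (intro powr_mono2) auto
  also have "X powr (e - q) \<le> X powr m" using assms by (intro powr_mono) auto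
  finally show ?thesis by (simp add: mult_right_mono)
qed simp

text \<open>
  Exponents within \<open>\<delta>\<close> of \<open>p0\<close> together with a logarithm, which costs another \<open>\<delta>\<close>, lead to the shift by
  \<open>2 * \<delta>\<close>. Both estimates are instances of \<open>profile_increment_le\<close>.
\<close>

lemma kernel_bounds:
  fixes p0 \<delta> S :: real
  assumes \<delta>: "0 < \<delta>" and S: "0 \<le> S" and q': "p0 + 2 * \<delta> - 1 \<le> 0"
  obtains C where "0 \<le> C"
    "\<And>p s y. \<bar>p - p0\<bar> \<le> \<delta> \<Longrightarrow> \<bar>s\<bar> \<le> S \<Longrightarrow>
      \<bar>kernel_increment p s y\<bar> \<le> C * kernel_majorant (2 * S + 2) (p0 - 2 * \<delta>) (p0 + 2 * \<delta> - 1) s y"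
    "\<And>p p' s y. \<bar>p - p0\<bar> \<le> \<delta> \<Longrightarrow> \<bar>p' - p0\<bar> \<le> \<delta> \<Longrightarrow> \<bar>s\<bar> \<le> S \<Longrightarrow>
      \<bar>kernel_increment p s y - kernel_increment p' s y\<bar>
        \<le> C * \<bar>p - p'\<bar> * kernel_majorant (2 * S + 2) (p0 - 2 * \<delta>) (p0 + 2 * \<delta> - 1) s y"
proof -
  define q q' X where "q = p0 - 2 * \<delta>" and "q' = p0 + 2 * \<delta> - 1" and "X = 3 * S + 2"
  define c1 where "c1 = X powr (4 * \<delta>) + (\<bar>p0\<bar> + \<delta>)"
  define c2 where "c2 = 4 * X powr (4 * \<delta>) / \<delta> + (1 + (\<bar>p0\<bar> + \<delta>) * (4 / \<delta>))"
  define A where "A = 1 + S * 2 powr (- q')"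
  have X: "1 \<le> X" using S by (simp add: X_def)
  have A: "0 \<le> A" using S by (simp add: A_def)
  have c: "0 \<le> c1" "0 \<le> c2" using \<delta> by (auto simp: c1_def c2_def)
  have lnx: "\<bar>ln x\<bar> * x powr e \<le> (x powr (e + \<delta>) + x powr (e - \<delta>)) / \<delta>" if "0 < x" for x e :: real
  proof -
    have "\<bar>ln x\<bar> * x powr e \<le> (x powr \<delta> + x powr (- \<delta>)) / \<delta> * x powr e"
      by (intro mult_right_mono abs_ln_le_powr that \<delta>) simp
    also have "\<dots> = (x powr (e + \<delta>) + x powr (e - \<delta>)) / \<delta>"
    proof -
      have "x powr \<delta> * x powr e = x powr (e + \<delta>)" "x powr (- \<delta>) * x powr e = x powr (e - \<delta>)"
        unfolding powr_add[symmetric] by (rule arg_cong[where f = "\<lambda>y. x powr y"]; simp)+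
      then show ?thesis by (simp add: distrib_right)
    qed
    finally show ?thesis .
  qed
  show thesis
  proof (rule that[of "(c1 + c2) * A"])
    show "0 \<le> (c1 + c2) * A" using c A by simp
  next
    fix p s y :: real assume p: "\<bar>p - p0\<bar> \<le> \<delta>" and s: "\<bar>s\<bar> \<le> S"
    have "\<bar>\<bar>s - y\<bar> powr p - \<bar>y\<bar> powr p\<bar> \<le> c1 * (1 + S * 2 powr (- q')) * kernel_majorant (2 * S + 2) q q' s y"
    proof (rule profile_increment_le[where f' = "\<lambda>x. p * x powr (p - 1)", OF S s c(1)])
      show "q' \<le> 0" using q' by (simp add: q'_def)
      fix x :: real
      { assume x: "0 \<le> x" "x \<le> 3 * S + 2"
        have "x powr p \<le> X powr (4 * \<delta>) * x powr q"
          using x X p \<delta> by (intro powr_le_scaled) (auto simp: q_def X_def abs_le_iff)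
        also have "\<dots> \<le> c1 * x powr q" using \<delta> by (intro mult_right_mono) (auto simp: c1_def)
        finally show "\<bar>x powr p\<bar> \<le> c1 * x powr q" by simp }
      { assume x: "1 \<le> x"
        then show "((\<lambda>x. x powr p) has_real_derivative p * x powr (p - 1)) (at x)"
          by (auto intro!: derivative_eq_intros)
        have "\<bar>p * x powr (p - 1)\<bar> = \<bar>p\<bar> * x powr (p - 1)" by (simp add: abs_mult)
        also have "\<dots> \<le> (\<bar>p0\<bar> + \<delta>) * x powr q'"
          using p x \<delta> by (intro mult_mono powr_mono) (auto simp: q'_def abs_le_iff)
        also have "\<dots> \<le> c1 * x powr q'" by (intro mult_right_mono) (auto simp: c1_def)
        finally show "\<bar>p * x powr (p - 1)\<bar> \<le> c1 * x powr q'" . }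
    qed
    also have "\<dots> \<le> (c1 + c2) * A * kernel_majorant (2 * S + 2) q q' s y"
      using c A unfolding A_def[symmetric] by (intro mult_right_mono kernel_majorant_nonneg) auto
    finally show "\<bar>kernel_increment p s y\<bar> \<le> (c1 + c2) * A * kernel_majorant (2 * S + 2) (p0 - 2 * \<delta>) (p0 + 2 * \<delta> - 1) s y"
      by (simp add: kernel_increment_def q_def q'_def)
  next
    fix p p' s y :: real assume p: "\<bar>p - p0\<bar> \<le> \<delta>" "\<bar>p' - p0\<bar> \<le> \<delta>" and s: "\<bar>s\<bar> \<le> S"
    let ?d = "\<bar>p - p'\<bar>"
    have "\<bar>(\<bar>s - y\<bar> powr p - \<bar>s - y\<bar> powr p') - (\<bar>y\<bar> powr p - \<bar>y\<bar> powr p')\<bar> \<le> ?d * c2 * (1 + S * 2 powr (- q')) * kernel_majorant (2 * S + 2) q q' s y"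
    proof (rule profile_increment_le[where f = "\<lambda>x. x powr p - x powr p'" and f' = "\<lambda>x. p * x powr (p - 1) - p' * x powr (p' - 1)", OF S s])
      show "0 \<le> ?d * c2" using c by simp
      show "q' \<le> 0" using q' by (simp add: q'_def)
      fix x :: real
      { assume x: "0 \<le> x" "x \<le> 3 * S + 2"
        show "\<bar>x powr p - x powr p'\<bar> \<le> ?d * c2 * x powr q"
        proof (cases "x = 0")
          case False
          then have x0: "0 < x" using x by simp
          have pw: "\<bar>ln x\<bar> * x powr e \<le> 2 * X powr (4 * \<delta>) / \<delta> * x powr q" if "\<bar>e - p0\<bar> \<le> \<delta>" for e
          proof -
            have "\<bar>ln x\<bar> * x powr e \<le> (x powr (e + \<delta>) + x powr (e - \<delta>)) / \<delta>" by (rule lnx[OF x0])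
            also have "x powr (e + \<delta>) \<le> X powr (4 * \<delta>) * x powr q"
              by (rule powr_le_scaled) (use x X that \<delta> in \<open>auto simp: q_def X_def abs_le_iff\<close>)
            also have "x powr (e - \<delta>) \<le> X powr (4 * \<delta>) * x powr q"
              by (rule powr_le_scaled) (use x X that \<delta> in \<open>auto simp: q_def X_def abs_le_iff\<close>)
            finally show ?thesis using \<delta> by (simp add: field_simps)
          qed
          have "\<bar>x powr p - x powr p'\<bar> \<le> ?d * \<bar>ln x\<bar> * (x powr p + x powr p')"
            by (rule powr_exponent_diff_le[OF x0])
          also have "\<dots> = ?d * (\<bar>ln x\<bar> * x powr p + \<bar>ln x\<bar> * x powr p')" by (simp add: algebra_simps)
          also have "\<dots> \<le> ?d * (2 * X powr (4 * \<delta>) / \<delta> * x powr q + 2 * X powr (4 * \<delta>) / \<delta> * x powr q)"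
            by (intro mult_left_mono add_mono pw p) auto
          also have "\<dots> = ?d * (4 * X powr (4 * \<delta>) / \<delta> * x powr q)" by (simp add: field_simps)
          also have "\<dots> \<le> ?d * (c2 * x powr q)"
            using \<delta> by (intro mult_left_mono mult_right_mono) (auto simp: c2_def)
          finally show ?thesis by (simp add: mult.assoc)
        qed simp }
      { assume x: "1 \<le> x"
        then show "((\<lambda>x. x powr p - x powr p') has_real_derivative p * x powr (p - 1) - p' * x powr (p' - 1)) (at x)"
          by (auto intro!: derivative_eq_intros)
        have x0: "0 < x" using x by simp
        have pw: "\<bar>ln x\<bar> * x powr (e - 1) \<le> 2 / \<delta> * x powr q'" if "\<bar>e - p0\<bar> \<le> \<delta>" for e
        proof -
          have "\<bar>ln x\<bar> * x powr (e - 1) \<le> (x powr (e - 1 + \<delta>) + x powr (e - 1 - \<delta>)) / \<delta>" by (rule lnx[OF x0])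
          also have "\<dots> \<le> (x powr q' + x powr q') / \<delta>"
            using x that \<delta> by (intro divide_right_mono add_mono powr_mono) (auto simp: q'_def abs_le_iff)
          finally show ?thesis by (simp add: field_simps)
        qed
        have "p * x powr (p - 1) - p' * x powr (p' - 1) = (p - p') * x powr (p - 1) + p' * (x powr (p - 1) - x powr (p' - 1))"
          by (simp add: algebra_simps)
        then have "\<bar>p * x powr (p - 1) - p' * x powr (p' - 1)\<bar> \<le> ?d * x powr (p - 1) + \<bar>p'\<bar> * \<bar>x powr (p - 1) - x powr (p' - 1)\<bar>"
          using abs_triangle_ineq[of "(p - p') * x powr (p - 1)" "p' * (x powr (p - 1) - x powr (p' - 1))"] by (simp add: abs_mult)
        also have "\<dots> \<le> ?d * x powr q' + (\<bar>p0\<bar> + \<delta>) * (?d * (4 / \<delta> * x powr q'))"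
        proof (intro add_mono mult_mono)
          have "\<bar>x powr (p - 1) - x powr (p' - 1)\<bar> \<le> \<bar>(p - 1) - (p' - 1)\<bar> * \<bar>ln x\<bar> * (x powr (p - 1) + x powr (p' - 1))"
            by (rule powr_exponent_diff_le[OF x0])
          also have "\<dots> = ?d * (\<bar>ln x\<bar> * x powr (p - 1) + \<bar>ln x\<bar> * x powr (p' - 1))" by (simp add: algebra_simps)
          also have "\<dots> \<le> ?d * (2 / \<delta> * x powr q' + 2 / \<delta> * x powr q')"
            by (intro mult_left_mono add_mono pw p) auto
          also have "\<dots> = ?d * (4 / \<delta> * x powr q')" by (simp add: field_simps)
          finally show "\<bar>x powr (p - 1) - x powr (p' - 1)\<bar> \<le> ?d * (4 / \<delta> * x powr q')" .
          show "x powr (p - 1) \<le> x powr q'" using x p \<delta> by (intro powr_mono) (auto simp: q'_def abs_le_iff)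
        qed (use p \<delta> in auto)
        also have "\<dots> = ?d * ((1 + (\<bar>p0\<bar> + \<delta>) * (4 / \<delta>)) * x powr q')" by (simp add: algebra_simps)
        also have "\<dots> \<le> ?d * (c2 * x powr q')"
          using \<delta> by (intro mult_left_mono mult_right_mono) (auto simp: c2_def)
        finally show "\<bar>p * x powr (p - 1) - p' * x powr (p' - 1)\<bar> \<le> ?d * c2 * x powr q'" by (simp add: mult.assoc) }
    qed
    also have "?d * c2 * (1 + S * 2 powr (- q')) * kernel_majorant (2 * S + 2) q q' s y = c2 * (A * (?d * kernel_majorant (2 * S + 2) q q' s y))"
      by (simp add: A_def mult_ac)
    also have "\<dots> \<le> (c1 + c2) * (A * (?d * kernel_majorant (2 * S + 2) q q' s y))"
      using c A by (intro mult_right_mono mult_nonneg_nonneg kernel_majorant_nonneg) auto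
    also have "\<dots> = (c1 + c2) * A * ?d * kernel_majorant (2 * S + 2) q q' s y" by (simp add: mult_ac)
    finally show "\<bar>kernel_increment p s y - kernel_increment p' s y\<bar>
        \<le> (c1 + c2) * A * \<bar>p - p'\<bar> * kernel_majorant (2 * S + 2) (p0 - 2 * \<delta>) (p0 + 2 * \<delta> - 1) s y"
      by (simp add: kernel_increment_def q_def q'_def algebra_simps)
  qed
qed

lemma nn_integral_even:
  fixes g :: "real \<Rightarrow> ennreal"
  assumes [measurable]: "g \<in> borel_measurable borel"
  shows "(\<integral>\<^sup>+x. g \<bar>x\<bar> \<partial>lborel) \<le> 2 * (\<integral>\<^sup>+x. g x * indicator {0..} x \<partial>lborel)"
proof -
  have "(\<integral>\<^sup>+x. g \<bar>x\<bar> \<partial>lborel) \<le> (\<integral>\<^sup>+x. g x * indicator {0..} x + g (- x) * indicator {0..} (- x) \<partial>lborel)"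
    by (intro nn_integral_mono) (auto simp: indicator_def abs_if)
  also have "\<dots> = (\<integral>\<^sup>+x. g x * indicator {0..} x \<partial>lborel) + (\<integral>\<^sup>+x. g (- x) * indicator {0..} (- x) \<partial>lborel)"
    by (rule nn_integral_add) measurable
  also have "(\<integral>\<^sup>+x. g (- x) * indicator {0..} (- x) \<partial>lborel) = (\<integral>\<^sup>+x. g x * indicator {0..} x \<partial>lborel)"
    using nn_integral_real_affine[of "\<lambda>x. g x * indicator {0..} x" "-1" 0] by simp
  finally show ?thesis by (simp add: mult_2)
qed

lemma kernel_majorant_power_integral_bounded:
  fixes R S q q' a :: real
  assumes a: "0 < a" "- 1 < q * a" "q' * a < - 1" and R: "0 < R" and S: "0 \<le> S"
  obtains B where "\<And>s. \<bar>s\<bar> \<le> S \<Longrightarrow> (\<integral>\<^sup>+y. ennreal (kernel_majorant R q q' s y powr a) \<partial>lborel) \<le> ennreal B"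
proof -
  define g where "g x = ennreal (x powr (q * a)) * indicator {0..R + S} x" for x :: real
  define h where "h x = ennreal (x powr (q' * a)) * indicator {R..} x" for x :: real
  have [measurable]: "g \<in> borel_measurable borel" "h \<in> borel_measurable borel"
    unfolding g_def h_def by measurable
  have g_fin: "(\<integral>\<^sup>+x. g \<bar>x\<bar> \<partial>lborel) < \<infinity>"
  proof -
    have "(\<integral>\<^sup>+x. g x * indicator {0..} x \<partial>lborel) = (\<integral>\<^sup>+x. ennreal (x powr (q * a)) * indicator {0..R + S} x \<partial>lborel)"
      by (intro nn_integral_cong) (auto simp: g_def indicator_def)
    also have "\<dots> = ennreal ((R + S) powr (q * a + 1) / (q * a + 1))"
      using a R S by (intro nn_integral_has_integral_lebesgue' has_integral_powr_from_0) auto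
    finally have "2 * (\<integral>\<^sup>+x. g x * indicator {0..} x \<partial>lborel) < \<infinity>" by (simp add: ennreal_mult_less_top)
    then show ?thesis by (rule order_le_less_trans[OF nn_integral_even, rotated]) simp
  qed
  have h_fin: "(\<integral>\<^sup>+x. h \<bar>x\<bar> \<partial>lborel) < \<infinity>"
  proof -
    have "(\<integral>\<^sup>+x. h x * indicator {0..} x \<partial>lborel) = (\<integral>\<^sup>+x. ennreal (x powr (q' * a)) * indicator {R..} x \<partial>lborel)"
      using R by (intro nn_integral_cong) (auto simp: h_def indicator_def)
    also have "\<dots> = ennreal (- (R powr (q' * a + 1)) / (q' * a + 1))"
      using a R by (intro nn_integral_has_integral_lebesgue' has_integral_powr_to_inf) auto
    finally have "2 * (\<integral>\<^sup>+x. h x * indicator {0..} x \<partial>lborel) < \<infinity>" by (simp add: ennreal_mult_less_top)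
    then show ?thesis by (rule order_le_less_trans[OF nn_integral_even, rotated]) simp
  qed
  define T where "T = ennreal (2 powr a) * (2 * (\<integral>\<^sup>+x. g \<bar>x\<bar> \<partial>lborel)) + (\<integral>\<^sup>+x. h \<bar>x\<bar> \<partial>lborel)"
  have T: "T < \<infinity>" using g_fin h_fin by (simp add: T_def ennreal_mult_less_top)
  have bound: "(\<integral>\<^sup>+y. ennreal (kernel_majorant R q q' s y powr a) \<partial>lborel) \<le> T" if s: "\<bar>s\<bar> \<le> S" for s
  proof -
    have "(\<integral>\<^sup>+y. ennreal (kernel_majorant R q q' s y powr a) \<partial>lborel) \<le> (\<integral>\<^sup>+y. ennreal (2 powr a) * (g \<bar>s - y\<bar> + g \<bar>y\<bar>) + h \<bar>y\<bar> \<partial>lborel)"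
    proof (rule nn_integral_mono)
      fix y
      show "ennreal (kernel_majorant R q q' s y powr a) \<le> ennreal (2 powr a) * (g \<bar>s - y\<bar> + g \<bar>y\<bar>) + h \<bar>y\<bar>"
      proof (cases "\<bar>y\<bar> \<le> R")
        case True
        define u v where "u = \<bar>s - y\<bar> powr q" and "v = \<bar>y\<bar> powr q"
        have uv: "0 \<le> u" "0 \<le> v" by (auto simp: u_def v_def)
        have "(u + v) powr a \<le> (2 * max u v) powr a" using uv a by (intro powr_mono2) auto
        also have "\<dots> = 2 powr a * max u v powr a" using uv by (simp add: powr_mult)
        also have "max u v powr a \<le> u powr a + v powr a" by (auto simp: max_def)
        finally have "(u + v) powr a \<le> 2 powr a * (u powr a + v powr a)" by (simp add: mult_left_mono)
        then have "ennreal (kernel_majorant R q q' s y powr a) \<le> ennreal (2 powr a * (u powr a + v powr a))"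
          using True by (intro ennreal_leI) (simp add: kernel_majorant_def u_def v_def)
        also have "\<dots> = ennreal (2 powr a) * (ennreal (u powr a) + ennreal (v powr a))"
          by (simp add: ennreal_mult)
        also have "\<dots> = ennreal (2 powr a) * (g \<bar>s - y\<bar> + g \<bar>y\<bar>)"
        proof -
          have "\<bar>s - y\<bar> \<le> R + S" "\<bar>y\<bar> \<le> R + S" using True s S by linarith+
          then show ?thesis by (simp add: g_def u_def v_def powr_powr indicator_def)
        qed
        finally show ?thesis by (rule order_trans) simp
      next
        case False
        then show ?thesis by (simp add: kernel_majorant_def h_def powr_powr indicator_def)
      qed
    qed
    also have "\<dots> = ennreal (2 powr a) * ((\<integral>\<^sup>+y. g \<bar>s - y\<bar> \<partial>lborel) + (\<integral>\<^sup>+y. g \<bar>y\<bar> \<partial>lborel)) + (\<integral>\<^sup>+x. h \<bar>x\<bar> \<partial>lborel)"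
      by (simp add: nn_integral_add nn_integral_cmult)
    also have "(\<integral>\<^sup>+y. g \<bar>s - y\<bar> \<partial>lborel) = (\<integral>\<^sup>+y. g \<bar>y\<bar> \<partial>lborel)"
      using nn_integral_real_affine[of "\<lambda>y. g \<bar>y\<bar>" "-1" s] by simp
    finally show ?thesis by (simp add: T_def mult_2)
  qed
  obtain B where "T = ennreal B" using T by (cases T) auto
  then show thesis using bound by (intro that[of B]) auto
qed

lemma truncated_energy_mono:
  assumes "\<And>z y. 0 < z \<Longrightarrow> \<bar>F z y\<bar> \<le> \<bar>G z y\<bar>"
  shows "truncated_energy F \<le> truncated_energy G"
  unfolding truncated_energy_def
proof (intro nn_integral_mono)
  fix y z
  show "ennreal (min 1 ((F z y)\<^sup>2)) * indicator {0<..} z \<le> ennreal (min 1 ((G z y)\<^sup>2)) * indicator {0<..} z"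
  proof (cases "0 < z")
    case True
    then have "(F z y)\<^sup>2 \<le> (G z y)\<^sup>2" using assms[OF True] by (simp add: abs_le_square_iff)
    then have "min 1 ((F z y)\<^sup>2) \<le> min 1 ((G z y)\<^sup>2)" by (rule min.mono[OF order_refl])
    then show ?thesis using True by (simp add: ennreal_leI)
  qed simp
qed

text \<open>
  For fixed \<open>y\<close> the substitution \<open>z = \<bar>k y\<bar> powr a * z'\<close> takes out the factor \<open>\<bar>k y\<bar> powr a\<close>. What remains
  does not depend on \<open>y\<close> and is finite for \<open>a < 2\<close>.
\<close>

lemma truncated_energy_power:
  assumes a: "0 < a" "a < 2"
  obtains D where "\<And>k. k \<in> borel_measurable borel \<Longrightarrow>
    truncated_energy (\<lambda>z y. z powr (- 1 / a) * k y) = ennreal D * (\<integral>\<^sup>+y. ennreal (\<bar>k y\<bar> powr a) \<partial>lborel)"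
proof -
  define T where "T = (\<integral>\<^sup>+z. ennreal (min 1 ((z powr (- 1 / a))\<^sup>2)) * indicator {0<..} z \<partial>lborel)"
  have "set_integrable lborel {0<..} (\<lambda>z. min 1 ((z powr (- 1 / a))\<^sup>2))"
  proof (rule set_integrable_two_powerI)
    show "- 1 < (0::real)" "- 2 / a < - 1" using a by (auto simp: field_simps)
    show "\<bar>min 1 ((z powr (- 1 / a))\<^sup>2)\<bar> \<le> 1 * two_power 0 (- 2 / a) z" if "0 < z" for z
    proof -
      have "(z powr (- 1 / a))\<^sup>2 = z powr (- 2 / a)" using that by (simp add: powr_power)
      then show ?thesis using that by (simp add: two_power_def min_def)
    qed
  qed simp
  then have "(\<integral>\<^sup>+z. ennreal (indicator {0<..} z *\<^sub>R min 1 ((z powr (- 1 / a))\<^sup>2)) \<partial>lborel) < \<infinity>"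
    unfolding set_integrable_def by (subst nn_integral_eq_integral) (auto simp: indicator_def)
  moreover have "(\<integral>\<^sup>+z. ennreal (indicator {0<..} z *\<^sub>R min 1 ((z powr (- 1 / a))\<^sup>2)) \<partial>lborel) = T"
    unfolding T_def by (intro nn_integral_cong) (auto simp: indicator_def)
  ultimately obtain D where D: "T = ennreal D" by (cases T) auto
  have scale: "(\<integral>\<^sup>+z. ennreal (min 1 ((z powr (- 1 / a) * k)\<^sup>2)) * indicator {0<..} z \<partial>lborel) = ennreal (\<bar>k\<bar> powr a) * T" for k :: real
  proof (cases "k = 0")
    case False
    define b where "b = \<bar>k\<bar> powr a"
    have b: "0 < b" using False by (simp add: b_def)
    have "(\<integral>\<^sup>+z. ennreal (min 1 ((z powr (- 1 / a) * k)\<^sup>2)) * indicator {0<..} z \<partial>lborel) =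
      ennreal \<bar>b\<bar> * (\<integral>\<^sup>+z. ennreal (min 1 (((0 + b * z) powr (- 1 / a) * k)\<^sup>2)) * indicator {0<..} (0 + b * z) \<partial>lborel)"
      using b by (intro nn_integral_real_affine) auto
    also have "(\<integral>\<^sup>+z. ennreal (min 1 (((0 + b * z) powr (- 1 / a) * k)\<^sup>2)) * indicator {0<..} (0 + b * z) \<partial>lborel) = T"
      unfolding T_def
    proof (intro nn_integral_cong)
      fix z :: real
      show "ennreal (min 1 (((0 + b * z) powr (- 1 / a) * k)\<^sup>2)) * indicator {0<..} (0 + b * z) = ennreal (min 1 ((z powr (- 1 / a))\<^sup>2)) * indicator {0<..} z"
      proof (cases "0 < z")
        case True
        have "(b * z) powr (- 1 / a) * \<bar>k\<bar> = \<bar>k\<bar> powr (- 1) * \<bar>k\<bar> * z powr (- 1 / a)"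
          using True a by (simp add: b_def powr_mult powr_powr)
        also have "\<dots> = z powr (- 1 / a)" using False by (simp add: powr_minus)
        finally have "((b * z) powr (- 1 / a) * \<bar>k\<bar>)\<^sup>2 = (z powr (- 1 / a))\<^sup>2" by simp
        then have "((b * z) powr (- 1 / a) * k)\<^sup>2 = (z powr (- 1 / a))\<^sup>2" by (simp add: power_mult_distrib)
        then show ?thesis using True b by simp
      next
        case False
        then show ?thesis using b by (simp add: zero_less_mult_iff)
      qed
    qed
    finally show ?thesis using b by (simp add: b_def)
  qed simp
  show thesis
  proof (rule that[of D])
    fix k :: "real \<Rightarrow> real" assume [measurable]: "k \<in> borel_measurable borel"
    have "truncated_energy (\<lambda>z y. z powr (- 1 / a) * k y) = (\<integral>\<^sup>+y. ennreal (\<bar>k y\<bar> powr a) * T \<partial>lborel)"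
      unfolding truncated_energy_def scale ..
    also have "\<dots> = (\<integral>\<^sup>+y. ennreal (\<bar>k y\<bar> powr a) \<partial>lborel) * T" by (rule nn_integral_multc) measurable
    finally show "truncated_energy (\<lambda>z y. z powr (- 1 / a) * k y) = ennreal D * (\<integral>\<^sup>+y. ennreal (\<bar>k y\<bar> powr a) \<partial>lborel)"
      by (simp add: D mult.commute)
  qed
qed

lemma truncated_energy_sum_le:
  fixes k :: "real \<Rightarrow> real"
  assumes [measurable]: "k \<in> borel_measurable borel"
  shows "truncated_energy (\<lambda>z y. (z powr e + z powr e') * k y)
    \<le> 4 * (truncated_energy (\<lambda>z y. z powr e * k y) + truncated_energy (\<lambda>z y. z powr e' * k y))"
proof -
  let ?g = "\<lambda>e y z. ennreal (min 1 ((z powr e * k y)\<^sup>2)) * indicator {0<..} z"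
  have m: "(\<lambda>p. ?g e (fst p) (snd p)) \<in> borel_measurable (lborel \<Otimes>\<^sub>M lborel)" for e by measurable
  have m': "(\<lambda>y. \<integral>\<^sup>+z. ?g e y z \<partial>lborel) \<in> borel_measurable lborel" for e
    by (intro lborel.borel_measurable_nn_integral) (use m in \<open>simp add: split_beta'\<close>)
  have "truncated_energy (\<lambda>z y. (z powr e + z powr e') * k y) \<le> (\<integral>\<^sup>+y. \<integral>\<^sup>+z. 4 * (?g e y z + ?g e' y z) \<partial>lborel \<partial>lborel)"
    unfolding truncated_energy_def
  proof (intro nn_integral_mono)
    fix y z
    have sq: "min 1 ((u + v)\<^sup>2) \<le> 4 * (min 1 (u\<^sup>2) + min 1 (v\<^sup>2))" for u v :: real
    proof -
      have "(u + v)\<^sup>2 \<le> 2 * u\<^sup>2 + 2 * v\<^sup>2"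
        using sum_squares_bound[of u v] by (simp add: power2_sum)
      then show ?thesis unfolding min_def by (smt (verit) zero_le_power2)
    qed
    have "ennreal (min 1 (((z powr e + z powr e') * k y)\<^sup>2)) \<le> ennreal (4 * (min 1 ((z powr e * k y)\<^sup>2) + min 1 ((z powr e' * k y)\<^sup>2)))"
      unfolding distrib_right by (intro ennreal_leI sq)
    also have "\<dots> = 4 * (ennreal (min 1 ((z powr e * k y)\<^sup>2)) + ennreal (min 1 ((z powr e' * k y)\<^sup>2)))"
      by (simp add: ennreal_mult')
    finally show "ennreal (min 1 (((z powr e + z powr e') * k y)\<^sup>2)) * indicator {0<..} z \<le> 4 * (?g e y z + ?g e' y z)"
      by (auto simp: indicator_def)
  qed
  also have "\<dots> = (\<integral>\<^sup>+y. 4 * ((\<integral>\<^sup>+z. ?g e y z \<partial>lborel) + (\<integral>\<^sup>+z. ?g e' y z \<partial>lborel)) \<partial>lborel)"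
    by (simp add: nn_integral_cmult nn_integral_add)
  also have "\<dots> = 4 * ((\<integral>\<^sup>+y. \<integral>\<^sup>+z. ?g e y z \<partial>lborel \<partial>lborel) + (\<integral>\<^sup>+y. \<integral>\<^sup>+z. ?g e' y z \<partial>lborel \<partial>lborel))"
    using m' by (subst nn_integral_cmult) (auto simp: nn_integral_add intro!: borel_measurable_add)
  finally show ?thesis by (simp add: truncated_energy_def)
qed

text \<open>
  The integrand of the series at time \<open>s\<close>, with scale \<open>\<kappa>\<close>, \<open>\<beta> = 1 / \<alpha>\<close> and \<open>p = H - 1 / \<alpha>\<close>, as a function of
  the level \<open>z\<close> and the mark \<open>y\<close>.
\<close>

definition fkl_kernel :: "real \<Rightarrow> real \<Rightarrow> real \<Rightarrow> real \<Rightarrow> real \<Rightarrow> real \<Rightarrow> real" where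
  "fkl_kernel \<kappa> \<beta> p s z y = \<kappa> * (z powr (- \<beta>) * kernel_increment p s y)"

lemma fkl_kernel_measurable:
  "case_prod (fkl_kernel \<kappa> \<beta> p s) \<in> borel_measurable (borel \<Otimes>\<^sub>M borel)"
  unfolding fkl_kernel_def split_beta' by measurable

text \<open>
  At the singularities \<open>p * \<alpha> = H * \<alpha> - 1 > -1\<close>, and at infinity \<open>(p - 1) * \<alpha> < -1\<close> because \<open>H < 1\<close>.
\<close>

lemma kernel_increment_stable_integrand:
  fixes \<alpha> H s :: real
  assumes \<alpha>: "0 < \<alpha>" "\<alpha> < 2" and H: "0 < H" "H < 1"
  shows "kernel_increment (H - 1 / \<alpha>) s \<in> stable_integrand \<alpha>"
proof -
  define p0 \<delta> where "p0 = H - 1 / \<alpha>" and "\<delta> = min H (1 - H) / 4"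
  have \<delta>: "0 < \<delta>" "2 * \<delta> < H" "2 * \<delta> < 1 - H" using H by (auto simp: \<delta>_def min_def)
  have \<alpha>2: "1 / 2 < 1 / \<alpha>" using \<alpha> by (simp add: field_simps)
  have "p0 + 2 * \<delta> - 1 \<le> 0" using \<delta> \<alpha>2 by (simp add: p0_def)
  then obtain C where C: "0 \<le> C" "\<And>y. \<bar>kernel_increment p0 s y\<bar> \<le> C * kernel_majorant (2 * \<bar>s\<bar> + 2) (p0 - 2 * \<delta>) (p0 + 2 * \<delta> - 1) s y"
    using kernel_bounds[OF \<delta>(1) abs_ge_zero[of s], of p0] \<delta>(1) by (metis abs_0 diff_self less_imp_le order_refl)
  have e: "- 1 < (p0 - 2 * \<delta>) * \<alpha>" "(p0 + 2 * \<delta> - 1) * \<alpha> < - 1"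
  proof -
    have "(p0 - 2 * \<delta>) * \<alpha> = (H - 2 * \<delta>) * \<alpha> - 1" "(p0 + 2 * \<delta> - 1) * \<alpha> = - ((1 - H - 2 * \<delta>) * \<alpha>) - 1"
      using \<alpha> by (simp_all add: p0_def field_simps)
    moreover have "0 < (H - 2 * \<delta>) * \<alpha>" "0 < (1 - H - 2 * \<delta>) * \<alpha>" using \<delta> \<alpha> by auto
    ultimately show "- 1 < (p0 - 2 * \<delta>) * \<alpha>" "(p0 + 2 * \<delta> - 1) * \<alpha> < - 1" by linarith+
  qed
  define Q where "Q = kernel_majorant (2 * \<bar>s\<bar> + 2) (p0 - 2 * \<delta>) (p0 + 2 * \<delta> - 1) s"
  obtain B where B: "(\<integral>\<^sup>+y. ennreal (Q y powr \<alpha>) \<partial>lborel) \<le> ennreal B"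
    using kernel_majorant_power_integral_bounded[OF \<alpha>(1) e, of "2 * \<bar>s\<bar> + 2" "\<bar>s\<bar>"] unfolding Q_def
    by (metis abs_ge_zero add_nonneg_pos mult_nonneg_nonneg order_refl zero_le_numeral zero_less_numeral)
  have [measurable]: "Q \<in> borel_measurable borel" unfolding Q_def by simp
  have intQ: "integrable lborel (\<lambda>y. Q y powr \<alpha>)"
    by (rule integrableI_nonneg) (use B in \<open>auto intro: order_le_less_trans\<close>)
  have "integrable lborel (\<lambda>y. \<bar>kernel_increment p0 s y\<bar> powr \<alpha>)"
  proof (rule Bochner_Integration.integrable_bound[of _ "\<lambda>y. C powr \<alpha> * Q y powr \<alpha>"])
    show "AE y in lborel. norm (\<bar>kernel_increment p0 s y\<bar> powr \<alpha>) \<le> norm (C powr \<alpha> * Q y powr \<alpha>)"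
    proof (rule AE_I2)
      fix y
      have "\<bar>kernel_increment p0 s y\<bar> powr \<alpha> \<le> (C * Q y) powr \<alpha>"
        using C \<alpha> by (intro powr_mono2) (auto simp: Q_def)
      then show "norm (\<bar>kernel_increment p0 s y\<bar> powr \<alpha>) \<le> norm (C powr \<alpha> * Q y powr \<alpha>)"
        using C kernel_majorant_nonneg by (simp add: powr_mult Q_def)
    qed
  qed (use intQ in auto)
  then show ?thesis by (simp add: stable_integrand_def p0_def)
qed

lemma stable_integrand_energy:
  fixes \<kappa> :: real
  assumes \<alpha>: "0 < \<alpha>" "\<alpha> < 2" and f: "f \<in> stable_integrand \<alpha>"
  shows "truncated_energy (\<lambda>z y. \<kappa> * (z powr (- (1 / \<alpha>)) * f y)) < \<infinity>"
    and "(\<integral>\<^sup>+y. \<integral>\<^sup>+z. ennreal (1 - cos (\<kappa> * (z powr (- (1 / \<alpha>)) * f y))) * indicator {0<..} z \<partial>lborel \<partial>lborel)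
      = ennreal (\<bar>\<kappa>\<bar> powr \<alpha> / stable_const \<alpha> * (\<integral>y. \<bar>f y\<bar> powr \<alpha> \<partial>lborel))"
proof -
  have [measurable]: "f \<in> borel_measurable borel" and int: "integrable lborel (\<lambda>y. \<bar>f y\<bar> powr \<alpha>)"
    using f by (auto simp: stable_integrand_def)
  have nn: "(\<integral>\<^sup>+y. ennreal (\<bar>f y\<bar> powr \<alpha>) \<partial>lborel) = ennreal (\<integral>y. \<bar>f y\<bar> powr \<alpha> \<partial>lborel)"
    using int by (intro nn_integral_eq_integral) auto
  have nn\<kappa>: "(\<integral>\<^sup>+y. ennreal (\<bar>\<kappa> * f y\<bar> powr \<alpha>) \<partial>lborel) = ennreal (\<bar>\<kappa>\<bar> powr \<alpha> * (\<integral>y. \<bar>f y\<bar> powr \<alpha> \<partial>lborel))"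
    using int by (simp add: abs_mult powr_mult ennreal_mult nn_integral_cmult nn)
  obtain D where D: "\<And>k. k \<in> borel_measurable borel \<Longrightarrow>
    truncated_energy (\<lambda>z y. z powr (- 1 / \<alpha>) * k y) = ennreal D * (\<integral>\<^sup>+y. ennreal (\<bar>k y\<bar> powr \<alpha>) \<partial>lborel)"
    using truncated_energy_power[OF \<alpha>] by blast
  show "truncated_energy (\<lambda>z y. \<kappa> * (z powr (- (1 / \<alpha>)) * f y)) < \<infinity>"
    using D[of "\<lambda>y. \<kappa> * f y"] by (simp add: nn\<kappa> ennreal_mult_less_top mult.left_commute)
  have sc: "0 < stable_const \<alpha>" using \<alpha> levy_moment_pos stable_const_eq by simp
  have "(\<integral>\<^sup>+z. ennreal (1 - cos (\<kappa> * (z powr (- (1 / \<alpha>)) * f y))) * indicator {0<..} z \<partial>lborel) = ennreal (\<bar>\<kappa> * f y\<bar> powr \<alpha> / stable_const \<alpha>)" for y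
  proof -
    have "cos (\<kappa> * (z powr (- (1 / \<alpha>)) * f y)) = cos (\<bar>\<kappa> * f y\<bar> * z powr (- 1 / \<alpha>))" for z
      using cos_abs_real[of "\<kappa> * (z powr (- (1 / \<alpha>)) * f y)"] by (simp add: abs_mult mult_ac)
    then show ?thesis using nn_integral_one_minus_cos_power[OF \<alpha>, of "\<bar>\<kappa> * f y\<bar>"] by simp
  qed
  then have "(\<integral>\<^sup>+y. \<integral>\<^sup>+z. ennreal (1 - cos (\<kappa> * (z powr (- (1 / \<alpha>)) * f y))) * indicator {0<..} z \<partial>lborel \<partial>lborel)
    = (\<integral>\<^sup>+y. ennreal (1 / stable_const \<alpha>) * ennreal (\<bar>\<kappa> * f y\<bar> powr \<alpha>) \<partial>lborel)"
    using sc by (simp add: ennreal_mult[symmetric])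
  also have "\<dots> = ennreal (1 / stable_const \<alpha>) * ennreal (\<bar>\<kappa>\<bar> powr \<alpha> * (\<integral>y. \<bar>f y\<bar> powr \<alpha> \<partial>lborel))"
    by (subst nn_integral_cmult) (auto simp: nn\<kappa>)
  also have "\<dots> = ennreal (\<bar>\<kappa>\<bar> powr \<alpha> / stable_const \<alpha> * (\<integral>y. \<bar>f y\<bar> powr \<alpha> \<partial>lborel))"
    using sc by (subst ennreal_mult[symmetric]) auto
  finally show "(\<integral>\<^sup>+y. \<integral>\<^sup>+z. ennreal (1 - cos (\<kappa> * (z powr (- (1 / \<alpha>)) * f y))) * indicator {0<..} z \<partial>lborel \<partial>lborel)
      = ennreal (\<bar>\<kappa>\<bar> powr \<alpha> / stable_const \<alpha> * (\<integral>y. \<bar>f y\<bar> powr \<alpha> \<partial>lborel))" .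
qed

text \<open>
  The difference of the kernels is bounded by the distance of the parameters times
  \<open>z powr (- \<beta>1) + z powr (- \<beta>2)\<close> times \<open>kernel_majorant\<close>, where \<open>\<beta>1\<close> and \<open>\<beta>2\<close> lie slightly above and below
  \<open>\<beta>0\<close>. The energies of the two products are explicit by \<open>truncated_energy_power\<close>, with the stability
  indices \<open>a1 = 1 / \<beta>1\<close> and \<open>a2 = 1 / \<beta>2\<close>.
\<close>

lemma fkl_kernel_perturbation:
  fixes \<kappa>' \<beta>0 H0 S :: real
  assumes \<beta>0: "1 / 2 < \<beta>0" and H0: "0 < H0" "H0 < 1" and S: "0 \<le> S"
  obtains \<delta> a1 a2 B where "0 < \<delta>" "0 < a1" "0 < a2"
    "\<And>\<kappa> \<beta> p s c. \<bar>\<beta> - \<beta>0\<bar> \<le> \<delta> \<Longrightarrow> \<bar>p - (H0 - \<beta>0)\<bar> \<le> \<delta> \<Longrightarrow> \<bar>s\<bar> \<le> S \<Longrightarrow> 0 \<le> c \<Longrightarrow>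
      truncated_energy (\<lambda>z y. c * (fkl_kernel \<kappa> \<beta> p s z y - fkl_kernel \<kappa>' \<beta>0 (H0 - \<beta>0) s z y))
        \<le> ennreal (B * ((c * (\<bar>\<kappa> - \<kappa>'\<bar> + \<bar>\<beta> - \<beta>0\<bar> + \<bar>p - (H0 - \<beta>0)\<bar>)) powr a1 +
                       (c * (\<bar>\<kappa> - \<kappa>'\<bar> + \<bar>\<beta> - \<beta>0\<bar> + \<bar>p - (H0 - \<beta>0)\<bar>)) powr a2))"
proof -
  define p0 where "p0 = H0 - \<beta>0"
  \<comment> \<open>\<open>4 * \<delta> < H0\<close> gives \<open>q * a2 > -1\<close>, \<open>4 * \<delta> < 1 - H0\<close> gives \<open>q' * a1 < -1\<close>, and
    \<open>2 * \<delta> < \<beta>0 - 1 / 2\<close> gives \<open>a2 < 2\<close>\<close>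
  define \<delta> where "\<delta> = min (min H0 (1 - H0)) (\<beta>0 - 1 / 2) / 5"
  have \<delta>: "0 < \<delta>" "4 * \<delta> < H0" "4 * \<delta> < 1 - H0" "2 * \<delta> < \<beta>0 - 1 / 2"
    using H0 \<beta>0 by (auto simp: \<delta>_def min_def)
  define q q' where "q = p0 - 2 * \<delta>" and "q' = p0 + 2 * \<delta> - 1"
  define \<beta>1 \<beta>2 where "\<beta>1 = \<beta>0 + 2 * \<delta>" and "\<beta>2 = \<beta>0 - 2 * \<delta>"
  define a1 a2 where "a1 = 1 / \<beta>1" and "a2 = 1 / \<beta>2"
  have \<beta>pos: "1 / 2 < \<beta>1" "1 / 2 < \<beta>2" using \<delta> \<beta>0 by (auto simp: \<beta>1_def \<beta>2_def)
  then have a: "0 < a1" "a1 < 2" "0 < a2" "a2 < 2" by (auto simp: a1_def a2_def field_simps)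
  have inv: "- 1 / a1 = - \<beta>1" "- 1 / a2 = - \<beta>2" using \<beta>pos by (auto simp: a1_def a2_def)
  have ex: "- 1 < q * a1" "q' * a1 < - 1" "- 1 < q * a2" "q' * a2 < - 1"
    using \<beta>pos \<delta> by (auto simp: a1_def a2_def q_def q'_def p0_def \<beta>1_def \<beta>2_def field_simps)
  have q'0: "p0 + 2 * \<delta> - 1 \<le> 0" using \<delta> \<beta>0 by (simp add: p0_def)
  obtain C where C: "0 \<le> C"
    "\<And>p s y. \<bar>p - p0\<bar> \<le> \<delta> \<Longrightarrow> \<bar>s\<bar> \<le> S \<Longrightarrow> \<bar>kernel_increment p s y\<bar> \<le> C * kernel_majorant (2 * S + 2) q q' s y"
    "\<And>p p' s y. \<bar>p - p0\<bar> \<le> \<delta> \<Longrightarrow> \<bar>p' - p0\<bar> \<le> \<delta> \<Longrightarrow> \<bar>s\<bar> \<le> S \<Longrightarrow>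
      \<bar>kernel_increment p s y - kernel_increment p' s y\<bar> \<le> C * \<bar>p - p'\<bar> * kernel_majorant (2 * S + 2) q q' s y"
    using kernel_bounds[OF \<delta>(1) S q'0] unfolding q_def q'_def by metis
  have R: "0 < 2 * S + 2" using S by simp
  obtain B1 where B1: "\<And>s. \<bar>s\<bar> \<le> S \<Longrightarrow> (\<integral>\<^sup>+y. ennreal (kernel_majorant (2 * S + 2) q q' s y powr a1) \<partial>lborel) \<le> ennreal B1"
    using kernel_majorant_power_integral_bounded[OF a(1) ex(1,2) R S] by metis
  obtain B2 where B2: "\<And>s. \<bar>s\<bar> \<le> S \<Longrightarrow> (\<integral>\<^sup>+y. ennreal (kernel_majorant (2 * S + 2) q q' s y powr a2) \<partial>lborel) \<le> ennreal B2"
    using kernel_majorant_power_integral_bounded[OF a(3) ex(3,4) R S] by metis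
  obtain D1 where D1: "\<And>k. k \<in> borel_measurable borel \<Longrightarrow>
    truncated_energy (\<lambda>z y. z powr (- 1 / a1) * k y) = ennreal D1 * (\<integral>\<^sup>+y. ennreal (\<bar>k y\<bar> powr a1) \<partial>lborel)"
    using truncated_energy_power[OF a(1,2)] by blast
  obtain D2 where D2: "\<And>k. k \<in> borel_measurable borel \<Longrightarrow>
    truncated_energy (\<lambda>z y. z powr (- 1 / a2) * k y) = ennreal D2 * (\<integral>\<^sup>+y. ennreal (\<bar>k y\<bar> powr a2) \<partial>lborel)"
    using truncated_energy_power[OF a(3,4)] by blast
  define C' where "C' = C * (1 + \<bar>\<kappa>'\<bar> * (4 / \<delta>) + \<bar>\<kappa>'\<bar>)"
  have C': "0 \<le> C'" using C(1) \<delta> by (simp add: C'_def)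
  define B where "B = 4 * (max 0 D1 * C' powr a1 * max 0 B1 + max 0 D2 * C' powr a2 * max 0 B2)"
  show thesis
  proof (rule that[OF \<delta>(1) a(1,3), of B])
    fix \<kappa> \<beta> p s c :: real
    assume \<beta>: "\<bar>\<beta> - \<beta>0\<bar> \<le> \<delta>" and p: "\<bar>p - (H0 - \<beta>0)\<bar> \<le> \<delta>" and s: "\<bar>s\<bar> \<le> S" and c: "0 \<le> c"
    define d where "d = \<bar>\<kappa> - \<kappa>'\<bar> + \<bar>\<beta> - \<beta>0\<bar> + \<bar>p - (H0 - \<beta>0)\<bar>"
    have d: "0 \<le> d" "\<bar>\<kappa> - \<kappa>'\<bar> \<le> d" "\<bar>\<beta> - \<beta>0\<bar> \<le> d" "\<bar>p - p0\<bar> \<le> d" by (auto simp: d_def p0_def)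
    define Q where "Q = kernel_majorant (2 * S + 2) q q' s"
    have Q0: "0 \<le> Q y" for y by (simp add: Q_def kernel_majorant_nonneg)
    have [measurable]: "Q \<in> borel_measurable borel" unfolding Q_def by simp
    define K where "K y = c * d * C' * Q y" for y
    have Km: "K \<in> borel_measurable borel" unfolding K_def by measurable
    have bound: "\<bar>c * (fkl_kernel \<kappa> \<beta> p s z y - fkl_kernel \<kappa>' \<beta>0 p0 s z y)\<bar> \<le> \<bar>(z powr (- \<beta>1) + z powr (- \<beta>2)) * K y\<bar>"
      if z: "0 < z" for z y
    proof -
      define w where "w = z powr (- \<beta>1) + z powr (- \<beta>2)"
      have w0: "0 \<le> w" by (simp add: w_def)
      have zw: "z powr (- e) \<le> w" if e: "\<beta>2 \<le> e" "e \<le> \<beta>1" for e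
      proof (cases "z \<le> 1")
        case True
        then have "z powr (- e) \<le> z powr (- \<beta>1)" using z e by (intro powr_mono') auto
        then show ?thesis by (simp add: w_def add_increasing2)
      next
        case False
        then have "z powr (- e) \<le> z powr (- \<beta>2)" using z e by (intro powr_mono) auto
        then show ?thesis by (simp add: w_def add_increasing)
      qed
      have lnz: "\<bar>ln z\<bar> * z powr (- e) \<le> 2 / \<delta> * w" if e: "\<bar>e - \<beta>0\<bar> \<le> \<delta>" for e
      proof -
        have "\<bar>ln z\<bar> * z powr (- e) \<le> (z powr \<delta> + z powr (- \<delta>)) / \<delta> * z powr (- e)"
          by (intro mult_right_mono abs_ln_le_powr z \<delta>) simp
        also have "\<dots> = (z powr (- (e - \<delta>)) + z powr (- (e + \<delta>))) / \<delta>"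
        proof -
          have "z powr \<delta> * z powr (- e) = z powr (- (e - \<delta>))" "z powr (- \<delta>) * z powr (- e) = z powr (- (e + \<delta>))"
            unfolding powr_add[symmetric] by (rule arg_cong[where f = "\<lambda>y. z powr y"]; simp)+
          then show ?thesis by (simp add: distrib_right)
        qed
        also have "\<dots> \<le> (w + w) / \<delta>"
        proof (intro divide_right_mono add_mono zw)
          show "\<beta>2 \<le> e - \<delta>" "e - \<delta> \<le> \<beta>1" "\<beta>2 \<le> e + \<delta>" "e + \<delta> \<le> \<beta>1"
            using e \<delta>(1) unfolding \<beta>1_def \<beta>2_def abs_le_iff by linarith+
        qed (use \<delta> in simp)
        finally show ?thesis by simp
      qed
      have dz: "\<bar>z powr (- \<beta>) - z powr (- \<beta>0)\<bar> \<le> d * (4 / \<delta> * w)"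
      proof -
        have "\<bar>z powr (- \<beta>) - z powr (- \<beta>0)\<bar> \<le> \<bar>(- \<beta>) - (- \<beta>0)\<bar> * \<bar>ln z\<bar> * (z powr (- \<beta>) + z powr (- \<beta>0))"
          by (rule powr_exponent_diff_le[OF z])
        also have "\<dots> = \<bar>\<beta> - \<beta>0\<bar> * (\<bar>ln z\<bar> * z powr (- \<beta>) + \<bar>ln z\<bar> * z powr (- \<beta>0))"
          by (simp add: algebra_simps abs_minus_commute)
        also have "\<dots> \<le> d * (2 / \<delta> * w + 2 / \<delta> * w)"
        proof (rule mult_mono[OF d(3) add_mono[OF lnz[OF \<beta>] lnz[of \<beta>0]]])
          show "\<bar>\<beta>0 - \<beta>0\<bar> \<le> \<delta>" using \<delta> by simp
        qed (use d in auto)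
        finally show ?thesis by (simp add: field_simps)
      qed
      have zb: "z powr (- \<beta>) \<le> w" "z powr (- \<beta>0) \<le> w"
        using \<beta> \<delta>(1) unfolding abs_le_iff by (intro zw; simp add: \<beta>1_def \<beta>2_def)+
      have ki: "\<bar>kernel_increment p s y\<bar> \<le> C * Q y" using C(2)[of p s y] p s by (simp add: p0_def Q_def)
      have dki: "\<bar>kernel_increment p s y - kernel_increment p0 s y\<bar> \<le> d * (C * Q y)"
      proof -
        have "\<bar>kernel_increment p s y - kernel_increment p0 s y\<bar> \<le> \<bar>p - p0\<bar> * (C * Q y)"
          using C(3)[of p p0 s y] p s \<delta>(1) by (simp add: p0_def Q_def mult_ac)
        also have "\<dots> \<le> d * (C * Q y)" using d C(1) Q0 by (intro mult_right_mono) auto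
        finally show ?thesis .
      qed
      define P where "P = z powr (- \<beta>) * kernel_increment p s y"
      have P: "\<bar>P\<bar> \<le> w * (C * Q y)" unfolding P_def abs_mult using zb ki w0 by (intro mult_mono) auto
      have "fkl_kernel \<kappa> \<beta> p s z y - fkl_kernel \<kappa>' \<beta>0 p0 s z y =
        (\<kappa> - \<kappa>') * P + (\<kappa>' * ((z powr (- \<beta>) - z powr (- \<beta>0)) * kernel_increment p s y)
          + \<kappa>' * (z powr (- \<beta>0) * (kernel_increment p s y - kernel_increment p0 s y)))"
        by (simp add: fkl_kernel_def P_def algebra_simps)
      then have "\<bar>fkl_kernel \<kappa> \<beta> p s z y - fkl_kernel \<kappa>' \<beta>0 p0 s z y\<bar> \<le>
        \<bar>(\<kappa> - \<kappa>') * P\<bar> + (\<bar>\<kappa>' * ((z powr (- \<beta>) - z powr (- \<beta>0)) * kernel_increment p s y)\<bar>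
          + \<bar>\<kappa>' * (z powr (- \<beta>0) * (kernel_increment p s y - kernel_increment p0 s y))\<bar>)"
        by linarith
      also have "\<dots> \<le> d * (w * (C * Q y)) + (\<bar>\<kappa>'\<bar> * ((d * (4 / \<delta> * w)) * (C * Q y)) + \<bar>\<kappa>'\<bar> * (w * (d * (C * Q y))))"
      proof (intro add_mono)
        have CQ: "0 \<le> C * Q y" using C(1) Q0 by simp
        show "\<bar>(\<kappa> - \<kappa>') * P\<bar> \<le> d * (w * (C * Q y))"
          unfolding abs_mult by (rule mult_mono[OF d(2) P d(1)]) simp
        have "\<bar>z powr (- \<beta>) - z powr (- \<beta>0)\<bar> * \<bar>kernel_increment p s y\<bar> \<le> (d * (4 / \<delta> * w)) * (C * Q y)"
          by (rule mult_mono[OF dz ki]) (use d(1) w0 \<delta>(1) in auto)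
        then show "\<bar>\<kappa>' * ((z powr (- \<beta>) - z powr (- \<beta>0)) * kernel_increment p s y)\<bar> \<le> \<bar>\<kappa>'\<bar> * ((d * (4 / \<delta> * w)) * (C * Q y))"
          unfolding abs_mult by (rule mult_left_mono) simp
        have "\<bar>z powr (- \<beta>0)\<bar> * \<bar>kernel_increment p s y - kernel_increment p0 s y\<bar> \<le> w * (d * (C * Q y))"
          by (rule mult_mono[OF _ dki w0]) (use zb in auto)
        then show "\<bar>\<kappa>' * (z powr (- \<beta>0) * (kernel_increment p s y - kernel_increment p0 s y))\<bar> \<le> \<bar>\<kappa>'\<bar> * (w * (d * (C * Q y)))"
          unfolding abs_mult by (rule mult_left_mono) simp
      qed
      also have "\<dots> = w * (d * C' * Q y)" by (simp add: C'_def algebra_simps)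
      finally have "c * \<bar>fkl_kernel \<kappa> \<beta> p s z y - fkl_kernel \<kappa>' \<beta>0 p0 s z y\<bar> \<le> c * (w * (d * C' * Q y))"
        using c by (rule mult_left_mono)
      then have "\<bar>c * (fkl_kernel \<kappa> \<beta> p s z y - fkl_kernel \<kappa>' \<beta>0 p0 s z y)\<bar> \<le> w * K y"
        using c by (simp add: abs_mult K_def mult_ac)
      then show ?thesis unfolding w_def by linarith
    qed
    have K_int: "(\<integral>\<^sup>+y. ennreal (\<bar>K y\<bar> powr a) \<partial>lborel) \<le> ennreal ((c * d) powr a * C' powr a * max 0 Bj)"
      if Bj: "(\<integral>\<^sup>+y. ennreal (Q y powr a) \<partial>lborel) \<le> ennreal Bj" for a Bj
    proof -
      have "(\<integral>\<^sup>+y. ennreal (\<bar>K y\<bar> powr a) \<partial>lborel) = (\<integral>\<^sup>+y. ennreal ((c * d) powr a * C' powr a) * ennreal (Q y powr a) \<partial>lborel)"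
        using c d C' Q0 by (intro nn_integral_cong) (simp add: K_def powr_mult abs_mult ennreal_mult[symmetric])
      also have "\<dots> = ennreal ((c * d) powr a * C' powr a) * (\<integral>\<^sup>+y. ennreal (Q y powr a) \<partial>lborel)"
        by (rule nn_integral_cmult) measurable
      also have "\<dots> \<le> ennreal ((c * d) powr a * C' powr a) * ennreal (max 0 Bj)"
        using Bj by (intro mult_left_mono) (auto simp: max_def ennreal_neg split: if_splits)
      also have "\<dots> = ennreal ((c * d) powr a * C' powr a * max 0 Bj)"
        by (rule ennreal_mult[symmetric]) auto
      finally show ?thesis .
    qed
    have "truncated_energy (\<lambda>z y. c * (fkl_kernel \<kappa> \<beta> p s z y - fkl_kernel \<kappa>' \<beta>0 p0 s z y)) \<le> truncated_energy (\<lambda>z y. (z powr (- \<beta>1) + z powr (- \<beta>2)) * K y)"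
      by (rule truncated_energy_mono) (rule bound)
    also have "\<dots> \<le> 4 * (truncated_energy (\<lambda>z y. z powr (- \<beta>1) * K y) + truncated_energy (\<lambda>z y. z powr (- \<beta>2) * K y))"
      by (rule truncated_energy_sum_le[OF Km])
    also have "\<dots> = 4 * (ennreal D1 * (\<integral>\<^sup>+y. ennreal (\<bar>K y\<bar> powr a1) \<partial>lborel) + ennreal D2 * (\<integral>\<^sup>+y. ennreal (\<bar>K y\<bar> powr a2) \<partial>lborel))"
      using D1[OF Km] D2[OF Km] by (simp only: inv)
    also have "\<dots> \<le> 4 * (ennreal (max 0 D1) * ennreal ((c * d) powr a1 * C' powr a1 * max 0 B1) + ennreal (max 0 D2) * ennreal ((c * d) powr a2 * C' powr a2 * max 0 B2))"
      by (intro mult_left_mono[where c = 4] add_mono mult_mono K_int B1[OF s, folded Q_def] B2[OF s, folded Q_def]) (auto intro: ennreal_leI)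
    also have "\<dots> = ennreal (4 * (max 0 D1 * ((c * d) powr a1 * C' powr a1 * max 0 B1) + max 0 D2 * ((c * d) powr a2 * C' powr a2 * max 0 B2)))"
      by (simp add: ennreal_mult)
    also have "\<dots> \<le> ennreal (B * ((c * d) powr a1 + (c * d) powr a2))"
    proof (rule ennreal_leI)
      define X1 X2 where "X1 = max 0 D1 * C' powr a1 * max 0 B1" and "X2 = max 0 D2 * C' powr a2 * max 0 B2"
      have X: "0 \<le> X1" "0 \<le> X2" by (auto simp: X1_def X2_def)
      have "4 * (max 0 D1 * ((c * d) powr a1 * C' powr a1 * max 0 B1) + max 0 D2 * ((c * d) powr a2 * C' powr a2 * max 0 B2)) = 4 * (X1 * (c * d) powr a1 + X2 * (c * d) powr a2)"
        by (simp add: X1_def X2_def mult_ac)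
      also have "\<dots> \<le> 4 * ((X1 + X2) * (c * d) powr a1 + (X1 + X2) * (c * d) powr a2)"
        using X by (intro mult_left_mono add_mono mult_right_mono) auto
      also have "\<dots> = B * ((c * d) powr a1 + (c * d) powr a2)" by (simp add: B_def X1_def X2_def algebra_simps)
      finally show "4 * (max 0 D1 * ((c * d) powr a1 * C' powr a1 * max 0 B1) + max 0 D2 * ((c * d) powr a2 * C' powr a2 * max 0 B2)) \<le> B * ((c * d) powr a1 + (c * d) powr a2)" .
    qed
    finally show "truncated_energy (\<lambda>z y. c * (fkl_kernel \<kappa> \<beta> p s z y - fkl_kernel \<kappa>' \<beta>0 (H0 - \<beta>0) s z y))
        \<le> ennreal (B * ((c * (\<bar>\<kappa> - \<kappa>'\<bar> + \<bar>\<beta> - \<beta>0\<bar> + \<bar>p - (H0 - \<beta>0)\<bar>)) powr a1 +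
                       (c * (\<bar>\<kappa> - \<kappa>'\<bar> + \<bar>\<beta> - \<beta>0\<bar> + \<bar>p - (H0 - \<beta>0)\<bar>)) powr a2))"
      unfolding d_def p0_def .
  qed
qed

section \<open>Freezing the parameters and localisability\<close>

text \<open>
  All that the localisation uses of the differentiability of the parameters at the point \<open>u\<close>.
\<close>

definition lipschitz_at :: "(real \<Rightarrow> real) \<Rightarrow> real \<Rightarrow> bool" where
  "lipschitz_at f u \<longleftrightarrow> (\<exists>L\<ge>0. \<forall>\<^sub>F s in nhds u. \<bar>f s - f u\<bar> \<le> L * \<bar>s - u\<bar>)"

lemma lipschitz_at_tendsto:
  assumes "lipschitz_at f u"
  shows "(f \<longlongrightarrow> f u) (nhds u)"
proof -
  obtain L where L: "\<forall>\<^sub>F s in nhds u. \<bar>f s - f u\<bar> \<le> L * \<bar>s - u\<bar>"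
    using assms by (auto simp: lipschitz_at_def)
  have "((\<lambda>s. L * \<bar>s - u\<bar>) \<longlongrightarrow> L * \<bar>u - u\<bar>) (nhds u)"
    by (intro tendsto_intros filterlim_ident)
  then have "((\<lambda>s. L * \<bar>s - u\<bar>) \<longlongrightarrow> 0) (nhds u)" by simp
  then have "((\<lambda>s. f s - f u) \<longlongrightarrow> 0) (nhds u)"
    by (rule Lim_null_comparison[rotated]) (use L in simp)
  then show ?thesis by (simp add: LIM_zero_iff)
qed

lemma DERIV_imp_lipschitz_at:
  assumes "DERIV f u :> D"
  shows "lipschitz_at f u"
  unfolding lipschitz_at_def
proof (intro exI[of _ "\<bar>D\<bar> + 1"] conjI)
  have "((\<lambda>s. \<bar>(f s - f u) / (s - u)\<bar>) \<longlongrightarrow> \<bar>D\<bar>) (at u)"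
    using assms by (intro tendsto_rabs) (simp add: has_field_derivative_iff)
  then have "\<forall>\<^sub>F s in at u. \<bar>(f s - f u) / (s - u)\<bar> < \<bar>D\<bar> + 1" by (rule order_tendstoD) simp
  then show "\<forall>\<^sub>F s in nhds u. \<bar>f s - f u\<bar> \<le> (\<bar>D\<bar> + 1) * \<bar>s - u\<bar>"
    unfolding eventually_at_filter
    by eventually_elim (auto simp: abs_divide divide_less_eq dest: less_imp_le split: if_splits)
qed simp

lemma lipschitz_at_compose:
  assumes g: "lipschitz_at g u" and f: "lipschitz_at f (g u)"
  shows "lipschitz_at (\<lambda>s. f (g s)) u"
proof -
  obtain L where L: "0 \<le> L" "\<forall>\<^sub>F s in nhds u. \<bar>g s - g u\<bar> \<le> L * \<bar>s - u\<bar>" using g by (auto simp: lipschitz_at_def)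
  obtain K where K: "0 \<le> K" "\<forall>\<^sub>F x in nhds (g u). \<bar>f x - f (g u)\<bar> \<le> K * \<bar>x - g u\<bar>" using f by (auto simp: lipschitz_at_def)
  have "\<forall>\<^sub>F s in nhds u. \<bar>f (g s) - f (g u)\<bar> \<le> K * \<bar>g s - g u\<bar>"
    by (rule eventually_compose_filterlim[OF K(2) lipschitz_at_tendsto[OF g]])
  with L(2) have "\<forall>\<^sub>F s in nhds u. \<bar>f (g s) - f (g u)\<bar> \<le> K * L * \<bar>s - u\<bar>"
  proof eventually_elim
    case (elim s)
    have "K * \<bar>g s - g u\<bar> \<le> K * (L * \<bar>s - u\<bar>)" using elim(1) K(1) by (rule mult_left_mono)
    with elim(2) show ?case by (simp add: mult.assoc)
  qed
  then show ?thesis unfolding lipschitz_at_def using K(1) L(1) by (intro exI[of _ "K * L"]) simp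
qed

lemma lipschitz_at_diff:
  assumes "lipschitz_at f u" "lipschitz_at g u"
  shows "lipschitz_at (\<lambda>s. f s - g s) u"
proof -
  obtain L where L: "0 \<le> L" "\<forall>\<^sub>F s in nhds u. \<bar>f s - f u\<bar> \<le> L * \<bar>s - u\<bar>" using assms by (auto simp: lipschitz_at_def)
  obtain K where K: "0 \<le> K" "\<forall>\<^sub>F s in nhds u. \<bar>g s - g u\<bar> \<le> K * \<bar>s - u\<bar>" using assms by (auto simp: lipschitz_at_def)
  have "\<forall>\<^sub>F s in nhds u. \<bar>f s - g s - (f u - g u)\<bar> \<le> (L + K) * \<bar>s - u\<bar>"
    using L(2) K(2) by eventually_elim (simp add: distrib_right)
  then show ?thesis unfolding lipschitz_at_def using K(1) L(1) by (intro exI[of _ "L + K"]) simp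
qed

lemma lipschitz_at_mult:
  assumes f: "lipschitz_at f u" and g: "lipschitz_at g u"
  shows "lipschitz_at (\<lambda>s. f s * g s) u"
proof -
  obtain L where L: "0 \<le> L" "\<forall>\<^sub>F s in nhds u. \<bar>f s - f u\<bar> \<le> L * \<bar>s - u\<bar>" using assms by (auto simp: lipschitz_at_def)
  obtain K where K: "0 \<le> K" "\<forall>\<^sub>F s in nhds u. \<bar>g s - g u\<bar> \<le> K * \<bar>s - u\<bar>" using assms by (auto simp: lipschitz_at_def)
  have "\<forall>\<^sub>F s in nhds u. \<bar>g s\<bar> < \<bar>g u\<bar> + 1"
    by (rule order_tendstoD[OF tendsto_rabs[OF lipschitz_at_tendsto[OF g]]]) simp
  with L(2) K(2) have "\<forall>\<^sub>F s in nhds u. \<bar>f s * g s - f u * g u\<bar> \<le> (L * (\<bar>g u\<bar> + 1) + \<bar>f u\<bar> * K) * \<bar>s - u\<bar>"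
  proof eventually_elim
    case (elim s)
    have "f s * g s - f u * g u = (f s - f u) * g s + f u * (g s - g u)" by (simp add: algebra_simps)
    then have "\<bar>f s * g s - f u * g u\<bar> \<le> \<bar>f s - f u\<bar> * \<bar>g s\<bar> + \<bar>f u\<bar> * \<bar>g s - g u\<bar>"
      using abs_triangle_ineq[of "(f s - f u) * g s" "f u * (g s - g u)"] by (simp add: abs_mult)
    also have "\<dots> \<le> (L * \<bar>s - u\<bar>) * (\<bar>g u\<bar> + 1) + \<bar>f u\<bar> * (K * \<bar>s - u\<bar>)"
      using elim L K by (intro add_mono mult_mono) auto
    finally show ?case by (simp add: algebra_simps)
  qed
  then show ?thesis unfolding lipschitz_at_def using K(1) L(1) by (intro exI[of _ "L * (\<bar>g u\<bar> + 1) + \<bar>f u\<bar> * K"]) simp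
qed

lemma C1_imp_lipschitz_at:
  assumes "f C1_differentiable_on UNIV"
  shows "lipschitz_at f u"
proof -
  obtain D where "(f has_vector_derivative D) (at u)" using assms by (auto simp: C1_differentiable_on_def)
  then have "DERIV f u :> D" by (simp add: has_real_derivative_iff_has_vector_derivative)
  then show ?thesis by (rule DERIV_imp_lipschitz_at)
qed

lemma lipschitz_at_levy_moment:
  assumes "lipschitz_at \<alpha> u" "0 < c" "d < 2" "\<And>t. \<alpha> t \<in> {c..d}"
  shows "lipschitz_at (\<lambda>t. levy_moment (\<alpha> t)) u"
proof -
  obtain L where L: "\<And>a a'. a \<in> {c..d} \<Longrightarrow> a' \<in> {c..d} \<Longrightarrow> \<bar>levy_moment a - levy_moment a'\<bar> \<le> L * \<bar>a - a'\<bar>"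
    using levy_moment_lipschitz[OF assms(2,3)] by blast
  obtain K where K: "0 \<le> K" "\<forall>\<^sub>F s in nhds u. \<bar>\<alpha> s - \<alpha> u\<bar> \<le> K * \<bar>s - u\<bar>" using assms(1) by (auto simp: lipschitz_at_def)
  have "\<forall>\<^sub>F s in nhds u. \<bar>levy_moment (\<alpha> s) - levy_moment (\<alpha> u)\<bar> \<le> \<bar>L\<bar> * K * \<bar>s - u\<bar>"
    using K(2)
  proof eventually_elim
    case (elim s)
    have "\<bar>levy_moment (\<alpha> s) - levy_moment (\<alpha> u)\<bar> \<le> L * \<bar>\<alpha> s - \<alpha> u\<bar>" by (intro L assms)
    also have "\<dots> \<le> \<bar>L\<bar> * (K * \<bar>s - u\<bar>)" using elim by (intro mult_mono) auto
    finally show ?case by (simp add: mult.assoc)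
  qed
  then show ?thesis unfolding lipschitz_at_def using K(1) by (intro exI[of _ "\<bar>L\<bar> * K"]) simp
qed

text \<open>
  By \<open>stable_const_eq\<close> the constant is \<open>1 / levy_moment\<close>, whose power \<open>1 / \<alpha>\<close> is written as an exponential.
\<close>

lemma lipschitz_at_scale:
  assumes b: "lipschitz_at b u" and \<alpha>: "lipschitz_at \<alpha> u" and cd: "0 < c" "d < 2" "\<And>t. \<alpha> t \<in> {c..d}"
  shows "lipschitz_at (\<lambda>t. b t * stable_const (\<alpha> t) powr (1 / \<alpha> t)) u"
proof -
  have \<alpha>t: "0 < \<alpha> t" "\<alpha> t < 2" for t using cd(1,2) cd(3)[of t] by auto
  have inv: "lipschitz_at (\<lambda>t. inverse (\<alpha> t)) u"
    using \<alpha>t[of u] by (intro lipschitz_at_compose[OF \<alpha>] DERIV_imp_lipschitz_at[OF DERIV_inverse]) auto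
  have "lipschitz_at (\<lambda>t. ln (levy_moment (\<alpha> t))) u"
    by (intro lipschitz_at_compose[OF lipschitz_at_levy_moment[OF \<alpha> cd]] DERIV_imp_lipschitz_at[OF DERIV_ln] levy_moment_pos \<alpha>t)
  then have "lipschitz_at (\<lambda>t. inverse (\<alpha> t) * ln (levy_moment (\<alpha> t))) u" by (rule lipschitz_at_mult[OF inv])
  then have "lipschitz_at (\<lambda>t. exp (- (inverse (\<alpha> t) * ln (levy_moment (\<alpha> t))))) u"
  proof (rule lipschitz_at_compose[where f = "\<lambda>x. exp (- x)"])
    show "lipschitz_at (\<lambda>x. exp (- x)) x" for x :: real
      by (rule DERIV_imp_lipschitz_at) (rule derivative_eq_intros refl)+
  qed
  moreover have "stable_const (\<alpha> t) powr (1 / \<alpha> t) = exp (- (inverse (\<alpha> t) * ln (levy_moment (\<alpha> t))))" for t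
    using levy_moment_pos[OF \<alpha>t, of t] by (simp add: stable_const_eq[OF \<alpha>t] powr_def ln_inverse divide_inverse)
  ultimately show ?thesis by (simp add: lipschitz_at_mult[OF b])
qed

text \<open>
  The cells partition the line. The negative cells are closed on the left, which is why the index of a
  negative \<open>y\<close> is formed with the ceiling of \<open>- y\<close>.
\<close>

definition cell_index :: "real \<Rightarrow> nat" where
  "cell_index y = (if 0 \<le> y then nat \<lfloor>y\<rfloor> else nat (\<lceil>- y\<rceil> - 1))"

lemma mem_cell_iff: "y \<in> cell (Suc j) \<longleftrightarrow> j = cell_index y"
proof (cases "0 \<le> y")
  case True
  have "y \<in> cell (Suc j) \<longleftrightarrow> real j \<le> y \<and> y < real j + 1"
    using True by (auto simp: cell_def)
  also have "\<dots> \<longleftrightarrow> \<lfloor>y\<rfloor> = int j" by (simp add: floor_eq_iff)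
  also have "\<dots> \<longleftrightarrow> j = cell_index y" using True by (auto simp: cell_index_def)
  finally show ?thesis .
next
  case False
  have "y \<in> cell (Suc j) \<longleftrightarrow> real j < - y \<and> - y \<le> real j + 1"
    using False by (auto simp: cell_def)
  also have "\<dots> \<longleftrightarrow> \<lceil>- y\<rceil> = int j + 1" by (simp add: ceiling_eq_iff)
  also have "\<dots> \<longleftrightarrow> j = cell_index y" using False by (auto simp: cell_index_def)
  finally show ?thesis .
qed

lemma suminf_cells:
  fixes f :: "nat \<Rightarrow> real"
  shows "(\<Sum>j. f j * indicator (cell (Suc j)) y) = f (cell_index y)"
proof -
  have "(\<lambda>j. f j * indicator (cell (Suc j)) y) = (\<lambda>j. if j = cell_index y then f j else 0)"
    by (auto simp: fun_eq_iff mem_cell_iff indicator_def)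
  then show ?thesis using sums_single[of "cell_index y" f] by (simp add: sums_iff)
qed

lemma mark_density_eq: "mark_density y = 3 / (pi\<^sup>2 * (real (Suc (cell_index y)))\<^sup>2)"
  using suminf_cells[of "\<lambda>j. 1 / (real (Suc j))\<^sup>2" y] by (simp add: mark_density_def)

lemma mark_density_pos: "0 < mark_density y"
  by (simp add: mark_density_eq)

lemma cell_in_borel[measurable]: "cell j \<in> sets borel"
  by (simp add: cell_def)

lemma mark_density_measurable[measurable]: "mark_density \<in> borel_measurable borel"
  unfolding mark_density_def[abs_def] by measurable

lemma stable_integrand_add_scaled:
  assumes \<alpha>: "0 < \<alpha>" and f: "f \<in> stable_integrand \<alpha>" and g: "g \<in> stable_integrand \<alpha>"
  shows "(\<lambda>x. p * f x + q * g x) \<in> stable_integrand \<alpha>"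
proof -
  have [measurable]: "f \<in> borel_measurable borel" "g \<in> borel_measurable borel"
    and int: "integrable lborel (\<lambda>y. \<bar>f y\<bar> powr \<alpha>)" "integrable lborel (\<lambda>y. \<bar>g y\<bar> powr \<alpha>)"
    using f g by (auto simp: stable_integrand_def)
  have "integrable lborel (\<lambda>x. \<bar>p * f x + q * g x\<bar> powr \<alpha>)"
  proof (rule Bochner_Integration.integrable_bound)
    show "integrable lborel (\<lambda>x. 2 powr \<alpha> * (\<bar>p\<bar> powr \<alpha> * \<bar>f x\<bar> powr \<alpha> + \<bar>q\<bar> powr \<alpha> * \<bar>g x\<bar> powr \<alpha>))"
      using int by auto
    show "AE x in lborel. norm (\<bar>p * f x + q * g x\<bar> powr \<alpha>) \<le> norm (2 powr \<alpha> * (\<bar>p\<bar> powr \<alpha> * \<bar>f x\<bar> powr \<alpha> + \<bar>q\<bar> powr \<alpha> * \<bar>g x\<bar> powr \<alpha>))"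
    proof (rule AE_I2)
      fix x
      define a b where "a = \<bar>p * f x\<bar>" and "b = \<bar>q * g x\<bar>"
      have "\<bar>p * f x + q * g x\<bar> powr \<alpha> \<le> (2 * max a b) powr \<alpha>"
        using \<alpha> by (intro powr_mono2) (auto simp: a_def b_def)
      also have "\<dots> = 2 powr \<alpha> * max a b powr \<alpha>" by (simp add: powr_mult a_def)
      also have "\<dots> \<le> 2 powr \<alpha> * (a powr \<alpha> + b powr \<alpha>)" by (intro mult_left_mono) (auto simp: max_def)
      finally show "norm (\<bar>p * f x + q * g x\<bar> powr \<alpha>) \<le> norm (2 powr \<alpha> * (\<bar>p\<bar> powr \<alpha> * \<bar>f x\<bar> powr \<alpha> + \<bar>q\<bar> powr \<alpha> * \<bar>g x\<bar> powr \<alpha>))"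
        by (simp add: a_def b_def abs_mult powr_mult)
    qed
  qed measurable
  then show ?thesis by (simp add: stable_integrand_def)
qed

lemma stable_integrand_zero: "(\<lambda>x. 0) \<in> stable_integrand \<alpha>"
  by (simp add: stable_integrand_def)

lemma stable_integrand_sum:
  fixes n :: nat
  assumes \<alpha>: "0 < \<alpha>" and f: "\<And>k. f k \<in> stable_integrand \<alpha>"
  shows "(\<lambda>x. \<Sum>k<n. \<theta> k * f k x) \<in> stable_integrand \<alpha>"
proof (induction n)
  case (Suc n)
  from stable_integrand_add_scaled[OF \<alpha> Suc f[of n], of 1 "\<theta> n"] show ?case by simp
qed (simp add: stable_integrand_zero)

text \<open>
  The linearity of the stable integral holds almost surely for two integrands at a time, and its value
  at 0 is forced to be 0 by the combination with coefficients 0.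
\<close>

lemma sas_integral_sum:
  fixes n :: nat
  assumes I: "sas_integral N \<alpha> I" and \<alpha>: "0 < \<alpha>" and f: "\<And>k. f k \<in> stable_integrand \<alpha>"
  shows "AE \<omega> in N. I (\<lambda>x. \<Sum>k<n. \<theta> k * f k x) \<omega> = (\<Sum>k<n. \<theta> k * I (f k) \<omega>)"
proof -
  have linear: "AE \<omega> in N. I (\<lambda>x. p * g x + q * g' x) \<omega> = p * I g \<omega> + q * I g' \<omega>"
    if "g \<in> stable_integrand \<alpha>" "g' \<in> stable_integrand \<alpha>" for g g' p q
    using I that unfolding sas_integral_def by blast
  show ?thesis
  proof (induction n)
    case 0
    have "AE \<omega> in N. I (\<lambda>x. 0 * f 0 x + 0 * f 0 x) \<omega> = 0 * I (f 0) \<omega> + 0 * I (f 0) \<omega>"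
      by (rule linear[OF f f])
    then show ?case by simp
  next
    case (Suc n)
    have "AE \<omega> in N. I (\<lambda>x. 1 * (\<Sum>k<n. \<theta> k * f k x) + \<theta> n * f n x) \<omega> = 1 * I (\<lambda>x. \<Sum>k<n. \<theta> k * f k x) \<omega> + \<theta> n * I (f n) \<omega>"
      by (rule linear[OF stable_integrand_sum[OF \<alpha> f] f])
    with Suc show ?case by eventually_elim simp
  qed
qed

text \<open>
  Substituting \<open>y = u + r * x\<close> produces the factor \<open>r\<close>. The integrand scales with
  \<open>(r powr (- H) * r powr (H - 1 / \<alpha>)) powr \<alpha> = 1 / r\<close>, and the terms \<open>\<bar>y\<bar> powr (H - 1 / \<alpha>)\<close> cancel in the increment.
\<close>

lemma kernel_increment_self_similar:
  fixes r u \<alpha> H :: real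
  assumes r: "0 < r" and \<alpha>: "0 < \<alpha>"
  shows "(\<integral>y. \<bar>\<Sum>k<n. \<theta> k * (r powr (- H) * kernel_increment (H - 1 / \<alpha>) (u + r * t k) y + (- (r powr (- H))) * kernel_increment (H - 1 / \<alpha>) u y)\<bar> powr \<alpha> \<partial>lborel)
    = (\<integral>x. \<bar>\<Sum>k<n. \<theta> k * kernel_increment (H - 1 / \<alpha>) (t k) x\<bar> powr \<alpha> \<partial>lborel)"
proof -
  let ?p = "H - 1 / \<alpha>"
  let ?f = "\<lambda>y. \<bar>\<Sum>k<n. \<theta> k * (r powr (- H) * kernel_increment ?p (u + r * t k) y + (- (r powr (- H))) * kernel_increment ?p u y)\<bar> powr \<alpha>"
  have "?f (u + r * x) = (1 / r) * \<bar>\<Sum>k<n. \<theta> k * kernel_increment ?p (t k) x\<bar> powr \<alpha>" for x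
  proof -
    have summand: "r powr (- H) * kernel_increment ?p (u + r * t k) (u + r * x) + (- (r powr (- H))) * kernel_increment ?p u (u + r * x)
      = r powr (- (1 / \<alpha>)) * kernel_increment ?p (t k) x" for k
    proof -
      have "\<bar>u + r * t k - (u + r * x)\<bar> = r * \<bar>t k - x\<bar>" "\<bar>u - (u + r * x)\<bar> = r * \<bar>x\<bar>"
        using r by (simp_all add: abs_mult right_diff_distrib[symmetric])
      then have "r powr (- H) * kernel_increment ?p (u + r * t k) (u + r * x) + (- (r powr (- H))) * kernel_increment ?p u (u + r * x)
        = r powr (- H) * ((r * \<bar>t k - x\<bar>) powr ?p - (r * \<bar>x\<bar>) powr ?p)"
        by (simp add: kernel_increment_def algebra_simps)
      also have "\<dots> = (r powr (- H) * r powr ?p) * kernel_increment ?p (t k) x"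
        using r by (simp add: kernel_increment_def powr_mult algebra_simps)
      also have "r powr (- H) * r powr ?p = r powr (- (1 / \<alpha>))"
        unfolding powr_add[symmetric] by simp
      finally show ?thesis .
    qed
    have "?f (u + r * x) = \<bar>r powr (- (1 / \<alpha>)) * (\<Sum>k<n. \<theta> k * kernel_increment ?p (t k) x)\<bar> powr \<alpha>"
      unfolding summand by (simp add: sum_distrib_left mult_ac)
    also have "\<dots> = (r powr (- (1 / \<alpha>))) powr \<alpha> * \<bar>\<Sum>k<n. \<theta> k * kernel_increment ?p (t k) x\<bar> powr \<alpha>"
      by (simp add: abs_mult powr_mult)
    also have "(r powr (- (1 / \<alpha>))) powr \<alpha> = 1 / r"
      using r \<alpha> by (simp only: powr_powr) (simp add: powr_minus divide_inverse)
    finally show ?thesis .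
  qed
  then show ?thesis
    using r by (subst lborel_integral_real_affine[of r _ u]) simp_all
qed

lemma (in marked_poisson) fkl_series_scaled_diff:
  assumes F: "case_prod F \<in> borel_measurable (borel \<Otimes>\<^sub>M borel)" "truncated_energy F < \<infinity>"
    and G: "case_prod G \<in> borel_measurable (borel \<Otimes>\<^sub>M borel)" "truncated_energy G < \<infinity>"
  shows "AE \<omega> in M. fkl_series (\<lambda>z y. c * (F z y - G z y)) \<omega> = c * (fkl_series F \<omega> - fkl_series G \<omega>)"
  using AE_fkl_summable[OF F] AE_fkl_summable[OF G]
proof eventually_elim
  case (elim \<omega>)
  have "(\<lambda>i. c * (\<gamma> i \<omega> * F (level i \<omega>) (V i \<omega>) - \<gamma> i \<omega> * G (level i \<omega>) (V i \<omega>))) sums (c * (fkl_series F \<omega> - fkl_series G \<omega>))"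
    unfolding fkl_series_def by (intro sums_mult sums_diff summable_sums elim)
  then have "(\<lambda>i. \<gamma> i \<omega> * (c * (F (level i \<omega>) (V i \<omega>) - G (level i \<omega>) (V i \<omega>)))) sums (c * (fkl_series F \<omega> - fkl_series G \<omega>))"
    by (simp add: algebra_simps)
  then show ?case unfolding fkl_series_def[of "\<lambda>z y. c * (F z y - G z y)"] by (simp add: sums_iff)
qed

text \<open>
  With the parameters frozen, the linear combination is itself a series whose integrand is \<open>\<kappa> * z powr (- 1 / \<alpha>)\<close>
  times a function of \<open>y\<close>. By self-similarity its exponent does not depend on \<open>r\<close> and \<open>u\<close>.
\<close>

lemma (in marked_poisson) frozen_series_char:
  fixes \<alpha> H r u \<kappa> :: real and t \<theta> :: "nat \<Rightarrow> real" and n :: nat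
  assumes \<alpha>: "0 < \<alpha>" "\<alpha> < 2" and H: "0 < H" "H < 1" and r: "0 < r"
  shows "(\<integral>\<omega>. iexp (\<Sum>k<n. \<theta> k * fkl_series (\<lambda>z y. r powr (- H) *
        (fkl_kernel \<kappa> (1 / \<alpha>) (H - 1 / \<alpha>) (u + r * t k) z y - fkl_kernel \<kappa> (1 / \<alpha>) (H - 1 / \<alpha>) u z y)) \<omega>) \<partial>M)
    = complex_of_real (exp (- (\<bar>\<kappa>\<bar> powr \<alpha> / stable_const \<alpha> * (\<integral>x. \<bar>\<Sum>k<n. \<theta> k * kernel_increment (H - 1 / \<alpha>) (t k) x\<bar> powr \<alpha> \<partial>lborel))))"
proof -
  let ?p = "H - 1 / \<alpha>"
  define \<phi> where "\<phi> k y = r powr (- H) * kernel_increment ?p (u + r * t k) y + (- (r powr (- H))) * kernel_increment ?p u y" for k y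
  have \<phi>: "\<phi> k \<in> stable_integrand \<alpha>" for k
    unfolding \<phi>_def by (intro stable_integrand_add_scaled \<alpha> kernel_increment_stable_integrand H)
  define f where "f y = (\<Sum>k<n. \<theta> k * \<phi> k y)" for y
  have f: "f \<in> stable_integrand \<alpha>" unfolding f_def by (rule stable_integrand_sum[OF \<alpha>(1) \<phi>])
  have [measurable]: "f \<in> borel_measurable borel" "\<phi> k \<in> borel_measurable borel" for k
    using f \<phi>[of k] by (auto simp: stable_integrand_def)
  define G where "G k z y = \<kappa> * (z powr (- (1 / \<alpha>)) * \<phi> k y)" for k z y
  define F where "F z y = \<kappa> * (z powr (- (1 / \<alpha>)) * f y)" for z y
  have G_eq: "(\<lambda>z y. r powr (- H) * (fkl_kernel \<kappa> (1 / \<alpha>) ?p (u + r * t k) z y - fkl_kernel \<kappa> (1 / \<alpha>) ?p u z y)) = G k" for k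
    by (simp add: fun_eq_iff G_def fkl_kernel_def \<phi>_def algebra_simps)
  have Gm: "case_prod (G k) \<in> borel_measurable (borel \<Otimes>\<^sub>M borel)" for k
    unfolding G_def split_beta' by measurable
  have Fm: "case_prod F \<in> borel_measurable (borel \<Otimes>\<^sub>M borel)"
    unfolding F_def split_beta' by measurable
  have Ge: "truncated_energy (G k) < \<infinity>" for k
    unfolding G_def by (rule stable_integrand_energy(1)[OF \<alpha> \<phi>])
  have Fe: "truncated_energy F < \<infinity>"
    unfolding F_def by (rule stable_integrand_energy(1)[OF \<alpha> f])
  have "AE \<omega> in M. \<forall>k. summable (\<lambda>i. \<gamma> i \<omega> * G k (level i \<omega>) (V i \<omega>))"
    unfolding AE_all_countable using AE_fkl_summable[OF Gm Ge] by blast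
  then have sum_eq: "AE \<omega> in M. (\<Sum>k<n. \<theta> k * fkl_series (G k) \<omega>) = fkl_series F \<omega>"
  proof eventually_elim
    case (elim \<omega>)
    have "(\<lambda>i. \<Sum>k<n. \<theta> k * (\<gamma> i \<omega> * G k (level i \<omega>) (V i \<omega>))) sums (\<Sum>k<n. \<theta> k * fkl_series (G k) \<omega>)"
      unfolding fkl_series_def using elim by (intro sums_sum sums_mult summable_sums) auto
    moreover have "(\<Sum>k<n. \<theta> k * (\<gamma> i \<omega> * G k (level i \<omega>) (V i \<omega>))) = \<gamma> i \<omega> * F (level i \<omega>) (V i \<omega>)" for i
      by (simp add: G_def F_def f_def sum_distrib_left mult_ac)
    ultimately show ?case by (simp add: fkl_series_def sums_iff)
  qed
  have [measurable]: "fkl_series (G k) \<in> borel_measurable M" "fkl_series F \<in> borel_measurable M" for k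
    using Gm Fm by (auto intro: measurable_fkl_series)
  have "(\<integral>\<omega>. iexp (\<Sum>k<n. \<theta> k * fkl_series (G k) \<omega>) \<partial>M) = (\<integral>\<omega>. iexp (fkl_series F \<omega>) \<partial>M)"
  proof (rule integral_cong_AE)
    show "AE \<omega> in M. iexp (\<Sum>k<n. \<theta> k * fkl_series (G k) \<omega>) = iexp (fkl_series F \<omega>)"
      using sum_eq by eventually_elim (simp only:)
  qed measurable
  also have "\<dots> = complex_of_real (exp (- enn2real (levy_exponent F)))"
    by (rule char_fkl_series[OF Fm Fe]) (auto simp: F_def intro!: continuous_intros)
  also have "levy_exponent F = ennreal (\<bar>\<kappa>\<bar> powr \<alpha> / stable_const \<alpha> * (\<integral>y. \<bar>f y\<bar> powr \<alpha> \<partial>lborel))"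
    unfolding levy_exponent_def F_def by (rule stable_integrand_energy(2)[OF \<alpha> f])
  also have "(\<integral>y. \<bar>f y\<bar> powr \<alpha> \<partial>lborel) = (\<integral>x. \<bar>\<Sum>k<n. \<theta> k * kernel_increment ?p (t k) x\<bar> powr \<alpha> \<partial>lborel)"
    unfolding f_def \<phi>_def by (rule kernel_increment_self_similar[OF r \<alpha>(1)])
  also have "enn2real (ennreal (\<bar>\<kappa>\<bar> powr \<alpha> / stable_const \<alpha> * (\<integral>x. \<bar>\<Sum>k<n. \<theta> k * kernel_increment ?p (t k) x\<bar> powr \<alpha> \<partial>lborel)))
      = \<bar>\<kappa>\<bar> powr \<alpha> / stable_const \<alpha> * (\<integral>x. \<bar>\<Sum>k<n. \<theta> k * kernel_increment ?p (t k) x\<bar> powr \<alpha> \<partial>lborel)"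
  proof (rule enn2real_ennreal)
    have "0 < stable_const \<alpha>" using levy_moment_pos[OF \<alpha>] stable_const_eq[OF \<alpha>] by simp
    then show "0 \<le> \<bar>\<kappa>\<bar> powr \<alpha> / stable_const \<alpha> * (\<integral>x. \<bar>\<Sum>k<n. \<theta> k * kernel_increment ?p (t k) x\<bar> powr \<alpha> \<partial>lborel)"
      by (intro mult_nonneg_nonneg) auto
  qed
  finally show ?thesis unfolding G_eq .
qed

text \<open>
  The distance of the parameters at \<open>u + r * t\<close> and \<open>u\<close> is at most a constant times \<open>r\<close>, and
  \<open>r powr (- H) * r\<close> tends to 0. The energy bound of \<open>fkl_kernel_perturbation\<close>, uniform in the time
  argument, and \<open>fkl_series_tail\<close> give the claim.
\<close>

lemma (in marked_poisson) frozen_parameters_error: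
  fixes \<kappa> \<beta> p :: "real \<Rightarrow> real" and H u t \<epsilon> :: real
  assumes lip: "lipschitz_at \<kappa> u" "lipschitz_at \<beta> u" "lipschitz_at p u"
    and H: "0 < H" "H < 1" and \<beta>: "1 / 2 < \<beta> u" and p: "p u = H - \<beta> u" and \<epsilon>: "0 < \<epsilon>"
  shows "((\<lambda>r. measure M {\<omega> \<in> space M. \<epsilon> < \<bar>fkl_series (\<lambda>z y. r powr (- H) *
      (fkl_kernel (\<kappa> (u + r * t)) (\<beta> (u + r * t)) (p (u + r * t)) (u + r * t) z y
        - fkl_kernel (\<kappa> u) (\<beta> u) (p u) (u + r * t) z y)) \<omega>\<bar>}) \<longlongrightarrow> 0) (at_right 0)"
proof -
  define S where "S = \<bar>u\<bar> + \<bar>t\<bar>"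
  have S: "0 \<le> S" by (simp add: S_def)
  show ?thesis
  proof (rule fkl_kernel_perturbation[OF \<beta> H S, where \<kappa>' = "\<kappa> u"])
    fix \<delta> a1 a2 B
    assume \<delta>: "0 < \<delta>" and a: "0 < a1" "0 < a2" and bound:
      "\<And>\<kappa>' \<beta>' p' s c. \<bar>\<beta>' - \<beta> u\<bar> \<le> \<delta> \<Longrightarrow> \<bar>p' - (H - \<beta> u)\<bar> \<le> \<delta> \<Longrightarrow> \<bar>s\<bar> \<le> S \<Longrightarrow> 0 \<le> c \<Longrightarrow>
        truncated_energy (\<lambda>z y. c * (fkl_kernel \<kappa>' \<beta>' p' s z y - fkl_kernel (\<kappa> u) (\<beta> u) (H - \<beta> u) s z y))
          \<le> ennreal (B * ((c * (\<bar>\<kappa>' - \<kappa> u\<bar> + \<bar>\<beta>' - \<beta> u\<bar> + \<bar>p' - (H - \<beta> u)\<bar>)) powr a1 +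
                         (c * (\<bar>\<kappa>' - \<kappa> u\<bar> + \<bar>\<beta>' - \<beta> u\<bar> + \<bar>p' - (H - \<beta> u)\<bar>)) powr a2))"
    define d where "d s = \<bar>\<kappa> s - \<kappa> u\<bar> + \<bar>\<beta> s - \<beta> u\<bar> + \<bar>p s - p u\<bar>" for s
    have line: "filterlim (\<lambda>r. u + r * t) (nhds u) (at_right 0)"
    proof -
      have "((\<lambda>r. u + r * t) \<longlongrightarrow> u + 0 * t) (at_right 0)" by (intro tendsto_intros)
      then show ?thesis by simp
    qed
    have "\<exists>L. \<forall>\<^sub>F s in nhds u. d s \<le> L * \<bar>s - u\<bar>"
    proof -
      obtain L1 L2 L3 where "\<forall>\<^sub>F s in nhds u. \<bar>\<kappa> s - \<kappa> u\<bar> \<le> L1 * \<bar>s - u\<bar>"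
        "\<forall>\<^sub>F s in nhds u. \<bar>\<beta> s - \<beta> u\<bar> \<le> L2 * \<bar>s - u\<bar>" "\<forall>\<^sub>F s in nhds u. \<bar>p s - p u\<bar> \<le> L3 * \<bar>s - u\<bar>"
        using lip unfolding lipschitz_at_def by blast
      then have "\<forall>\<^sub>F s in nhds u. d s \<le> (L1 + L2 + L3) * \<bar>s - u\<bar>"
        by eventually_elim (simp add: d_def distrib_right)
      then show ?thesis by blast
    qed
    then obtain L where L: "\<forall>\<^sub>F s in nhds u. d s \<le> L * \<bar>s - u\<bar>" by blast
    define m where "m r = r powr (- H) * d (u + r * t)" for r
    have m0: "0 \<le> m r" for r by (simp add: m_def d_def)
    have m_lim: "(m \<longlongrightarrow> 0) (at_right 0)"
    proof (rule tendsto_sandwich)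
      show "\<forall>\<^sub>F r in at_right 0. 0 \<le> m r" using m0 by simp
      have "((\<lambda>r::real. r powr (1 - H)) \<longlongrightarrow> 0) (at_right 0)" using H by real_asymp
      from tendsto_mult[OF tendsto_const[of "L * \<bar>t\<bar>"] this]
      show "((\<lambda>r. L * \<bar>t\<bar> * r powr (1 - H)) \<longlongrightarrow> 0) (at_right 0)" by simp
      show "\<forall>\<^sub>F r in at_right 0. m r \<le> L * \<bar>t\<bar> * r powr (1 - H)"
        using eventually_compose_filterlim[OF L line] eventually_at_right_less[of 0]
      proof eventually_elim
        case (elim r)
        have "m r \<le> r powr (- H) * (L * \<bar>r * t\<bar>)"
          unfolding m_def using elim(1) by (intro mult_left_mono) auto
        also have "\<dots> = L * \<bar>t\<bar> * (r powr (- H) * r powr 1)" using elim(2) by (simp add: abs_mult)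
        also have "r powr (- H) * r powr 1 = r powr (1 - H)" unfolding powr_add[symmetric] by simp
        finally show ?case .
      qed
    qed simp
    \<comment> \<open>the tail estimate is for thresholds up to 1\<close>
    define e where "e = min \<epsilon> 1"
    have e: "0 < e" "e \<le> 1" "e \<le> \<epsilon>" using \<epsilon> by (auto simp: e_def)
    have "((\<lambda>r. 1 / e\<^sup>2 * max 0 (B * (m r powr a1 + m r powr a2))) \<longlongrightarrow> 1 / e\<^sup>2 * max 0 (B * (0 + 0))) (at_right 0)"
    proof (intro tendsto_mult tendsto_max tendsto_const tendsto_add)
      show "((\<lambda>r. m r powr a1) \<longlongrightarrow> 0) (at_right 0)" "((\<lambda>r. m r powr a2) \<longlongrightarrow> 0) (at_right 0)"
        using a m0 by (auto intro!: tendsto_zero_powrI[OF m_lim tendsto_const])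
    qed
    then have lim: "((\<lambda>r. 1 / e\<^sup>2 * max 0 (B * (m r powr a1 + m r powr a2))) \<longlongrightarrow> 0) (at_right 0)" by simp
    show ?thesis
    proof (rule tendsto_sandwich[OF _ _ tendsto_const lim])
      have close: "\<forall>\<^sub>F r in at_right 0. \<bar>f (u + r * t) - f u\<bar> < \<delta>" if "lipschitz_at f u" for f
        using tendstoD[OF filterlim_compose[OF lipschitz_at_tendsto[OF that] line] \<delta>] by (simp add: dist_real_def)
      have "\<forall>\<^sub>F r in at_right 0. r < (1::real)" by (rule eventually_at_rightI[of 0 1]) auto
      then show "\<forall>\<^sub>F r in at_right 0. measure M {\<omega> \<in> space M. \<epsilon> < \<bar>fkl_series (\<lambda>z y. r powr (- H) *
        (fkl_kernel (\<kappa> (u + r * t)) (\<beta> (u + r * t)) (p (u + r * t)) (u + r * t) z y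
          - fkl_kernel (\<kappa> u) (\<beta> u) (p u) (u + r * t) z y)) \<omega>\<bar>} \<le> 1 / e\<^sup>2 * max 0 (B * (m r powr a1 + m r powr a2))"
        using close[OF lip(2)] close[OF lip(3)] eventually_at_right_less[of 0]
      proof eventually_elim
        case (elim r)
        let ?s = "u + r * t"
        define F where "F z y = r powr (- H) * (fkl_kernel (\<kappa> ?s) (\<beta> ?s) (p ?s) ?s z y - fkl_kernel (\<kappa> u) (\<beta> u) (p u) ?s z y)" for z y
        have Fm: "case_prod F \<in> borel_measurable (borel \<Otimes>\<^sub>M borel)"
          unfolding F_def fkl_kernel_def split_beta' by measurable
        have "\<bar>r * t\<bar> \<le> 1 * \<bar>t\<bar>" unfolding abs_mult using elim by (intro mult_right_mono) auto
        then have s: "\<bar>?s\<bar> \<le> S" using abs_triangle_ineq[of u "r * t"] by (simp add: S_def)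
        have Fe: "truncated_energy F \<le> ennreal (B * (m r powr a1 + m r powr a2))"
          using bound[of "\<beta> ?s" "p ?s" ?s "r powr (- H)" "\<kappa> ?s"] elim s unfolding F_def m_def d_def p
          by (simp add: less_imp_le)
        have [measurable]: "fkl_series F \<in> borel_measurable M" by (rule measurable_fkl_series[OF Fm])
        have "measure M {\<omega> \<in> space M. \<epsilon> < \<bar>fkl_series F \<omega>\<bar>} \<le> measure M {\<omega> \<in> space M. e < \<bar>fkl_series F \<omega>\<bar>}"
          using e by (intro finite_measure_mono) auto
        moreover have "ennreal (measure M {\<omega> \<in> space M. e < \<bar>fkl_series F \<omega>\<bar>}) \<le> ennreal (1 / e\<^sup>2) * truncated_energy F"
          using Fe by (intro fkl_series_tail[OF Fm _ e(1,2)]) (auto intro: order_le_less_trans)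
        moreover have "ennreal (1 / e\<^sup>2) * truncated_energy F \<le> ennreal (1 / e\<^sup>2) * ennreal (max 0 (B * (m r powr a1 + m r powr a2)))"
          using Fe by (intro mult_left_mono) (auto simp: max_def ennreal_neg split: if_splits)
        ultimately have "ennreal (measure M {\<omega> \<in> space M. \<epsilon> < \<bar>fkl_series F \<omega>\<bar>}) \<le> ennreal (1 / e\<^sup>2 * max 0 (B * (m r powr a1 + m r powr a2)))"
          by (subst ennreal_mult) (auto intro: order_trans ennreal_leI)
        then have "measure M {\<omega> \<in> space M. \<epsilon> < \<bar>fkl_series F \<omega>\<bar>} \<le> 1 / e\<^sup>2 * max 0 (B * (m r powr a1 + m r powr a2))"
          by (subst (asm) ennreal_le_iff) auto
        then show ?case by (simp only: F_def[abs_def])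
      qed
    qed simp
  qed
qed


lemma independent_of_triple:
  fixes \<Gamma> V \<gamma> :: "nat \<Rightarrow> 'a \<Rightarrow> real"
  assumes M: "prob_space M"
    and J: "prob_space.indep_vars M (\<lambda>_. PiM UNIV (\<lambda>_. borel))
          (\<lambda>k \<omega> i. ([\<Gamma>, V, \<gamma>] ! k) i \<omega>) {..<3::nat}"
  shows "prob_space.independent M (PiM UNIV (\<lambda>_. borel)) (\<lambda>\<omega> i. \<Gamma> i \<omega>) (PiM UNIV (\<lambda>_. borel)) (\<lambda>\<omega> i. V i \<omega>)"
    and "prob_space.independent M (PiM UNIV (\<lambda>_. borel) \<Otimes>\<^sub>M PiM UNIV (\<lambda>_. borel)) (\<lambda>\<omega>. ((\<lambda>i. \<Gamma> i \<omega>), (\<lambda>i. V i \<omega>)))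
      (PiM UNIV (\<lambda>_. borel)) (\<lambda>\<omega> i. \<gamma> i \<omega>)"
proof -
  interpret prob_space M by fact
  let ?P = "PiM UNIV (\<lambda>_. borel) :: (nat \<Rightarrow> real) measure"
  let ?X = "\<lambda>k \<omega> i. ([\<Gamma>, V, \<gamma>] ! k) i \<omega>"
  have comp: "(\<lambda>x. x k) \<in> measurable (PiM K (\<lambda>_. ?P)) ?P" if "k \<in> K" for k :: nat and K
    by (rule measurable_component_singleton[OF that])
  have 1: "independent (PiM {0} (\<lambda>_. ?P)) (\<lambda>\<omega>. \<lambda>k\<in>{0}. ?X k \<omega>) (PiM {1} (\<lambda>_. ?P)) (\<lambda>\<omega>. \<lambda>k\<in>{1}. ?X k \<omega>)"
    by (intro indep_var_imp_independent indep_var_restrict[OF J]) auto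
  have "independent ?P (\<lambda>\<omega>. (\<lambda>k\<in>{0}. ?X k \<omega>) 0) ?P (\<lambda>\<omega>. (\<lambda>k\<in>{1}. ?X k \<omega>) 1)"
    by (rule independent_compose[OF 1 comp comp]) auto
  then show "independent ?P (\<lambda>\<omega> i. \<Gamma> i \<omega>) ?P (\<lambda>\<omega> i. V i \<omega>)" by simp
  have 2: "independent (PiM {0, 1} (\<lambda>_. ?P)) (\<lambda>\<omega>. \<lambda>k\<in>{0, 1}. ?X k \<omega>) (PiM {2} (\<lambda>_. ?P)) (\<lambda>\<omega>. \<lambda>k\<in>{2}. ?X k \<omega>)"
    by (intro indep_var_imp_independent indep_var_restrict[OF J]) auto
  have "independent (?P \<Otimes>\<^sub>M ?P) (\<lambda>\<omega>. ((\<lambda>k\<in>{0, 1}. ?X k \<omega>) 0, (\<lambda>k\<in>{0, 1}. ?X k \<omega>) 1)) ?P (\<lambda>\<omega>. (\<lambda>k\<in>{2}. ?X k \<omega>) 2)"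
    by (rule independent_compose[OF 2 measurable_Pair[OF comp comp] comp]) auto
  then show "independent (?P \<Otimes>\<^sub>M ?P) (\<lambda>\<omega>. ((\<lambda>i. \<Gamma> i \<omega>), (\<lambda>i. V i \<omega>))) ?P (\<lambda>\<omega> i. \<gamma> i \<omega>)"
    by (simp add: numeral_2_eq_2)
qed

lemma lmmm_measurable:
  assumes [measurable]: "\<And>i. \<Gamma> i \<in> borel_measurable M" "\<And>i. V i \<in> borel_measurable M" "\<And>i. \<gamma> i \<in> borel_measurable M"
  shows "lmmm b \<alpha> h \<Gamma> V \<gamma> t \<in> borel_measurable M"
  unfolding lmmm_def[abs_def] by measurable

text \<open>
  Exactly one cell contains \<open>V i\<close>, and there \<open>pi\<^sup>2 * j\<^sup>2 / 3\<close> is the reciprocal of the density of the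
  marks. Its power \<open>1 / \<alpha>\<close> combines with that of \<open>\<Gamma> i\<close> into a power of \<open>level i\<close>.
\<close>

lemma lmmm_eq_fkl_series:
  assumes MP: "marked_poisson M \<Gamma> N' \<gamma> V mark_density"
    and \<alpha>: "0 < \<alpha> t" "\<alpha> t < 2" and h: "0 < h t" "h t < 1"
  shows "AE \<omega> in M. lmmm b \<alpha> h \<Gamma> V \<gamma> t \<omega> =
    marked_poisson.fkl_series \<Gamma> \<gamma> V mark_density (fkl_kernel (b t * stable_const (\<alpha> t) powr (1 / \<alpha> t)) (1 / \<alpha> t) (h t - 1 / \<alpha> t) t) \<omega>"
proof -
  interpret marked_poisson M \<Gamma> N' \<gamma> V mark_density by fact
  let ?\<kappa> = "b t * stable_const (\<alpha> t) powr (1 / \<alpha> t)" and ?p = "h t - 1 / \<alpha> t"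
  have "truncated_energy (fkl_kernel 1 (1 / \<alpha> t) ?p t) < \<infinity>"
    using stable_integrand_energy(1)[OF \<alpha> kernel_increment_stable_integrand[OF \<alpha> h], of 1 t]
    by (simp add: fkl_kernel_def[abs_def])
  from AE_fkl_summable[OF fkl_kernel_measurable this] arrival_pos
  show ?thesis
  proof eventually_elim
    case (elim \<omega>)
    have summand: "(\<Sum>j. \<gamma> i \<omega> * \<Gamma> i \<omega> powr (- 1 / \<alpha> t) *
      (\<bar>t - V i \<omega>\<bar> powr ?p - \<bar>V i \<omega>\<bar> powr ?p) *
      (pi\<^sup>2 * (real (Suc j))\<^sup>2 / 3) powr (1 / \<alpha> t) * indicator (cell (Suc j)) (V i \<omega>))
      = \<gamma> i \<omega> * fkl_kernel 1 (1 / \<alpha> t) ?p t (level i \<omega>) (V i \<omega>)" for i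
    proof -
      let ?c = "pi\<^sup>2 * (real (Suc (cell_index (V i \<omega>))))\<^sup>2 / 3"
      have "mark_density (V i \<omega>) = inverse ?c" by (simp add: mark_density_eq)
      then have "?c powr (1 / \<alpha> t) = mark_density (V i \<omega>) powr (- (1 / \<alpha> t))"
        by (simp only: powr_minus inverse_powr) simp
      moreover have "level i \<omega> powr (- (1 / \<alpha> t)) = \<Gamma> i \<omega> powr (- 1 / \<alpha> t) * mark_density (V i \<omega>) powr (- (1 / \<alpha> t))"
        using elim(2) mark_density_pos[of "V i \<omega>"] by (simp add: level_def powr_mult less_imp_le)
      ultimately show ?thesis
        unfolding suminf_cells[of "\<lambda>j. \<gamma> i \<omega> * \<Gamma> i \<omega> powr (- 1 / \<alpha> t) *
          (\<bar>t - V i \<omega>\<bar> powr ?p - \<bar>V i \<omega>\<bar> powr ?p) * (pi\<^sup>2 * (real (Suc j))\<^sup>2 / 3) powr (1 / \<alpha> t)" "V i \<omega>"]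
        by (simp add: fkl_kernel_def kernel_increment_def)
    qed
    have "lmmm b \<alpha> h \<Gamma> V \<gamma> t \<omega> = ?\<kappa> * (\<Sum>i. \<gamma> i \<omega> * fkl_kernel 1 (1 / \<alpha> t) ?p t (level i \<omega>) (V i \<omega>))"
      unfolding lmmm_def summand ..
    also have "\<dots> = (\<Sum>i. ?\<kappa> * (\<gamma> i \<omega> * fkl_kernel 1 (1 / \<alpha> t) ?p t (level i \<omega>) (V i \<omega>)))"
      using elim(1) by (rule suminf_mult[symmetric])
    also have "\<dots> = fkl_series (fkl_kernel ?\<kappa> (1 / \<alpha> t) ?p t) \<omega>"
      by (simp add: fkl_series_def fkl_kernel_def mult_ac)
    finally show ?case .
  qed
qed

lemma lfsm_eq_integral_kernel: "lfsm I \<alpha> H t = I (kernel_increment (H - 1 / \<alpha>) t)"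
  by (simp add: lfsm_def kernel_increment_def[abs_def])

lemma lfsm_combination_char:
  fixes t \<theta> :: "nat \<Rightarrow> real" and n :: nat
  assumes I: "sas_integral N \<alpha> I" and \<alpha>: "0 < \<alpha>" "\<alpha> < 2" and H: "0 < H" "H < 1"
  shows "(\<integral>\<omega>. iexp (\<Sum>k<n. \<theta> k * (b * lfsm I \<alpha> H (t k) \<omega>)) \<partial>N)
    = complex_of_real (exp (- (\<bar>b\<bar> powr \<alpha> * (\<integral>x. \<bar>\<Sum>k<n. \<theta> k * kernel_increment (H - 1 / \<alpha>) (t k) x\<bar> powr \<alpha> \<partial>lborel))))"
proof -
  define g where "g x = (\<Sum>k<n. \<theta> k * kernel_increment (H - 1 / \<alpha>) (t k) x)" for x
  note k = kernel_increment_stable_integrand[OF \<alpha> H]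
  have g: "g \<in> stable_integrand \<alpha>" unfolding g_def by (rule stable_integrand_sum[OF \<alpha>(1) k])
  have Im[measurable]: "I f \<in> borel_measurable N" if "f \<in> stable_integrand \<alpha>" for f
    using I that by (auto simp: sas_integral_def)
  have [measurable]: "I g \<in> borel_measurable N" "I (kernel_increment (H - 1 / \<alpha>) s) \<in> borel_measurable N" for s
    using g k by (auto intro: Im)
  have "AE \<omega> in N. I g \<omega> = (\<Sum>k<n. \<theta> k * I (kernel_increment (H - 1 / \<alpha>) (t k)) \<omega>)"
    unfolding g_def by (rule sas_integral_sum[OF I \<alpha>(1) k])
  then have "(\<integral>\<omega>. iexp (\<Sum>k<n. \<theta> k * (b * lfsm I \<alpha> H (t k) \<omega>)) \<partial>N) = (\<integral>\<omega>. iexp (b * I g \<omega>) \<partial>N)"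
    unfolding lfsm_eq_integral_kernel
  proof (intro integral_cong_AE)
    assume "AE \<omega> in N. I g \<omega> = (\<Sum>k<n. \<theta> k * I (kernel_increment (H - 1 / \<alpha>) (t k)) \<omega>)"
    then show "AE \<omega> in N. iexp (\<Sum>k<n. \<theta> k * (b * I (kernel_increment (H - 1 / \<alpha>) (t k)) \<omega>)) = iexp (b * I g \<omega>)"
    proof eventually_elim
      case (elim \<omega>)
      have "(\<Sum>k<n. \<theta> k * (b * I (kernel_increment (H - 1 / \<alpha>) (t k)) \<omega>)) = b * I g \<omega>"
        unfolding elim by (simp add: sum_distrib_left mult_ac)
      then show ?case by (simp only:)
    qed
  qed measurable
  also have "\<dots> = char (distr N borel (I g)) b"
    unfolding char_def by (subst integral_distr) auto
  also have "\<dots> = complex_of_real (exp (- (\<bar>b\<bar> powr \<alpha> * (\<integral>x. \<bar>g x\<bar> powr \<alpha> \<partial>lborel))))"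
    using I g by (auto simp: sas_integral_def)
  finally show ?thesis by (simp only: g_def)
qed

text \<open>
  A vanishing value at time 1 would have the characteristic function 1, which forces the kernel to vanish
  almost everywhere. But \<open>1 - x\<close> and \<open>x\<close> have different powers for \<open>0 < x < 1 / 2\<close>.
\<close>

lemma lfsm_nontrivial:
  assumes I: "sas_integral N \<alpha> I" and \<alpha>: "0 < \<alpha>" "\<alpha> < 2" and H: "0 < H" "H < 1" and ne: "H \<noteq> 1 / \<alpha>"
  shows "\<not> (AE \<omega> in N. lfsm I \<alpha> H 1 \<omega> = 0)"
proof
  assume zero: "AE \<omega> in N. lfsm I \<alpha> H 1 \<omega> = 0"
  interpret N: prob_space N using I by (simp add: sas_integral_def)
  let ?k = "kernel_increment (H - 1 / \<alpha>) 1"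
  have k: "?k \<in> stable_integrand \<alpha>" by (rule kernel_increment_stable_integrand[OF \<alpha> H])
  then have int: "integrable lborel (\<lambda>x. \<bar>?k x\<bar> powr \<alpha>)" by (simp add: stable_integrand_def)
  have [measurable]: "I ?k \<in> borel_measurable N" using I k by (auto simp: sas_integral_def)
  have "complex_of_real (exp (- (\<bar>1\<bar> powr \<alpha> * (\<integral>x. \<bar>?k x\<bar> powr \<alpha> \<partial>lborel)))) = char (distr N borel (I ?k)) 1"
    using I k by (auto simp: sas_integral_def)
  also have "\<dots> = (\<integral>\<omega>. iexp (1 * I ?k \<omega>) \<partial>N)" unfolding char_def by (subst integral_distr) auto
  also have "\<dots> = (\<integral>\<omega>. 1 \<partial>N)"
    using zero unfolding lfsm_eq_integral_kernel by (intro integral_cong_AE) auto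
  also have "\<dots> = 1" by (simp add: N.prob_space)
  finally have "(\<integral>x. \<bar>?k x\<bar> powr \<alpha> \<partial>lborel) = 0" by (simp flip: of_real_exp)
  then have "AE x in lborel. \<bar>?k x\<bar> powr \<alpha> = 0"
    using integral_nonneg_eq_0_iff_AE[OF int] by simp
  then have "AE x in lborel. x \<notin> {0<..<1/2::real}"
  proof (rule AE_mp, intro AE_I2 impI notI)
    fix x :: real assume x: "\<bar>?k x\<bar> powr \<alpha> = 0" "x \<in> {0<..<1/2}"
    then have "(1 - x) powr (H - 1 / \<alpha>) = x powr (H - 1 / \<alpha>)" by (simp add: kernel_increment_def)
    then have "(H - 1 / \<alpha>) * ln (1 - x) = (H - 1 / \<alpha>) * ln x" using x by (simp add: powr_def)
    then have "ln (1 - x) = ln x" using ne by simp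
    then show False using x by simp
  qed
  then have "emeasure lborel {x \<in> space lborel. x \<in> {0<..<1/2::real}} = 0" by (rule emeasure_eq_0_AE)
  moreover have "{x \<in> space lborel. x \<in> {0<..<1/2::real}} = {0<..<1/2}" by auto
  ultimately show False by simp
qed

theorem theorem9:
  fixes M :: "'a measure" and N :: "'b measure"
    and b \<alpha> h :: "real \<Rightarrow> real" and c d u :: real
    and \<Gamma> V \<gamma> :: "nat \<Rightarrow> 'a \<Rightarrow> real"
    and I :: "(real \<Rightarrow> real) \<Rightarrow> 'b \<Rightarrow> real"
  assumes "prob_space M"
    and "b C1_differentiable_on UNIV" and "\<And>t. 0 < b t"
    and "\<alpha> C1_differentiable_on UNIV" and "0 < c" and "d < 2" and "\<And>t. \<alpha> t \<in> {c..d}"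
    and "h C1_differentiable_on UNIV" and "\<And>t. h t \<in> {0<..<1}"
    and "poisson_arrival_times M 1 \<Gamma>"
    and "prob_space.indep_vars M (\<lambda>_. borel) V UNIV"
    and "\<And>i. distributed M lborel (V i) (\<lambda>x. ennreal (mark_density x))"
    and "prob_space.indep_vars M (\<lambda>_. borel) \<gamma> UNIV"
    and "\<And>i. measure M {\<omega> \<in> space M. \<gamma> i \<omega> = 1} = 1 / 2"
    and "\<And>i. measure M {\<omega> \<in> space M. \<gamma> i \<omega> = - 1} = 1 / 2"
    and "prob_space.indep_vars M (\<lambda>_. PiM UNIV (\<lambda>_. borel))
          (\<lambda>k \<omega> i. ([\<Gamma>, V, \<gamma>] ! k) i \<omega>) {..<3::nat}"
    and "sas_integral N (\<alpha> u) I"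
  shows "(h u \<noteq> 1 / \<alpha> u \<longrightarrow>
            localisable_with M (lmmm b \<alpha> h \<Gamma> V \<gamma>) (h u) u
              N (\<lambda>t \<omega>. b u * lfsm I (\<alpha> u) (h u) t \<omega>)) \<and>
         (h u = 1 / \<alpha> u \<longrightarrow>
            fdd_tangent M (lmmm b \<alpha> h \<Gamma> V \<gamma>) (h u) u
              N (\<lambda>t \<omega>. b u * lfsm I (\<alpha> u) (h u) t \<omega>))"
proof -
  interpret prob_space M by fact
  obtain N' where "poisson_points M \<Gamma> N'" using poisson_arrival_timesE[OF assms(10)] .
  then have MP: "marked_poisson M \<Gamma> N' \<gamma> V mark_density"
    using assms(1,11-16) independent_of_triple[OF assms(1,16)]
    by (auto simp: marked_poisson_def marked_poisson_axioms_def rademacher_def rademacher_axioms_def mark_density_pos)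
  interpret MP: marked_poisson M \<Gamma> N' \<gamma> V mark_density by fact
  have N: "prob_space N" using assms(17) by (simp add: sas_integral_def)
  have \<alpha>: "0 < \<alpha> t" "\<alpha> t < 2" and h: "0 < h t" "h t < 1" for t
    using assms(5,6) assms(7)[of t] assms(9)[of t] by auto
  define \<kappa> \<beta> p where "\<kappa> t = b t * stable_const (\<alpha> t) powr (1 / \<alpha> t)" and "\<beta> t = 1 / \<alpha> t" and "p t = h t - \<beta> t" for t
  let ?Y = "lmmm b \<alpha> h \<Gamma> V \<gamma>" and ?H = "h u"
  let ?L = "\<lambda>t \<omega>. b u * lfsm I (\<alpha> u) ?H t \<omega>"
  let ?K = "\<lambda>s. fkl_kernel (\<kappa> s) (\<beta> s) (p s)"
  have Y_meas: "?Y t \<in> borel_measurable M" for t by (rule lmmm_measurable) measurable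
  have L_meas: "?L t \<in> borel_measurable N" for t
    using assms(17) kernel_increment_stable_integrand[OF \<alpha> h, of u u t]
    by (auto simp: lfsm_eq_integral_kernel sas_integral_def)
  have energy: "truncated_energy (?K s t) < \<infinity>" for s t
    using stable_integrand_energy(1)[OF \<alpha> kernel_increment_stable_integrand[OF \<alpha> h], of "\<kappa> s" s s t]
    by (simp add: fkl_kernel_def[abs_def] p_def \<beta>_def)
  have Y_eq: "AE \<omega> in M. ?Y t \<omega> = MP.fkl_series (?K t t) \<omega>" for t
    using lmmm_eq_fkl_series[OF MP, of \<alpha> t h b] \<alpha> h by (simp add: \<kappa>_def \<beta>_def p_def)
  \<comment> \<open>the increment with the parameters frozen at \<open>u\<close>\<close>
  define A where "A r t = MP.fkl_series (\<lambda>z y. r powr (- ?H) * (?K u (u + r * t) z y - ?K u u z y))" for r t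
  have A_meas: "A r t \<in> borel_measurable M" for r t
    unfolding A_def by (rule MP.measurable_fkl_series) (simp add: fkl_kernel_def split_beta')
  have lip_inv: "lipschitz_at \<beta> u"
  proof -
    have "lipschitz_at (\<lambda>t. inverse (\<alpha> t)) u"
      using \<alpha>(1)[of u] by (intro lipschitz_at_compose[OF C1_imp_lipschitz_at[OF assms(4)]] DERIV_imp_lipschitz_at[OF DERIV_inverse]) auto
    then show ?thesis by (simp add: \<beta>_def[abs_def] divide_inverse)
  qed
  have lip: "lipschitz_at \<kappa> u" "lipschitz_at p u"
    unfolding \<kappa>_def p_def
    by (intro lipschitz_at_scale[where c = c and d = d] lipschitz_at_diff C1_imp_lipschitz_at lip_inv assms)+
  have "fdd_tendsto M (rescaled_increment ?Y ?H u) N ?L (at_right 0)"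
  proof (rule fdd_tendsto_perturbation[OF assms(1) N _ A_meas L_meas])
    show "rescaled_increment ?Y ?H u r t \<in> borel_measurable M" for r t
      unfolding rescaled_increment_def[abs_def] using Y_meas by measurable
    show "\<forall>\<^sub>F r in at_right 0. \<forall>(n::nat) t \<theta>. (\<integral>\<omega>. iexp (\<Sum>k<n. \<theta> k * A r (t k) \<omega>) \<partial>M) = (\<integral>\<omega>. iexp (\<Sum>k<n. \<theta> k * ?L (t k) \<omega>) \<partial>N)"
      using eventually_at_right_less[of 0]
    proof eventually_elim
      case (elim r)
      \<comment> \<open>the normalising constant of the series cancels\<close>
      have "\<bar>\<kappa> u\<bar> powr \<alpha> u / stable_const (\<alpha> u) = \<bar>b u\<bar> powr \<alpha> u"
      proof -
        have sc: "0 < stable_const (\<alpha> u)" using levy_moment_pos[OF \<alpha>] stable_const_eq(1)[OF \<alpha>] by simp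
        have "\<bar>\<kappa> u\<bar> powr \<alpha> u = \<bar>b u\<bar> powr \<alpha> u * (stable_const (\<alpha> u) powr (1 / \<alpha> u)) powr \<alpha> u"
          by (simp add: \<kappa>_def abs_mult powr_mult)
        also have "(stable_const (\<alpha> u) powr (1 / \<alpha> u)) powr \<alpha> u = stable_const (\<alpha> u)"
          using sc \<alpha>(1)[of u] by (simp add: powr_powr)
        finally show ?thesis using sc by simp
      qed
      note scale = this
      show ?case
      proof (intro allI)
        fix n :: nat and t \<theta> :: "nat \<Rightarrow> real"
        show "(\<integral>\<omega>. iexp (\<Sum>k<n. \<theta> k * A r (t k) \<omega>) \<partial>M) = (\<integral>\<omega>. iexp (\<Sum>k<n. \<theta> k * ?L (t k) \<omega>) \<partial>N)"
          unfolding A_def \<beta>_def p_def MP.frozen_series_char[OF \<alpha>[of u] h[of u] elim]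
            lfsm_combination_char[OF assms(17) \<alpha>[of u] h[of u]] scale ..
      qed
    qed
    show "((\<lambda>r. measure M {\<omega> \<in> space M. \<bar>rescaled_increment ?Y ?H u r t \<omega> - A r t \<omega>\<bar> > \<epsilon>}) \<longlongrightarrow> 0) (at_right 0)"
      if \<epsilon>: "0 < \<epsilon>" for t \<epsilon>
    proof -
      \<comment> \<open>the error made by freezing the parameters\<close>
      define B where "B r = MP.fkl_series (\<lambda>z y. r powr (- ?H) * (?K (u + r * t) (u + r * t) z y - ?K u (u + r * t) z y))" for r
      have B_meas: "B r \<in> borel_measurable M" for r
        unfolding B_def by (rule MP.measurable_fkl_series) (simp add: fkl_kernel_def split_beta')
      have eq: "AE \<omega> in M. rescaled_increment ?Y ?H u r t \<omega> - A r t \<omega> = B r \<omega>" for r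
        using Y_eq[of "u + r * t"] Y_eq[of u]
          MP.fkl_series_scaled_diff[OF fkl_kernel_measurable energy fkl_kernel_measurable energy, of "r powr (- ?H)" "u + r * t" "u + r * t" u "u + r * t"]
          MP.fkl_series_scaled_diff[OF fkl_kernel_measurable energy fkl_kernel_measurable energy, of "r powr (- ?H)" u "u + r * t" u u]
        by eventually_elim (simp add: rescaled_increment_def A_def B_def algebra_simps)
      have "measure M {\<omega> \<in> space M. \<bar>rescaled_increment ?Y ?H u r t \<omega> - A r t \<omega>\<bar> > \<epsilon>} = measure M {\<omega> \<in> space M. \<epsilon> < \<bar>B r \<omega>\<bar>}" for r
      proof (rule finite_measure_eq_AE)
        show "AE \<omega> in M. \<omega> \<in> {\<omega> \<in> space M. \<bar>rescaled_increment ?Y ?H u r t \<omega> - A r t \<omega>\<bar> > \<epsilon>} \<longleftrightarrow> \<omega> \<in> {\<omega> \<in> space M. \<epsilon> < \<bar>B r \<omega>\<bar>}"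
          using eq[of r] by eventually_elim simp
        have [measurable]: "?Y s \<in> borel_measurable M" "A r t \<in> borel_measurable M" "B r \<in> borel_measurable M" for s
          by (fact Y_meas A_meas B_meas)+
        show "{\<omega> \<in> space M. \<bar>rescaled_increment ?Y ?H u r t \<omega> - A r t \<omega>\<bar> > \<epsilon>} \<in> sets M" "{\<omega> \<in> space M. \<epsilon> < \<bar>B r \<omega>\<bar>} \<in> sets M"
          unfolding rescaled_increment_def by measurable
      qed
      moreover have "((\<lambda>r. measure M {\<omega> \<in> space M. \<epsilon> < \<bar>B r \<omega>\<bar>}) \<longlongrightarrow> 0) (at_right 0)"
        unfolding B_def
      proof (rule MP.frozen_parameters_error[OF lip(1) lip_inv lip(2) h _ _ \<epsilon>])
        show "1 / 2 < \<beta> u" using \<alpha>[of u] by (simp add: \<beta>_def field_simps)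
        show "p u = ?H - \<beta> u" by (simp add: p_def)
      qed
      ultimately show ?thesis by simp
    qed
  qed
  then have tangent: "fdd_tangent M ?Y ?H u N ?L"
    using assms(1) N Y_meas L_meas by (simp add: fdd_tangent_def stoch_process_def)
  have "nontrivial_process N ?L" if "h u \<noteq> 1 / \<alpha> u"
    unfolding nontrivial_process_def using lfsm_nontrivial[OF assms(17) \<alpha> h that] assms(3)[of u] by (intro exI[of _ 1]) simp
  with tangent show ?thesis unfolding localisable_with_def by blast
qed

end
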